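(* Let $\xi_0,\xi_1,\ldots$ be non-degenerate i.i.d. complex-valued random variables such that $\mathbb{E}\log(1+|\xi_0|)<\infty$. Let $\alpha>0$, $\beta\in\mathbb{R}$, and let $w_0,w_1,\ldots$ be a complex sequence satisfying $$\log|w_k|=-\alpha(k\log k-k)-\beta k+o(k),\qquad k\to\infty .$$ Let $W_n(z)=\sum_{k=0}^n\xi_kw_kz^k$. Then, with probability $1$, as $n\to\infty$ the sequence of random measures $\frac1n\mu_{W_n}(e^{\beta}n^{\alpha}\,\cdot)$ converges to the deterministic probability measure having the density $$z\mapsto\frac1{2\pi\alpha}|z|^{\frac1\alpha-2}\,\mathbb{1}_{\{|z|<1\}}$$ with respect to the Lebesgue measure on $\mathbb{C}$.
   Context: A random variable is non-degenerate if it is not almost surely equal to a constant. For a polynomial $G\not\equiv0$, $\mu_G=\sum_{z:G(z)=0}n_G(z)\,\delta_z$ is the measure on $\mathbb{C}$ counting zeros with multiplicity $n_G(z)$. For a measure $\mu$ on $\mathbb{C}$ and $c>0$, $\mu(c\,\cdot)$ is the measure $B\mapsto\mu(cB)$; thus $\mu_{W_n}(e^\beta n^\alpha\,\cdot)$ counts the points $z/(e^\beta n^\alpha)$, where $z$ runs over the zeros of $W_n$. Almost surely $W_n\not\equiv0$ for all large $n$; when $W_n\equiv0$ the measure may be given any value, e.g. $0$. Random measures $\mu_n$ converge to $\mu$ with probability $1$ (a.s.) if, for every continuous compactly supported $\varphi:\mathbb{C}\to\mathbb{R}$, $\int\varphi\,d\mu_n\to\int\varphi\,d\mu$ a.s.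 *)

theory Defs
  imports "HOL-Probability.Probability" "HOL-Computational_Algebra.Polynomial"
    "HOL-Library.Landau_Symbols"
begin

definition nondegenerate :: "'a measure \<Rightarrow> ('a \<Rightarrow> complex) \<Rightarrow> bool" where
  "nondegenerate M X \<longleftrightarrow> \<not> (\<exists>c. AE \<omega> in M. X \<omega> = c)"

definition random_poly ::
  "(nat \<Rightarrow> 'a \<Rightarrow> complex) \<Rightarrow> (nat \<Rightarrow> complex) \<Rightarrow> nat \<Rightarrow> 'a \<Rightarrow> complex poly" where
  "random_poly \<xi> w n \<omega> = (\<Sum>k\<le>n. monom (\<xi> k \<omega> * w k) k)"

lemma poly_random_poly: "poly (random_poly \<xi> w n \<omega>) z = (\<Sum>k\<le>n. \<xi> k \<omega> * w k * z ^ k)"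
  by (simp add: random_poly_def poly_sum poly_monom)

text \<open>The zero polynomial, which has no zero counting measure, is assigned the null measure.\<close>

definition zero_measure :: "complex poly \<Rightarrow> complex measure" where
  "zero_measure G =
    (if G = 0 then null_measure borel
     else measure_of UNIV (sets borel)
       (\<lambda>B. \<Sum>z | poly G z = 0. of_nat (order z G) * emeasure (return borel z) B))"

lemma sets_zero_measure [simp, measurable_cong]: "sets (zero_measure G) = sets borel"
  by (simp add: zero_measure_def sets.sigma_sets_eq[of borel, simplified])

lemma space_zero_measure [simp]: "space (zero_measure G) = UNIV"
  using sets_eq_imp_space_eq[OF sets_zero_measure] by simp

text \<open>Since \<^const>\<open>measure_of\<close> falls back to the null measure when its argument is
  not a measure, we check that this does not happen.\<close>

lemma emeasure_zero_measure:
  assumes "G \<noteq> 0" "B \<in> sets borel"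
  shows "emeasure (zero_measure G) B =
    (\<Sum>z | poly G z = 0. of_nat (order z G) * indicator B z)"
proof -
  have "emeasure (zero_measure G) B =
    (\<Sum>z | poly G z = 0. of_nat (order z G) * emeasure (return borel z) B)"
  proof (rule emeasure_measure_of)
    show "zero_measure G = measure_of UNIV (sets borel)
       (\<lambda>B. \<Sum>z | poly G z = 0. of_nat (order z G) * emeasure (return borel z) B)"
      using assms by (simp add: zero_measure_def)
    show "countably_additive (sets (zero_measure G))
       (\<lambda>B. \<Sum>z | poly G z = 0. of_nat (order z G) * emeasure (return borel z) B)"
    proof (rule countably_additiveI)
      fix A :: "nat \<Rightarrow> complex set"
      assume A: "range A \<subseteq> sets (zero_measure G)" "disjoint_family A"
      have s: "(\<Sum>i. emeasure (return borel z) (A i)) = emeasure (return borel z) (\<Union>i. A i)" for z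
        using A by (intro suminf_emeasure) auto
      show "(\<Sum>i. \<Sum>z | poly G z = 0. of_nat (order z G) * emeasure (return borel z) (A i)) =
        (\<Sum>z | poly G z = 0. of_nat (order z G) * emeasure (return borel z) (\<Union>i. A i))"
        by (subst suminf_sum) (auto simp: s)
    qed
  qed (use assms in \<open>auto simp: positive_def\<close>)
  then show ?thesis using assms by simp
qed

text \<open>The measure \<open>B \<mapsto> \<mu> (c B)\<close>, as a push-forward.\<close>

definition dilate :: "real \<Rightarrow> complex measure \<Rightarrow> complex measure" where
  "dilate c \<mu> = distr \<mu> borel (\<lambda>z. z / of_real c)"

lemma emeasure_dilate:
  assumes "c > 0" "sets \<mu> = sets borel" "B \<in> sets borel"
  shows "emeasure (dilate c \<mu>) B = emeasure \<mu> ((\<lambda>z. of_real c * z) ` B)"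
proof -
  have "(\<lambda>z. z / of_real c) -` B = (\<lambda>z. of_real c * z) ` B"
    using assms(1) by (force simp: image_iff field_simps)
  moreover have "(\<lambda>z. z / of_real c) \<in> borel_measurable \<mu>"
    unfolding measurable_cong_sets[OF assms(2) refl] by measurable
  moreover have "space \<mu> = UNIV"
    using sets_eq_imp_space_eq[OF assms(2)] by simp
  ultimately show ?thesis
    using assms(3) by (simp add: dilate_def emeasure_distr)
qed

definition limit_measure :: "real \<Rightarrow> complex measure" where
  "limit_measure \<alpha> = density lborel
    (\<lambda>z. ennreal (1 / (2 * pi * \<alpha>) * norm z powr (1 / \<alpha> - 2) * indicator {z. norm z < 1} z))"

text \<open>The exceptional null set may depend on the test function.\<close>

definition converges_as ::
  "'a measure \<Rightarrow> (nat \<Rightarrow> 'a \<Rightarrow> complex measure) \<Rightarrow> complex measure \<Rightarrow> bool" where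
  "converges_as M \<mu> \<nu> \<longleftrightarrow>
    (\<forall>\<phi> :: complex \<Rightarrow> real.
      continuous_on UNIV \<phi> \<longrightarrow> compact (closure {z. \<phi> z \<noteq> 0}) \<longrightarrow>
      (AE \<omega> in M. (\<lambda>n. \<integral>z. \<phi> z \<partial>(\<mu> n \<omega>)) \<longlonglongrightarrow> (\<integral>z. \<phi> z \<partial>\<nu>)))"

end

theory Submission
  imports Defs "HOL-Complex_Analysis.Complex_Analysis" "HOL-Real_Asymp.Real_Asymp"
    "HOL-Computational_Algebra.Fundamental_Theorem_Algebra"
begin

text \<open>
  Write \<open>u\<^sub>n(z) = 1/n log |W\<^sub>n(e\<^sup>\<beta> n\<^sup>\<alpha> z)|\<close>. This is the logarithmic potential of the rescaled zeros, and
  its maximal term suggests the limit \<open>U(z) = \<alpha> |z|\<^bsup>1/\<alpha>\<^esup>\<close> for \<open>|z| \<le> 1\<close>, \<open>U(z) = \<alpha> + log |z|\<close> otherwise,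
  which is the potential of the limit measure. Since the log moment makes the \<open>\<xi>\<^sub>k\<close> subexponential,
  \<open>u\<^sub>n \<le> U + \<epsilon>\<close> almost surely and locally uniformly. Conversely, \<open>u\<^sub>n \<ge> U - \<epsilon>\<close> at some point of any given
  small disc, up to an event of exponentially small probability: were \<open>u\<^sub>n\<close> smaller on the whole disc,
  a number of coefficients proportional to \<open>n\<close> would be determined by the others up to a tiny error.
  As \<open>u\<^sub>n\<close> is subharmonic, the two bounds force \<open>u\<^sub>n \<rightarrow> U\<close> locally in \<open>L\<^sup>1\<close>. Finally, every test function
  is a uniform limit of logarithmic potentials of bounded functions \<open>g\<close> of compact support and
  integral 0, and against the potential of \<open>g\<close> the zero measure integrates to \<open>\<integral> u\<^sub>n g\<close>.
\<close>

section \<open>Circular means of the logarithm\<close>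

text \<open>Almost sure convergence calls for summable error probabilities. Smallness of
  \<open>W\<^sub>n\<close> at one point restricts a single linear combination of the
  \<open>\<xi> k\<close>: given the others, it pins one coefficient and costs one fixed factor.
  Smallness on a disc pins a number of coefficients proportional to \<open>n\<close>. Hence the
  lower bound is claimed only somewhere in each disc, and the submean value property has to spread
  it. Test functions are merely continuous, so there is no Laplacian to apply; the difference
  between a circular average and the function itself takes its place. It is bounded, so local
  convergence in \<open>L1\<close> is enough, and it has integral 0, which removes additive
  constants: \<open>\<alpha>\<close> on the limit side, the leading coefficient and the dilation on
  the side of the zeros. All logarithmic integrals rest on one formula: the mean of the logarithmic
  kernel over a circle is \<open>ln\<close> of the larger of two moduli. Since
  \<open>ln 0 = 0\<close>, potentials take a wrong finite value at their poles. Pointwise bounds are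
  therefore stated off the zeros, which form a null set.\<close>

lemma nn_integral_lborel_shift:
  fixes f :: "'a::euclidean_space \<Rightarrow> ennreal"
  assumes [measurable]: "f \<in> borel_measurable borel"
  shows "(\<integral>\<^sup>+x. f (x + y) \<partial>lborel) = (\<integral>\<^sup>+x. f x \<partial>lborel)"
proof -
  have "(\<integral>\<^sup>+x. f x \<partial>lborel) = (\<integral>\<^sup>+x. f x \<partial>(distr lborel borel ((+) y)))"
    by (simp add: lborel_distr_plus)
  also have "\<dots> = (\<integral>\<^sup>+x. f (y + x) \<partial>lborel)"
    by (subst nn_integral_distr) auto
  finally show ?thesis by (simp add: add.commute)
qed

text \<open>Both measures are translation invariant; comparing them through the product measure, on a
  set times a disc centred at the origin, shows that they agree (uniqueness of Haar measure).\<close>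

lemma lborel_rotation:
  fixes c :: complex
  assumes c: "norm c = 1"
  shows "distr lborel borel (\<lambda>z. c * z) = lborel"
proof (rule measure_eqI)
  have c0: "c \<noteq> 0" using assms by auto
  let ?B = "ball (0::complex) 1"
  have [measurable]: "?B \<in> sets borel" by simp
  fix A :: "complex set" assume "A \<in> sets (distr lborel borel (\<lambda>z. c * z))"
  then have [measurable]: "A \<in> sets borel" by simp
  have "emeasure (distr lborel borel ((*) c)) A * emeasure lborel ?B
      = (\<integral>\<^sup>+x. indicator A (c * x) \<partial>lborel) * (\<integral>\<^sup>+y. indicator ?B y \<partial>lborel)"
    by (simp flip: nn_integral_indicator add: nn_integral_distr)
  also have "\<dots> = (\<integral>\<^sup>+x. indicator A (c * x) * (\<integral>\<^sup>+y. indicator ?B y \<partial>lborel) \<partial>lborel)"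
    by (rule nn_integral_multc[symmetric]) measurable
  also have "\<dots> = (\<integral>\<^sup>+x. \<integral>\<^sup>+y. indicator A (c * x) * indicator ?B y \<partial>lborel \<partial>lborel)"
    by (intro nn_integral_cong nn_integral_cmult[symmetric]) measurable
  also have "\<dots> = (\<integral>\<^sup>+x. \<integral>\<^sup>+y. indicator A (c * x) * indicator ?B (y - c * x) \<partial>lborel \<partial>lborel)"
  proof (rule nn_integral_cong)
    fix x show "(\<integral>\<^sup>+y. indicator A (c * x) * indicator ?B y \<partial>lborel)
       = (\<integral>\<^sup>+y. indicator A (c * x) * indicator ?B (y - c * x) \<partial>lborel)"
      using nn_integral_lborel_shift[of "\<lambda>y. indicator A (c * x) * indicator ?B y" "- c * x"] by simp
  qed
  also have "\<dots> = (\<integral>\<^sup>+y. \<integral>\<^sup>+x. indicator A (c * x) * indicator ?B (y - c * x) \<partial>lborel \<partial>lborel)"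
    by (rule pair_sigma_finite.Fubini') (auto intro!: pair_sigma_finite.intro sigma_finite_lborel)
  \<comment> \<open>Shifting \<open>x\<close> by \<open>y / c\<close> moves the translation from the
    disc onto \<open>A\<close>. The disc factor then involves \<open>x\<close> alone and is
    insensitive to the rotation because \<open>norm c = 1\<close>.\<close>
  also have "\<dots> = (\<integral>\<^sup>+y. \<integral>\<^sup>+x. indicator A (y + c * x) * indicator ?B (- (c * x)) \<partial>lborel \<partial>lborel)"
  proof (rule nn_integral_cong)
    fix y show "(\<integral>\<^sup>+x. indicator A (c * x) * indicator ?B (y - c * x) \<partial>lborel)
       = (\<integral>\<^sup>+x. indicator A (y + c * x) * indicator ?B (- (c * x)) \<partial>lborel)"
      using nn_integral_lborel_shift[of "\<lambda>x. indicator A (c * x) * indicator ?B (y - c * x)" "y / c"] c0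
      by (simp add: algebra_simps)
  qed
  also have "\<dots> = (\<integral>\<^sup>+x. \<integral>\<^sup>+y. indicator A (y + c * x) * indicator ?B (- (c * x)) \<partial>lborel \<partial>lborel)"
    by (rule pair_sigma_finite.Fubini'[symmetric]) (auto intro!: pair_sigma_finite.intro sigma_finite_lborel)
  also have "\<dots> = (\<integral>\<^sup>+x. emeasure lborel A * indicator ?B x \<partial>lborel)"
  proof (rule nn_integral_cong)
    fix x
    have "indicator ?B (- (c * x)) = (indicator ?B x :: ennreal)"
      by (simp add: indicator_def norm_mult c)
    then show "(\<integral>\<^sup>+y. indicator A (y + c * x) * indicator ?B (- (c * x)) \<partial>lborel)
       = emeasure lborel A * indicator ?B x"
      using nn_integral_lborel_shift[of "indicator A" "c * x"] by (simp add: nn_integral_multc)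
  qed
  also have "\<dots> = emeasure lborel A * emeasure lborel ?B"
    by (simp add: nn_integral_cmult)
  finally have "emeasure (distr lborel borel ((*) c)) A * emeasure lborel ?B = emeasure lborel A * emeasure lborel ?B" .
  then have "emeasure lborel ?B * emeasure (distr lborel borel ((*) c)) A = emeasure lborel ?B * emeasure lborel A"
    by (simp only: mult.commute)
  moreover have "emeasure lborel ?B \<noteq> 0" "emeasure lborel ?B \<noteq> top"
    by (auto simp: emeasure_ball unit_ball_vol_2)
  ultimately show "emeasure (distr lborel borel ((*) c)) A = emeasure lborel A"
    unfolding ennreal_mult_cancel_left by blast
qed simp

text \<open>Mean value property at 0 for the real part of \<open>Ln (1 - y * w)\<close>, which is
  holomorphic in \<open>y\<close> and vanishes at 0. For \<open>norm w < 1\<close> the argument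
  stays in the right half-plane, away from the branch cut.\<close>

lemma circle_mean_ln_aux:
  fixes w :: complex
  assumes "norm w < 1"
  shows "((\<lambda>t. ln (norm (1 - cis (2 * pi * t) * w))) has_integral 0) {0..1}"
proof -
  define f where "f y = Ln (1 - y * w)" for y
  have ne: "1 - y * w \<notin> \<real>\<^sub>\<le>\<^sub>0" if "norm y \<le> 1" for y
  proof -
    have "norm (y * w) < 1" using that assms
      by (metis mult_left_le_one_le norm_ge_zero norm_mult order_le_less_trans)
    then have "Re (1 - y * w) > 0"
      using complex_Re_le_cmod[of "y * w"] by simp
    then show ?thesis by (metis complex_nonpos_Reals_iff not_less)
  qed
  have "f holomorphic_on ball 0 1" unfolding f_def
    by (intro holomorphic_intros) (use ne in auto)
  moreover have "continuous_on (cball 0 1) f" unfolding f_def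
    by (intro continuous_intros) (use ne in auto)
  ultimately have "((\<lambda>u. f u / (u - 0)) has_contour_integral (2 * of_real pi * \<i> * f 0)) (circlepath 0 1)"
    by (intro Cauchy_integral_circlepath) auto
  then have "((\<lambda>t. f (circlepath 0 1 t) / circlepath 0 1 t * vector_derivative (circlepath 0 1) (at t)) has_integral 0) {0..1}"
    unfolding has_contour_integral by (simp add: f_def)
  then have "((\<lambda>t. 2 * pi * \<i> * f (cis (2 * pi * t))) has_integral 0) {0..1}"
    by (rule has_integral_eq[rotated])
       (simp only: vector_derivative_circlepath, simp add: circlepath cis_conv_exp ac_simps)
  then have "((\<lambda>t. (1 / (2 * pi * \<i>)) * (2 * pi * \<i> * f (cis (2 * pi * t)))) has_integral (1 / (2 * pi * \<i>)) * 0) {0..1}"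
    by (rule has_integral_mult_right)
  then have "((\<lambda>t. f (cis (2 * pi * t))) has_integral 0) {0..1}" by simp
  then have "((\<lambda>t. Re (f (cis (2 * pi * t)))) has_integral Re 0) {0..1}"
    using has_integral_Re by blast
  moreover have "Re (f (cis (2 * pi * t))) = ln (norm (1 - cis (2 * pi * t) * w))" for t
    unfolding f_def by (rule Re_Ln) (use ne[of "cis (2 * pi * t)"] in auto)
  ultimately show ?thesis by simp
qed

text \<open>Factoring out the larger modulus leaves \<open>1 - cis (2 * pi * t) * w\<close> with
  \<open>norm w < 1\<close>. Equal moduli would put a singularity on the circle; such
  \<open>x\<close> form a null set in the area integrals below.\<close>

lemma circle_mean_ln:
  fixes x z :: complex
  assumes "norm x \<noteq> norm z"
  shows "((\<lambda>t. ln (norm (cis (2 * pi * t) * x - z))) has_integral ln (max (norm x) (norm z))) {0..1}"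
proof (cases "norm x < norm z")
  case True
  have z0: "z \<noteq> 0" using True by auto
  have n: "norm (x / z) < 1" using True z0 by (simp add: norm_divide)
  have "((\<lambda>t. ln (norm z) + ln (norm (1 - cis (2 * pi * t) * (x / z)))) has_integral (ln (norm z) + 0)) {0..1}"
    by (intro has_integral_add circle_mean_ln_aux n)
      (use has_integral_const_real[of "ln (norm z)" 0 1] in simp)
  moreover have "ln (norm z) + ln (norm (1 - cis (2 * pi * t) * (x / z))) = ln (norm (cis (2 * pi * t) * x - z))" for t
  proof -
    have "norm (cis (2 * pi * t) * x - z) = norm z * norm (1 - cis (2 * pi * t) * (x / z))"
      using z0 by (simp flip: norm_mult add: algebra_simps norm_minus_commute)
    moreover have "norm (1 - cis (2 * pi * t) * (x / z)) > 0"
      using n by (metis diff_eq_diff_eq diff_self less_irrefl norm_cis norm_mult norm_one mult_1 zero_less_norm_iff eq_iff_diff_eq_0)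
    ultimately show ?thesis using z0 by (simp add: ln_mult)
  qed
  ultimately show ?thesis using True by simp
next
  case False
  then have xz: "norm z < norm x" using assms by auto
  have x0: "x \<noteq> 0" using xz by auto
  \<comment> \<open>Reflection across the unit circle: conjugation followed by multiplication with
    \<open>cis (2 * pi * t)\<close> turns \<open>1 - cis (2 * pi * t) * w\<close> into
    \<open>cis (2 * pi * t) - z / x\<close> and keeps the modulus.\<close>
  define w where "w = cnj (z / x)"
  have n: "norm w < 1" using xz x0 by (simp add: w_def norm_divide)
  have "((\<lambda>t. ln (norm x) + ln (norm (1 - cis (2 * pi * t) * w))) has_integral (ln (norm x) + 0)) {0..1}"
    by (intro has_integral_add circle_mean_ln_aux n)
      (use has_integral_const_real[of "ln (norm x)" 0 1] in simp)
  moreover have "ln (norm x) + ln (norm (1 - cis (2 * pi * t) * w)) = ln (norm (cis (2 * pi * t) * x - z))" for t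
  proof -
    have "norm (1 - cis (2 * pi * t) * w) = norm (cnj (1 - cis (2 * pi * t) * w))"
      by (simp only: complex_mod_cnj)
    also have "\<dots> = norm (cis (2 * pi * t) * cnj (1 - cis (2 * pi * t) * w))"
      by (simp add: norm_mult)
    also have "cis (2 * pi * t) * cnj (1 - cis (2 * pi * t) * w) = cis (2 * pi * t) - z / x"
      by (simp add: w_def algebra_simps cis_cnj cis_mult)
    finally have "norm (cis (2 * pi * t) * x - z) = norm x * norm (1 - cis (2 * pi * t) * w)"
      using x0 by (simp flip: norm_mult add: algebra_simps)
    moreover have "norm (1 - cis (2 * pi * t) * w) > 0"
      using n by (metis less_irrefl norm_cis norm_mult norm_one mult_1 zero_less_norm_iff eq_iff_diff_eq_0)
    ultimately show ?thesis using x0 by (simp add: ln_mult)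
  qed
  ultimately show ?thesis using xz by (simp add: max_def)
qed

lemma circle_mean_ln_nn:
  fixes x z :: complex
  assumes "norm x \<noteq> norm z" "norm x + norm z \<le> C"
  shows "(\<integral>\<^sup>+t\<in>{0..1}. ennreal (ln (C / norm (cis (2 * pi * t) * x - z))) \<partial>lborel)
    = ennreal (ln (C / max (norm x) (norm z)))"
proof (rule nn_integral_has_integral_lebesgue')
  have C: "C > 0" using assms norm_ge_zero[of x] norm_ge_zero[of z] by linarith
  have pos: "norm (cis (2 * pi * t) * x - z) > 0" for t
  proof -
    have "cis (2 * pi * t) * x \<noteq> z"
      using assms(1) by (metis norm_cis norm_mult mult_1)
    then show ?thesis by simp
  qed
  have "max (norm x) (norm z) > 0" using assms(1) norm_ge_zero[of x] norm_ge_zero[of z] by linarith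
  then have *: "ln (C / max (norm x) (norm z)) = ln C - ln (max (norm x) (norm z))"
    using C by (simp add: ln_div)
  have **: "ln (C / norm (cis (2 * pi * t) * x - z)) = ln C - ln (norm (cis (2 * pi * t) * x - z))" for t
    using C pos[of t] by (simp add: ln_div)
  show "((\<lambda>t. ln (C / norm (cis (2 * pi * t) * x - z))) has_integral ln (C / max (norm x) (norm z))) {0..1}"
    unfolding * **
    using has_integral_const_real[of "ln C" 0 1] circle_mean_ln[OF assms(1)]
    by (intro has_integral_diff) auto
  show "0 \<le> ln (C / norm (cis (2 * pi * t) * x - z))" for t
  proof -
    have "norm (cis (2 * pi * t) * x - z) \<le> C"
      using norm_triangle_ineq4[of "cis (2 * pi * t) * x" z] assms(2) by (simp add: norm_mult)
    then show ?thesis using pos[of t] by simp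
  qed
qed

lemma AE_lborel_norm_neq: "AE x in lborel. norm (x::complex) \<noteq> r"
proof (rule AE_I[where N = "sphere 0 r"])
  show "emeasure lborel (sphere (0::complex) r) = 0"
    using negligible_sphere[of "0::complex" r] unfolding negligible_iff_null_sets
    by (simp add: null_sets_completion_iff null_setsD1)
qed auto

text \<open>The kernel is written as \<open>ln (C / norm (x - z))\<close>, which is nonnegative where \<open>f\<close> lives, so that
  Tonelli applies without any integrability assumption.\<close>

lemma radial_mean_ln:
  fixes f :: "real \<Rightarrow> ennreal" and z :: complex
  assumes [measurable]: "f \<in> borel_measurable borel"
    and f0: "\<And>s. s > \<rho> \<Longrightarrow> f s = 0" and C: "\<rho> + norm z \<le> C"
  shows "(\<integral>\<^sup>+x. f (norm x) * ennreal (ln (C / norm (x - z))) \<partial>lborel)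
    = (\<integral>\<^sup>+x. f (norm (x::complex)) * ennreal (ln (C / max (norm x) (norm z))) \<partial>lborel)"
proof -
  have rot: "(\<integral>\<^sup>+x. f (norm x) * ennreal (ln (C / norm (x - z))) \<partial>lborel)
     = (\<integral>\<^sup>+x. f (norm x) * ennreal (ln (C / norm (cis (2 * pi * t) * x - z))) \<partial>lborel)" for t
  proof -
    have "(\<integral>\<^sup>+x. f (norm x) * ennreal (ln (C / norm (x - z))) \<partial>lborel)
      = (\<integral>\<^sup>+x. f (norm x) * ennreal (ln (C / norm (x - z))) \<partial>distr lborel borel (\<lambda>x. cis (2 * pi * t) * x))"
      by (simp add: lborel_rotation)
    also have "\<dots> = (\<integral>\<^sup>+x. f (norm x) * ennreal (ln (C / norm (cis (2 * pi * t) * x - z))) \<partial>lborel)"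
      by (subst nn_integral_distr) (auto simp: norm_mult)
    finally show ?thesis .
  qed
  \<comment> \<open>Rotating the variable by \<open>t\<close> leaves the value unchanged, so it may
    be averaged over \<open>t\<close> in \<open>{0..1}\<close>; after Tonelli a circular mean
    remains for each fixed \<open>x\<close>.\<close>
  have "(\<integral>\<^sup>+x. f (norm x) * ennreal (ln (C / norm (x - z))) \<partial>lborel)
     = (\<integral>\<^sup>+t. (\<integral>\<^sup>+x. f (norm x) * ennreal (ln (C / norm (x - z))) \<partial>lborel) * indicator {0..1::real} t \<partial>lborel)"
    by (simp add: nn_integral_cmult)
  also have "\<dots> = (\<integral>\<^sup>+t. \<integral>\<^sup>+x. f (norm x) * ennreal (ln (C / norm (cis (2 * pi * t) * x - z))) * indicator {0..1::real} t \<partial>lborel \<partial>lborel)"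
  proof (rule nn_integral_cong)
    fix t :: real
    show "(\<integral>\<^sup>+x. f (norm x) * ennreal (ln (C / norm (x - z))) \<partial>lborel) * indicator {0..1::real} t
      = (\<integral>\<^sup>+x. f (norm x) * ennreal (ln (C / norm (cis (2 * pi * t) * x - z))) * indicator {0..1::real} t \<partial>lborel)"
      unfolding rot[of t] by (rule nn_integral_multc[symmetric]) measurable
  qed
  also have "\<dots> = (\<integral>\<^sup>+x. \<integral>\<^sup>+t. f (norm x) * ennreal (ln (C / norm (cis (2 * pi * t) * x - z))) * indicator {0..1::real} t \<partial>lborel \<partial>lborel)"
    by (rule pair_sigma_finite.Fubini')
      (auto intro!: pair_sigma_finite.intro sigma_finite_lborel simp: cis_conv_exp)
  also have "\<dots> = (\<integral>\<^sup>+x. f (norm x) * (\<integral>\<^sup>+t. ennreal (ln (C / norm (cis (2 * pi * t) * x - z))) * indicator {0..1::real} t \<partial>lborel) \<partial>lborel)"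
    by (subst nn_integral_cmult[symmetric]) (auto simp: mult.assoc cis_conv_exp)
  also have "\<dots> = (\<integral>\<^sup>+x. f (norm (x::complex)) * ennreal (ln (C / max (norm x) (norm z))) \<partial>lborel)"
  proof (rule nn_integral_cong_AE)
    show "AE x in lborel. f (norm x) * (\<integral>\<^sup>+t. ennreal (ln (C / norm (cis (2 * pi * t) * x - z))) * indicator {0..1::real} t \<partial>lborel)
      = f (norm x) * ennreal (ln (C / max (norm x) (norm z)))"
      using AE_lborel_norm_neq[of "norm z"]
    proof eventually_elim
      case (elim x)
      show ?case
      proof (cases "norm x \<le> \<rho>")
        case True
        then show ?thesis using C by (subst circle_mean_ln_nn[OF elim]) auto
      qed (use f0[of "norm x"] in auto)
    qed
  qed
  finally show ?thesis .
qed

text \<open>The point is uniformity in the position \<open>w\<close> of the pole; this gives the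
  domination used for integrability and for Fubini.\<close>

lemma nn_integral_ln_norm_cball:
  assumes R: "R \<ge> 0" and W: "W \<ge> 0"
  obtains D :: real where "D \<ge> 0" "\<And>w. norm w \<le> W \<Longrightarrow>
    (\<integral>\<^sup>+a\<in>cball 0 R. ennreal \<bar>ln (norm (a - w))\<bar> \<partial>(lborel::complex measure)) \<le> ennreal D"
proof
  define \<rho> where "\<rho> = R + W + 1"
  define C where "C = \<rho> + 1"
  have C1: "C \<ge> 1" "ln C \<ge> 0" using R W by (auto simp: C_def \<rho>_def)
  let ?K = "\<lambda>r. cball (0::complex) r"
  have [measurable]: "?K r \<in> sets borel" for r by simp
  show "0 \<le> ln C * (pi * \<rho>\<^sup>2) + ln C * (pi * R\<^sup>2)" using C1 by simp
  have m: "emeasure lborel (?K r) = ennreal (pi * r\<^sup>2)" if "r \<ge> 0" for r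
    using that by (simp add: emeasure_cball unit_ball_vol_2)
  fix w :: complex assume w: "norm w \<le> W"
  \<comment> \<open>The pole is translated to 1 rather than to 0: the circular mean then involves
    \<open>max (norm x) 1\<close>, which is at least 1, and so is bounded by \<open>ln C\<close>.
    The translated disc lies within radius \<open>\<rho>\<close>.\<close>
  have "(\<integral>\<^sup>+a\<in>?K R. ennreal (ln (C / norm (a - w))) \<partial>lborel)
     = (\<integral>\<^sup>+x. ennreal (ln (C / norm (x - 1))) * indicator (?K R) (x + (w - 1)) \<partial>lborel)"
    using nn_integral_lborel_shift[of "\<lambda>x. ennreal (ln (C / norm (x - w))) * indicator (?K R) x" "w - 1"]
    by (simp add: algebra_simps)
  also have "\<dots> \<le> (\<integral>\<^sup>+x. indicator {..\<rho>} (norm (x::complex)) * ennreal (ln (C / norm (x - 1))) \<partial>lborel)"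
  proof (rule nn_integral_mono)
    fix x :: complex
    have "norm x \<le> \<rho>" if "norm (x + (w - 1)) \<le> R"
    proof -
      have "norm x = norm ((x + (w - 1)) - w + 1)" by simp
      also have "\<dots> \<le> norm (x + (w - 1)) + norm w + 1"
        by (metis norm_triangle_le norm_triangle_ineq4 add_mono norm_one order_refl)
      finally show ?thesis using that w by (simp add: \<rho>_def)
    qed
    then show "ennreal (ln (C / norm (x - 1))) * indicator (?K R) (x + (w - 1))
      \<le> indicator {..\<rho>} (norm x) * ennreal (ln (C / norm (x - 1)))"
      by (auto simp: indicator_def)
  qed
  also have "\<dots> = (\<integral>\<^sup>+x. indicator {..\<rho>} (norm (x::complex)) * ennreal (ln (C / max (norm x) (norm (1::complex)))) \<partial>lborel)"
    by (rule radial_mean_ln[where \<rho> = \<rho>]) (auto simp: C_def)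
  also have "\<dots> \<le> (\<integral>\<^sup>+x. ennreal (ln C) * indicator (?K \<rho>) x \<partial>lborel)"
  proof (rule nn_integral_mono)
    fix x :: complex
    have "ln (C / max (norm x) (norm (1::complex))) \<le> ln C"
      using C1 by (simp add: ln_div)
    then show "indicator {..\<rho>} (norm x) * ennreal (ln (C / max (norm x) (norm (1::complex)))) \<le> ennreal (ln C) * indicator (?K \<rho>) x"
      by (auto simp: indicator_def intro!: ennreal_leI)
  qed
  also have "\<dots> = ennreal (ln C * (pi * \<rho>\<^sup>2))"
    using R W C1 by (simp add: nn_integral_cmult m \<rho>_def ennreal_mult)
  finally have 1: "(\<integral>\<^sup>+a\<in>?K R. ennreal (ln (C / norm (a - w))) \<partial>lborel) \<le> ennreal (ln C * (pi * \<rho>\<^sup>2))" .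
  have "(\<integral>\<^sup>+a\<in>?K R. ennreal \<bar>ln (norm (a - w))\<bar> \<partial>lborel)
      \<le> (\<integral>\<^sup>+a. ennreal (ln (C / norm (a - w))) * indicator (?K R) a + ennreal (ln C) * indicator (?K R) a \<partial>lborel)"
  proof (rule nn_integral_mono)
    fix a :: complex
    have "\<bar>ln (norm (a - w))\<bar> \<le> ln (C / norm (a - w)) + ln C \<and> 0 \<le> ln (C / norm (a - w))" if "norm a \<le> R" "a \<noteq> w"
    proof -
      have "norm (a - w) \<le> C" using norm_triangle_ineq4[of a w] that w by (simp add: C_def \<rho>_def)
      moreover have "norm (a - w) > 0" using that by simp
      ultimately have "ln (norm (a - w)) \<le> ln C" "ln (C / norm (a - w)) = ln C - ln (norm (a - w))"
        using C1 by (auto simp: ln_div)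
      then show ?thesis using C1 by (simp add: abs_if)
    qed
    then show "ennreal \<bar>ln (norm (a - w))\<bar> * indicator (?K R) a
      \<le> ennreal (ln (C / norm (a - w))) * indicator (?K R) a + ennreal (ln C) * indicator (?K R) a"
      using C1 by (cases "a = w") (auto simp: indicator_def simp flip: ennreal_plus intro!: ennreal_leI)
  qed
  also have "\<dots> = (\<integral>\<^sup>+a\<in>?K R. ennreal (ln (C / norm (a - w))) \<partial>lborel) + ennreal (ln C * (pi * R\<^sup>2))"
    using R C1 by (subst nn_integral_add) (auto simp: nn_integral_cmult m ennreal_mult)
  also have "\<dots> \<le> ennreal (ln C * (pi * \<rho>\<^sup>2)) + ennreal (ln C * (pi * R\<^sup>2))"
    using 1 by (rule add_right_mono)
  also have "\<dots> = ennreal (ln C * (pi * \<rho>\<^sup>2) + ln C * (pi * R\<^sup>2))"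
    using C1 by (simp add: ennreal_plus)
  finally show "(\<integral>\<^sup>+a\<in>?K R. ennreal \<bar>ln (norm (a - w))\<bar> \<partial>lborel) \<le> ennreal (ln C * (pi * \<rho>\<^sup>2) + ln C * (pi * R\<^sup>2))" .
qed

section \<open>The limit measure and its potential\<close>

text \<open>Polar coordinates for radial integrands. It suffices to compare half-lines
  \<open>{x<..}\<close>, whose preimages in the disc are annuli of known area.\<close>

lemma distr_norm_lborel_disc:
  "distr (density lborel (indicator (ball 0 1))) borel (norm :: complex \<Rightarrow> real)
   = density lborel (\<lambda>r. ennreal (indicator {0..1} r * (2 * pi * r)))" (is "?M = ?N")
proof (rule measure_eqI_lessThan)
  have [measurable]: "ball (0::complex) 1 \<in> sets borel" by simp
  have M: "emeasure ?M {x<..} = emeasure lborel (ball (0::complex) 1 - cball 0 x)" for x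
  proof -
    have v: "norm -` {x<..} = - cball (0::complex) x" by auto
    have [measurable]: "- cball (0::complex) x \<in> sets borel" by simp
    have "emeasure ?M {x<..} = emeasure (density lborel (indicator (ball (0::complex) 1))) (- cball 0 x)"
      unfolding v[symmetric] by (subst emeasure_distr) auto
    also have "\<dots> = (\<integral>\<^sup>+z. indicator (ball (0::complex) 1) z * indicator (- cball 0 x) z \<partial>lborel)"
      by (rule emeasure_density) auto
    also have "\<dots> = (\<integral>\<^sup>+z. indicator (ball (0::complex) 1 - cball 0 x) z \<partial>lborel)"
      by (rule nn_integral_cong) (simp add: indicator_def)
    also have "\<dots> = emeasure lborel (ball (0::complex) 1 - cball 0 x)"
      by (rule nn_integral_indicator) auto
    finally show ?thesis .
  qed
  show "emeasure ?M {x<..} < \<infinity>" for x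
  proof -
    have "emeasure ?M {x<..} \<le> emeasure lborel (ball (0::complex) 1)"
      unfolding M by (intro emeasure_mono) auto
    also have "\<dots> < \<infinity>" by (simp add: emeasure_ball)
    finally show ?thesis .
  qed
  fix x :: real
  \<comment> \<open>\<open>y\<close> is \<open>x\<close> clamped to \<open>{0..1}\<close>. The point
    \<open>r = y\<close> is exempt because for negative \<open>x\<close> it satisfies
    \<open>x < r\<close> but not \<open>y < r\<close>; it is a null set.\<close>
  have N: "emeasure ?N {x<..} = ennreal (pi - pi * y\<^sup>2)" if "0 \<le> y" "y \<le> 1"
     "\<And>r. r \<in> {0..1} \<Longrightarrow> r \<noteq> y \<Longrightarrow> x < r \<longleftrightarrow> y < r" for y
  proof -
    have "((\<lambda>r. 2 * pi * r) has_integral (pi * 1\<^sup>2 - pi * y\<^sup>2)) {y..1}"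
      by (rule fundamental_theorem_of_calculus)
        (use that in \<open>auto intro!: derivative_eq_intros simp flip: has_real_derivative_iff_has_vector_derivative\<close>)
    then have "(\<integral>\<^sup>+r\<in>{y..1}. ennreal (2 * pi * r) \<partial>lborel) = ennreal (pi - pi * y\<^sup>2)"
      by (intro nn_integral_has_integral_lebesgue') (use that in auto)
    moreover have "emeasure ?N {x<..} = (\<integral>\<^sup>+r\<in>{y..1}. ennreal (2 * pi * r) \<partial>lborel)"
    proof -
      have "AE r in lborel. ennreal (indicator {0..1} r * (2 * pi * r)) * indicator {x<..} r
         = ennreal (2 * pi * r) * indicator {y..1} r"
        using AE_lborel_singleton[of y]
        by eventually_elim (use that in \<open>auto simp: indicator_def\<close>)
      then show ?thesis
        by (simp add: emeasure_density cong: nn_integral_cong_AE)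
    qed
    ultimately show ?thesis by simp
  qed
  have B: "emeasure lborel (ball (0::complex) 1) = ennreal pi"
    by (simp add: emeasure_ball unit_ball_vol_2)
  consider "x < 0" | "0 \<le> x" "x < 1" | "1 \<le> x" by linarith
  then show "emeasure ?M {x<..} = emeasure ?N {x<..}"
  proof cases
    case 1
    then have "cball (0::complex) x = {}" by simp
    then show ?thesis using M[of x] B N[of 0] 1 by simp
  next
    case 2
    have "emeasure lborel (ball (0::complex) 1 - cball 0 x)
       = emeasure lborel (ball (0::complex) 1) - emeasure lborel (cball (0::complex) x)"
      by (rule emeasure_Diff) (use 2 in \<open>auto simp: emeasure_cball\<close>)
    also have "\<dots> = ennreal (pi - pi * x\<^sup>2)"
      using 2 by (simp add: B emeasure_cball unit_ball_vol_2 ennreal_minus)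
    finally show ?thesis using M[of x] N[of x] 2 by simp
  next
    case 3
    then have e: "ball (0::complex) 1 - cball 0 x = {}" by auto
    show ?thesis unfolding M e using N[of 1] 3 by simp
  qed
qed auto

lemma nn_integral_limit_measure:
  fixes f :: "complex \<Rightarrow> ennreal"
  assumes [measurable]: "f \<in> borel_measurable borel" and "\<alpha> > 0"
  shows "(\<integral>\<^sup>+z. f z \<partial>limit_measure \<alpha>) =
    (\<integral>\<^sup>+z. ennreal (1 / (2 * pi * \<alpha>) * norm z powr (1 / \<alpha> - 2) * indicator {..<1} (norm z)) * f z \<partial>lborel)"
proof -
  have "indicator {z. norm z < 1} z = (indicator {..<1} (norm z) :: real)" for z :: complex
    by (simp add: indicator_def)
  then show ?thesis unfolding limit_measure_def
    by (subst nn_integral_density) (auto simp: indicator_def)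
qed

text \<open>The factor \<open>2 * pi * r\<close> of polar coordinates turns the planar density into
  that of the modulus, whose distribution function on \<open>{0..1}\<close> is
  \<open>r powr (1 / \<alpha>)\<close>.\<close>

lemma nn_integral_limit_measure_radial:
  fixes g :: "real \<Rightarrow> ennreal"
  assumes [measurable]: "g \<in> borel_measurable borel" and \<alpha>: "\<alpha> > 0"
  shows "(\<integral>\<^sup>+z. g (norm z) \<partial>limit_measure \<alpha>) =
    (\<integral>\<^sup>+r\<in>{0..1}. ennreal (1 / \<alpha> * r powr (1 / \<alpha> - 1)) * g r \<partial>lborel)"
proof -
  have [measurable]: "ball (0::complex) 1 \<in> sets borel" by simp
  define h where "h r = ennreal (1 / (2 * pi * \<alpha>) * r powr (1 / \<alpha> - 2)) * g r" for r
  have [measurable]: "h \<in> borel_measurable borel" unfolding h_def by measurable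
  have "(\<integral>\<^sup>+z. g (norm z) \<partial>limit_measure \<alpha>) = (\<integral>\<^sup>+z. indicator (ball (0::complex) 1) z * h (norm z) \<partial>lborel)"
    by (subst nn_integral_limit_measure) (use \<alpha> in \<open>auto intro!: nn_integral_cong simp: h_def indicator_def\<close>)
  also have "\<dots> = (\<integral>\<^sup>+r. h r \<partial>distr (density lborel (indicator (ball 0 1))) borel (norm :: complex \<Rightarrow> real))"
    by (simp add: nn_integral_distr nn_integral_density)
  also have "\<dots> = (\<integral>\<^sup>+r. ennreal (indicator {0..1} r * (2 * pi * r)) * h r \<partial>lborel)"
    unfolding distr_norm_lborel_disc by (subst nn_integral_density) auto
  also have "\<dots> = (\<integral>\<^sup>+r\<in>{0..1}. ennreal (1 / \<alpha> * r powr (1 / \<alpha> - 1)) * g r \<partial>lborel)"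
  proof (rule nn_integral_cong)
    fix r :: real
    have "2 * pi * r * (1 / (2 * pi * \<alpha>) * r powr (1 / \<alpha> - 2)) = 1 / \<alpha> * r powr (1 / \<alpha> - 1)" if "r \<ge> 0"
    proof (cases "r = 0")
      case False
      have "r * r powr (1 / \<alpha> - 2) = r powr (1 / \<alpha> - 1)"
        using that False powr_add[of r 1 "1 / \<alpha> - 2"] by simp
      then show ?thesis using \<alpha> by (simp add: field_simps)
    qed simp
    then show "ennreal (indicator {0..1} r * (2 * pi * r)) * h r =
      ennreal (1 / \<alpha> * r powr (1 / \<alpha> - 1)) * g r * indicator {0..1} r"
      using \<alpha> by (auto simp: indicator_def h_def mult.assoc[symmetric] simp flip: ennreal_mult)
  qed
  finally show ?thesis .
qed

lemma prob_space_limit_measure: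
  assumes \<alpha>: "\<alpha> > 0" shows "prob_space (limit_measure \<alpha>)"
proof
  have "((\<lambda>r. 1 / \<alpha> * r powr (1 / \<alpha> - 1)) has_integral 1 / \<alpha> * (1 powr (1 / \<alpha> - 1 + 1) / (1 / \<alpha> - 1 + 1))) {0..1}"
    by (intro has_integral_mult_right has_integral_powr_from_0) (use \<alpha> in auto)
  then have "(\<integral>\<^sup>+r\<in>{0..1}. ennreal (1 / \<alpha> * r powr (1 / \<alpha> - 1)) \<partial>lborel) = ennreal 1"
    using \<alpha> by (intro nn_integral_has_integral_lebesgue') auto
  then have "(\<integral>\<^sup>+z. 1 \<partial>limit_measure \<alpha>) = 1"
    using nn_integral_limit_measure_radial[of "\<lambda>_. 1" \<alpha>] \<alpha> by simp
  then show "emeasure (limit_measure \<alpha>) (space (limit_measure \<alpha>)) = 1"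
    by simp
qed

text \<open>Up to the additive constant \<open>\<alpha>\<close>, this is the logarithmic potential of the limit measure, and
  also the limit of \<open>1 / n * ln (norm (W\<^sub>n (e\<^sup>\<beta> n\<^sup>\<alpha> z)))\<close> for \<open>norm z = r\<close>.\<close>

definition limit_potential :: "real \<Rightarrow> real \<Rightarrow> real" where
  "limit_potential \<alpha> r = (if r \<le> 1 then \<alpha> * r powr (1 / \<alpha>) else \<alpha> + ln r)"

text \<open>The part of modulus below \<open>r\<close> has mass \<open>r powr (1 / \<alpha>)\<close>
  when \<open>r \<le> 1\<close> and sees the constant \<open>ln (C / r)\<close>; on the rest,
  integration by parts supplies the antiderivative \<open>?F\<close>.\<close>

lemma nn_integral_ln_max_limit_measure:
  assumes \<alpha>: "\<alpha> > 0" and r: "r > 0" "C \<ge> r" "C \<ge> 1"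
  shows "(\<integral>\<^sup>+z. ennreal (ln (C / max (norm z) r)) \<partial>limit_measure \<alpha>) = ennreal (ln C + \<alpha> - limit_potential \<alpha> r)"
proof -
  let ?p = "\<lambda>s. 1 / \<alpha> * s powr (1 / \<alpha> - 1)"
  have I: "(?p has_integral c powr (1 / \<alpha>)) {0..c}" if "c \<ge> 0" for c
    using has_integral_mult_right[OF has_integral_powr_from_0[of "1 / \<alpha> - 1" c], of "1 / \<alpha>"] \<alpha> that by simp
  have "((\<lambda>s. ?p s * ln (C / max s r)) has_integral (ln C + \<alpha> - limit_potential \<alpha> r)) {0..1}"
  proof (cases "r \<le> 1")
    case False
    have "((\<lambda>s. ?p s * ln (C / r)) has_integral (1 powr (1 / \<alpha>) * ln (C / r))) {0..1}"
      by (intro has_integral_mult_left I) auto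
    then have "((\<lambda>s. ?p s * ln (C / max s r)) has_integral (1 powr (1 / \<alpha>) * ln (C / r))) {0..1}"
      by (rule has_integral_eq[rotated]) (use False in auto)
    moreover have "1 powr (1 / \<alpha>) * ln (C / r) = ln C + \<alpha> - limit_potential \<alpha> r"
      using False r by (simp add: limit_potential_def ln_div)
    ultimately show ?thesis by simp
  next
    case True
    have "((\<lambda>s. ?p s * ln (C / r)) has_integral (r powr (1 / \<alpha>) * ln (C / r))) {0..r}"
      by (intro has_integral_mult_left I) (use r in auto)
    then have 1: "((\<lambda>s. ?p s * ln (C / max s r)) has_integral (r powr (1 / \<alpha>) * ln (C / r))) {0..r}"
      by (rule has_integral_eq[rotated]) (use r in auto)
    let ?F = "\<lambda>s. s powr (1 / \<alpha>) * (ln C - ln s) + \<alpha> * s powr (1 / \<alpha>)"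
    have "((\<lambda>s. ?p s * (ln C - ln s)) has_integral (?F 1 - ?F r)) {r..1}"
    proof (rule fundamental_theorem_of_calculus)
      fix s assume s: "s \<in> {r..1}"
      then have s0: "s > 0" using r by auto
      have e: "s powr (1 / \<alpha>) = s * s powr (1 / \<alpha> - 1)"
        using s0 powr_add[of s 1 "1 / \<alpha> - 1"] by simp
      have d: "((\<lambda>s. s powr (1 / \<alpha>)) has_real_derivative ?p s) (at s)"
        by (rule has_real_derivative_powr[OF s0])
      have "(?F has_real_derivative (?p s * (ln C - ln s) + (0 - 1 / s) * s powr (1 / \<alpha>)) + \<alpha> * ?p s) (at s)"
        by (intro DERIV_add DERIV_mult DERIV_diff DERIV_const DERIV_cmult d DERIV_ln_divide s0)
      moreover have "(?p s * (ln C - ln s) + (0 - 1 / s) * s powr (1 / \<alpha>)) + \<alpha> * ?p s = ?p s * (ln C - ln s)"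
        using s0 \<alpha> by (simp add: e)
      ultimately have "(?F has_real_derivative ?p s * (ln C - ln s)) (at s)" by simp
      then show "(?F has_vector_derivative ?p s * (ln C - ln s)) (at s within {r..1})"
        unfolding has_real_derivative_iff_has_vector_derivative by (rule has_vector_derivative_at_within)
    qed (use True in auto)
    then have 2: "((\<lambda>s. ?p s * ln (C / max s r)) has_integral (?F 1 - ?F r)) {r..1}"
      by (rule has_integral_eq[rotated]) (use r in \<open>auto simp: ln_div max_def\<close>)
    have "((\<lambda>s. ?p s * ln (C / max s r)) has_integral (r powr (1 / \<alpha>) * ln (C / r) + (?F 1 - ?F r))) {0..1}"
      by (rule has_integral_combine[OF _ _ 1 2]) (use r True in auto)
    moreover have "r powr (1 / \<alpha>) * ln (C / r) + (?F 1 - ?F r) = ln C + \<alpha> - limit_potential \<alpha> r"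
      using True r by (simp add: limit_potential_def ln_div algebra_simps)
    ultimately show ?thesis by (simp only:)
  qed
  then have "(\<integral>\<^sup>+s\<in>{0..1}. ennreal (?p s * ln (C / max s r)) \<partial>lborel) = ennreal (ln C + \<alpha> - limit_potential \<alpha> r)"
  proof (rule nn_integral_has_integral_lebesgue'[rotated])
    fix s :: real assume "s \<in> {0..1}"
    then have "ln (C / max s r) \<ge> 0" using r by (intro ln_ge_zero) (auto simp: max_def)
    then show "0 \<le> ?p s * ln (C / max s r)" using \<alpha> by simp
  qed
  moreover have "(\<integral>\<^sup>+z. ennreal (ln (C / max (norm z) r)) \<partial>limit_measure \<alpha>)
     = (\<integral>\<^sup>+s\<in>{0..1}. ennreal (?p s * ln (C / max s r)) \<partial>lborel)"
  proof -
    have "ennreal (?p s * x) = ennreal (?p s) * ennreal x" for s x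
      by (rule ennreal_mult') (use \<alpha> in simp)
    then show ?thesis
      using nn_integral_limit_measure_radial[of "\<lambda>s. ennreal (ln (C / max s r))" \<alpha>] \<alpha>
      by (simp only:) simp
  qed
  ultimately show ?thesis by simp
qed

lemma nn_integral_limit_measure_ln:
  assumes \<alpha>: "\<alpha> > 0" and z: "z \<noteq> 0" and C: "C \<ge> norm z + 1"
  shows "(\<integral>\<^sup>+w. ennreal (ln (C / norm (w - z))) \<partial>limit_measure \<alpha>) = ennreal (ln C + \<alpha> - limit_potential \<alpha> (norm z))"
proof -
  let ?f = "\<lambda>s. ennreal (1 / (2 * pi * \<alpha>) * s powr (1 / \<alpha> - 2) * indicator {..<1} s)"
  have "(\<integral>\<^sup>+w. ennreal (ln (C / norm (w - z))) \<partial>limit_measure \<alpha>)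
     = (\<integral>\<^sup>+x. ?f (norm x) * ennreal (ln (C / norm (x - z))) \<partial>lborel)"
    by (subst nn_integral_limit_measure) (use \<alpha> in auto)
  also have "\<dots> = (\<integral>\<^sup>+x. ?f (norm (x::complex)) * ennreal (ln (C / max (norm x) (norm z))) \<partial>lborel)"
    by (rule radial_mean_ln[where \<rho> = 1]) (use C in auto)
  also have "\<dots> = (\<integral>\<^sup>+w. ennreal (ln (C / max (norm w) (norm z))) \<partial>limit_measure \<alpha>)"
    by (subst nn_integral_limit_measure) (use \<alpha> in auto)
  also have "\<dots> = ennreal (ln C + \<alpha> - limit_potential \<alpha> (norm z))"
  proof (rule nn_integral_ln_max_limit_measure)
    show "C \<ge> norm z" "C \<ge> 1" "norm z > 0"
      using C norm_ge_zero[of z] z by (linarith, linarith, simp)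
  qed (rule \<alpha>)
  finally show ?thesis .
qed

section \<open>Integrability and submean value property of the logarithm\<close>

lemma integrable_bounded_mult_ln:
  fixes h :: "complex \<Rightarrow> real"
  assumes [measurable]: "h \<in> borel_measurable borel"
    and h: "\<And>x. \<bar>h x\<bar> \<le> B" "\<And>x. norm x > R \<Longrightarrow> h x = 0"
  shows "integrable lborel (\<lambda>x. h x * ln (norm (x - w)))"
proof -
  define R' where "R' = max R 0"
  have B: "B \<ge> 0" using h(1)[of 0] by linarith
  obtain D where D: "\<And>v. norm v \<le> norm w \<Longrightarrow>
    (\<integral>\<^sup>+a\<in>cball 0 R'. ennreal \<bar>ln (norm (a - v))\<bar> \<partial>(lborel::complex measure)) \<le> ennreal D"
    using nn_integral_ln_norm_cball[of R' "norm w"] by (auto simp: R'_def)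
  have [measurable]: "cball (0::complex) R' \<in> sets borel" by simp
  have "(\<integral>\<^sup>+x. ennreal (norm (h x * ln (norm (x - w)))) \<partial>lborel)
     \<le> (\<integral>\<^sup>+a. ennreal B * (ennreal \<bar>ln (norm (a - w))\<bar> * indicator (cball 0 R') a) \<partial>lborel)"
  proof (rule nn_integral_mono)
    fix x :: complex
    show "ennreal (norm (h x * ln (norm (x - w)))) \<le> ennreal B * (ennreal \<bar>ln (norm (x - w))\<bar> * indicator (cball 0 R') x)"
      using h[of x] B by (cases "norm x \<le> R'")
        (auto simp: R'_def abs_mult simp flip: ennreal_mult intro!: ennreal_leI mult_right_mono)
  qed
  also have "\<dots> = ennreal B * (\<integral>\<^sup>+a\<in>cball 0 R'. ennreal \<bar>ln (norm (a - w))\<bar> \<partial>lborel)"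
    by (rule nn_integral_cmult) measurable
  also have "\<dots> \<le> ennreal B * ennreal D"
    by (intro mult_left_mono D) auto
  also have "\<dots> < \<infinity>" by (simp add: ennreal_mult_less_top)
  finally show ?thesis by (intro integrableI_bounded) auto
qed

text \<open>Subharmonicity: the circular mean \<open>ln (max (norm x) (norm \<zeta>))\<close> about
  \<open>z\<close> never falls below the central value \<open>ln (norm \<zeta>)\<close>. The pole
  itself has to be excluded, since with \<open>ln 0 = 0\<close> the inequality fails there for small
  discs.\<close>

lemma ln_submean_cball:
  fixes z w :: complex
  assumes "w \<noteq> z" "\<rho> > 0"
  shows "pi * \<rho>\<^sup>2 * ln (norm (z - w)) \<le> (\<integral>x. indicator (cball z \<rho>) x * ln (norm (x - w)) \<partial>lborel)"
proof -
  define \<zeta> where "\<zeta> = w - z"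
  define C where "C = \<rho> + norm \<zeta>"
  have C: "C > 0" "norm \<zeta> > 0" "norm \<zeta> \<le> C" using assms by (auto simp: C_def \<zeta>_def add_pos_nonneg)
  have [measurable]: "cball z \<rho> \<in> sets borel" by simp
  have I: "integrable lborel (\<lambda>x. indicator (cball z \<rho>) x * ln (norm (x - w)))"
  proof (rule integrable_bounded_mult_ln[where R = "norm z + \<rho>" and B = 1])
    fix x :: complex assume "norm x > norm z + \<rho>"
    then have "dist z x > \<rho>" using norm_triangle_ineq2[of x z] by (simp add: dist_norm norm_minus_commute)
    then show "indicator (cball z \<rho>) x = (0::real)" by simp
  qed (auto simp: indicator_def)
  have m: "emeasure lborel (cball z \<rho>) = ennreal (pi * \<rho>\<^sup>2)" "measure lborel (cball z \<rho>) = pi * \<rho>\<^sup>2"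
    using assms by (simp_all add: emeasure_cball measure_def unit_ball_vol_2)
  have Ic: "integrable lborel (\<lambda>x. indicator (cball z \<rho>) x * ln C :: real)"
    using m by (intro integrable_mult_left integrable_real_indicator) auto
  have cb: "x + z \<in> cball z \<rho> \<longleftrightarrow> norm x \<le> \<rho>" for x :: complex
    by (simp add: dist_norm norm_minus_commute[of z])
  have ae: "AE x in lborel. indicator (cball z \<rho>) x * ln (C / norm (x - w))
     = indicator (cball z \<rho>) x * ln C - indicator (cball z \<rho>) x * ln (norm (x - w))"
    using AE_lborel_singleton[of w]
  proof eventually_elim
    case (elim x)
    then have "ln (C / norm (x - w)) = ln C - ln (norm (x - w))" using C(1) by (intro ln_divide_pos) auto
    then show ?case by (simp only: right_diff_distrib)
  qed
  have "(\<integral>\<^sup>+x. ennreal (indicator (cball z \<rho>) x * ln (C / norm (x - w))) \<partial>lborel)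
      = (\<integral>\<^sup>+x. ennreal (indicator (cball z \<rho>) (x + z) * ln (C / norm (x - \<zeta>))) \<partial>lborel)"
    using nn_integral_lborel_shift[of "\<lambda>x. ennreal (indicator (cball z \<rho>) x * ln (C / norm (x - w)))" z]
    by (simp add: \<zeta>_def algebra_simps)
  also have "\<dots> = (\<integral>\<^sup>+x. indicator {..\<rho>} (norm x) * ennreal (ln (C / norm (x - \<zeta>))) \<partial>lborel)"
    by (intro nn_integral_cong) (use cb in \<open>auto simp: indicator_def\<close>)
  also have "\<dots> = (\<integral>\<^sup>+x. indicator {..\<rho>} (norm (x::complex)) * ennreal (ln (C / max (norm x) (norm \<zeta>))) \<partial>lborel)"
    by (rule radial_mean_ln[where \<rho> = \<rho>]) (auto simp: C_def)
  also have "\<dots> \<le> (\<integral>\<^sup>+x. ennreal (ln (C / norm \<zeta>)) * indicator (cball (0::complex) \<rho>) x \<partial>lborel)"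
  proof (rule nn_integral_mono)
    fix x :: complex
    have "ln (C / max (norm x) (norm \<zeta>)) \<le> ln (C / norm \<zeta>)"
      using C(2) by (intro ln_mono divide_left_mono mult_pos_pos divide_pos_pos C(1) less_imp_le[OF C(1)]) (auto simp: less_max_iff_disj)
    then show "indicator {..\<rho>} (norm x) * ennreal (ln (C / max (norm x) (norm \<zeta>))) \<le> ennreal (ln (C / norm \<zeta>)) * indicator (cball 0 \<rho>) x"
      by (auto simp: indicator_def intro!: ennreal_leI)
  qed
  also have "\<dots> = ennreal (ln (C / norm \<zeta>) * (pi * \<rho>\<^sup>2))"
  proof -
    have "0 \<le> ln (C / norm \<zeta>)" using C(2,3) by (intro ln_ge_zero) simp
    then show ?thesis
      using assms by (simp add: nn_integral_cmult_indicator emeasure_cball unit_ball_vol_2 ennreal_mult)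
  qed
  finally have *: "(\<integral>\<^sup>+x. ennreal (indicator (cball z \<rho>) x * ln (C / norm (x - w))) \<partial>lborel) \<le> ennreal (ln (C / norm \<zeta>) * (pi * \<rho>\<^sup>2))" .
  have nn: "0 \<le> indicator (cball z \<rho>) x * ln (C / norm (x - w))" for x
  proof (cases "x \<in> cball z \<rho> \<and> x \<noteq> w")
    case True
    have "norm (x - w) \<le> norm (x - z) + norm (w - z)"
      using norm_triangle_ineq4[of "x - z" "w - z"] by simp
    then have "norm (x - w) \<le> C" using True by (simp add: C_def \<zeta>_def dist_norm norm_minus_commute)
    then show ?thesis using True by simp
  qed auto
  have "(\<integral>x. indicator (cball z \<rho>) x * ln (C / norm (x - w)) \<partial>lborel) \<le> ln (C / norm \<zeta>) * (pi * \<rho>\<^sup>2)"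
    by (subst integral_eq_nn_integral) (use * nn C in \<open>auto intro!: enn2real_leI\<close>)
  also have "(\<integral>x. indicator (cball z \<rho>) x * ln (C / norm (x - w)) \<partial>lborel)
     = (\<integral>x. indicator (cball z \<rho>) x * ln C - indicator (cball z \<rho>) x * ln (norm (x - w)) \<partial>lborel)"
    by (rule integral_cong_AE) (use ae in auto)
  also have "\<dots> = pi * \<rho>\<^sup>2 * ln C - (\<integral>x. indicator (cball z \<rho>) x * ln (norm (x - w)) \<partial>lborel)"
    using I Ic m by simp
  finally show ?thesis using C by (simp add: ln_div algebra_simps \<zeta>_def norm_minus_commute)
qed

lemma AE_limit_measure: "\<alpha> > 0 \<Longrightarrow> AE w in limit_measure \<alpha>. norm w < 1 \<and> w \<noteq> z"
  unfolding limit_measure_def using AE_lborel_singleton[of z]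
  by (subst AE_density) (auto simp: indicator_def)

lemma sets_limit_measure [simp, measurable_cong]: "sets (limit_measure \<alpha>) = sets borel"
  by (simp add: limit_measure_def)

lemma space_limit_measure [simp]: "space (limit_measure \<alpha>) = UNIV"
  by (simp add: limit_measure_def)

text \<open>Return from the nonnegative kernel \<open>ln (C / norm (w - z))\<close> to the signed
  logarithm; subtracting it from \<open>ln C\<close> is harmless under a probability
  measure.\<close>

lemma limit_measure_ln_integral:
  assumes \<alpha>: "\<alpha> > 0" and z: "z \<noteq> 0"
  shows "integrable (limit_measure \<alpha>) (\<lambda>w. ln (norm (w - z)))"
    and "(\<integral>w. ln (norm (w - z)) \<partial>limit_measure \<alpha>) = limit_potential \<alpha> (norm z) - \<alpha>"
proof -
  interpret prob_space "limit_measure \<alpha>" by (rule prob_space_limit_measure[OF \<alpha>])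
  define C where "C = norm z + 1"
  have C: "C > 0" "C \<ge> 1" by (auto simp: C_def add_nonneg_pos)
  have nn: "AE w in limit_measure \<alpha>. 0 \<le> ln (C / norm (w - z)) \<and> ln (C / norm (w - z)) = ln C - ln (norm (w - z))"
    using AE_limit_measure[OF \<alpha>, of z]
  proof eventually_elim
    case (elim w)
    have "norm (w - z) \<le> C" using norm_triangle_ineq4[of w z] elim by (simp add: C_def)
    then show ?case using elim C by (simp add: ln_div)
  qed
  have le: "limit_potential \<alpha> (norm z) \<le> ln C + \<alpha>"
  proof (cases "norm z \<le> 1")
    case True
    then have "\<alpha> * norm z powr (1 / \<alpha>) \<le> \<alpha> * 1" using \<alpha> by (intro mult_left_mono powr_le1) auto
    then show ?thesis using True C by (simp add: limit_potential_def add_increasing)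
  qed (use z in \<open>simp add: limit_potential_def C_def\<close>)
  have h: "has_bochner_integral (limit_measure \<alpha>) (\<lambda>w. ln (C / norm (w - z))) (ln C + \<alpha> - limit_potential \<alpha> (norm z))"
    by (rule has_bochner_integral_nn_integral)
      (use nn le nn_integral_limit_measure_ln[OF \<alpha> z, of C] in \<open>auto simp: C_def elim: eventually_mono\<close>)
  have "has_bochner_integral (limit_measure \<alpha>) (\<lambda>w. ln C - ln (C / norm (w - z))) (ln C - (ln C + \<alpha> - limit_potential \<alpha> (norm z)))"
    by (intro has_bochner_integral_diff h) (use prob_space in \<open>auto simp: has_bochner_integral_iff\<close>)
  moreover have "AE w in limit_measure \<alpha>. ln C - ln (C / norm (w - z)) = ln (norm (w - z))"
    using nn by eventually_elim auto
  ultimately have "has_bochner_integral (limit_measure \<alpha>) (\<lambda>w. ln (norm (w - z))) (ln C - (ln C + \<alpha> - limit_potential \<alpha> (norm z)))"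
    by (subst has_bochner_integral_cong_AE[symmetric]) auto
  then show "integrable (limit_measure \<alpha>) (\<lambda>w. ln (norm (w - z)))"
    "(\<integral>w. ln (norm (w - z)) \<partial>limit_measure \<alpha>) = limit_potential \<alpha> (norm z) - \<alpha>"
    by (auto simp: has_bochner_integral_iff)
qed

section \<open>Approximating test functions by logarithmic potentials\<close>

lemma integral_lborel_shift:
  fixes f :: "'a::euclidean_space \<Rightarrow> real"
  assumes [measurable]: "f \<in> borel_measurable borel"
  shows "(\<integral>x. f (x + y) \<partial>lborel) = (\<integral>x. f x \<partial>lborel)"
    and "integrable lborel (\<lambda>x. f (x + y)) \<longleftrightarrow> integrable lborel f"
proof -
  have "(\<integral>x. f x \<partial>lborel) = (\<integral>x. f x \<partial>(distr lborel borel ((+) y)))"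
    by (simp add: lborel_distr_plus)
  also have "\<dots> = (\<integral>x. f (y + x) \<partial>lborel)"
    by (subst integral_distr) auto
  finally show "(\<integral>x. f (x + y) \<partial>lborel) = (\<integral>x. f x \<partial>lborel)" by (simp add: add.commute)
  have "integrable lborel f \<longleftrightarrow> integrable (distr lborel borel ((+) y)) f"
    by (simp add: lborel_distr_plus)
  also have "\<dots> \<longleftrightarrow> integrable lborel (\<lambda>x. f (y + x))"
    by (subst integrable_distr_eq) auto
  finally show "integrable lborel (\<lambda>x. f (x + y)) \<longleftrightarrow> integrable lborel f" by (simp add: add.commute)
qed

text \<open>Parametrises circles through \<open>cis (2 * pi * t)\<close>. As a probability measure
  it turns circular averages into expectations, to which Fubini on a product with
  \<open>lborel\<close> applies.\<close>

definition unit_time :: "real measure" where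
  "unit_time = density lborel (\<lambda>t. ennreal (indicator {0..1} t))"

lemma sets_unit_time [simp, measurable_cong]: "sets unit_time = sets borel"
  by (simp add: unit_time_def)

lemma prob_space_unit_time: "prob_space unit_time"
proof
  show "emeasure unit_time (space unit_time) = 1"
    by (simp add: unit_time_def emeasure_density ennreal_indicator)
qed

lemma integral_unit_time_ln:
  assumes "norm x \<noteq> r" "r > 0"
  shows "(\<integral>t. ln (norm (x + of_real r * cis (2 * pi * t))) \<partial>unit_time) = ln (max (norm x) r)"
proof -
  let ?f = "\<lambda>t. ln (norm (x + of_real r * cis (2 * pi * t)))"
  have ne: "x + of_real r * cis (2 * pi * t) \<noteq> 0" for t
  proof
    assume "x + of_real r * cis (2 * pi * t) = 0"
    then have "norm x = norm (of_real r * cis (2 * pi * t))" by (metis add.inverse_inverse add_eq_0_iff norm_minus_cancel)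
    then show False using assms by (simp add: norm_mult)
  qed
  have "?f = (\<lambda>t. ln (norm (cis (2 * pi * t) * of_real r - (- x))))"
    by (simp add: add.commute mult.commute)
  then have i: "(?f has_integral ln (max r (norm x))) {0..1}"
    using circle_mean_ln[of "of_real r" "- x"] assms by simp
  have "continuous_on {0..1} ?f"
    using ne by (intro continuous_intros) auto
  then have "set_integrable lborel {0..1} ?f"
    by (rule borel_integrable_atLeastAtMost')
  then have "set_lebesgue_integral lborel {0..1} ?f = integral {0..1} ?f"
    by (rule set_borel_integral_eq_integral)
  moreover have "?f \<in> borel_measurable borel"
    unfolding cis_conv_exp by measurable
  ultimately show ?thesis using i
    by (simp add: unit_time_def integral_density set_lebesgue_integral_def integral_unique max.commute)
qed

text \<open>Averaging over circles is self-adjoint: Fubini, and a translation by \<open>e t\<close>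
  for each fixed \<open>t\<close>. The averages of \<open>\<phi>\<close> live on the disc of radius
  \<open>R + r\<close>, whence the integrability asked of \<open>\<psi>\<close> there.\<close>

lemma circle_convolution:
  fixes \<phi> \<psi> :: "complex \<Rightarrow> real" and r :: real
  defines "e \<equiv> (\<lambda>t. of_real r * cis (2 * pi * t))"
  assumes [measurable]: "\<phi> \<in> borel_measurable borel" "\<psi> \<in> borel_measurable borel"
    and \<phi>: "\<And>x. \<bar>\<phi> x\<bar> \<le> B" "\<And>x. norm x > R \<Longrightarrow> \<phi> x = 0" and r: "r > 0"
    and \<psi>: "integrable lborel (\<lambda>x. indicator (cball 0 (R + r)) x * \<psi> x)"
  shows "(\<integral>a. (\<integral>t. \<phi> (a - e t) \<partial>unit_time) * \<psi> a \<partial>lborel) = (\<integral>a. \<phi> a * (\<integral>t. \<psi> (a + e t) \<partial>unit_time) \<partial>lborel)"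
proof -
  interpret T: prob_space unit_time by (rule prob_space_unit_time)
  interpret Q: pair_sigma_finite unit_time "lborel :: complex measure"
    by (intro pair_sigma_finite.intro sigma_finite_lborel T.sigma_finite_measure_axioms)
  have [measurable]: "e \<in> borel_measurable borel" unfolding e_def cis_conv_exp by measurable
  have ne: "norm (e t) = r" for t using r by (simp add: e_def norm_mult)
  have B: "B \<ge> 0" using \<phi>(1)[of 0] by linarith
  let ?K = "\<lambda>x. B * \<bar>indicator (cball 0 (R + r)) x * \<psi> x\<bar>"
  have [measurable]: "cball (0::complex) (R + r) \<in> sets borel" by simp
  have K: "integrable lborel ?K" using \<psi> by (intro integrable_mult_right integrable_abs)
  have bd: "\<bar>\<phi> (a - e t) * \<psi> a\<bar> \<le> ?K a" for a t
  proof (cases "norm a \<le> R + r")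
    case True
    then show ?thesis using \<phi>(1)[of "a - e t"] by (simp add: abs_mult mult_right_mono)
  next
    case False
    then have "norm (a - e t) > R" using norm_triangle_ineq2[of a "e t"] ne[of t] by linarith
    then show ?thesis using \<phi>(2) B by simp
  qed
  have i1: "integrable lborel (\<lambda>a. \<phi> (a - e t) * \<psi> a)" for t
    by (rule Bochner_Integration.integrable_bound[OF K]) (use bd B in auto)
  have b1: "(\<integral>a. \<bar>\<phi> (a - e t) * \<psi> a\<bar> \<partial>lborel) \<le> (\<integral>a. ?K a \<partial>lborel)" for t
    by (rule integral_mono) (use i1 K bd in auto)
  have s1: "(\<integral>a. \<phi> (a - e t) * \<psi> a \<partial>lborel) = (\<integral>a. \<phi> a * \<psi> (a + e t) \<partial>lborel)"
    and s2: "(\<integral>a. \<bar>\<phi> (a - e t) * \<psi> a\<bar> \<partial>lborel) = (\<integral>a. \<bar>\<phi> a * \<psi> (a + e t)\<bar> \<partial>lborel)"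
    and i2: "integrable lborel (\<lambda>a. \<phi> a * \<psi> (a + e t))" for t
    using integral_lborel_shift(1)[of "\<lambda>a. \<phi> (a - e t) * \<psi> a" "e t"]
      integral_lborel_shift(1)[of "\<lambda>a. \<bar>\<phi> (a - e t) * \<psi> a\<bar>" "e t"]
      integral_lborel_shift(2)[of "\<lambda>a. \<phi> (a - e t) * \<psi> a" "e t"] i1[of t] by simp_all
  have F1: "integrable (unit_time \<Otimes>\<^sub>M lborel) (\<lambda>(t, a). \<phi> (a - e t) * \<psi> a)"
  proof (rule Q.Fubini_integrable)
    show "integrable unit_time (\<lambda>t. \<integral>a. norm (case (t, a) of (t, a) \<Rightarrow> \<phi> (a - e t) * \<psi> a) \<partial>lborel)"
      by (rule T.integrable_const_bound[where B = "\<integral>a. ?K a \<partial>lborel"]) (use b1 in auto)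
  qed (use i1 in auto)
  have F2: "integrable (unit_time \<Otimes>\<^sub>M lborel) (\<lambda>(t, a). \<phi> a * \<psi> (a + e t))"
  proof (rule Q.Fubini_integrable)
    show "integrable unit_time (\<lambda>t. \<integral>a. norm (case (t, a) of (t, a) \<Rightarrow> \<phi> a * \<psi> (a + e t)) \<partial>lborel)"
      by (rule T.integrable_const_bound[where B = "\<integral>a. ?K a \<partial>lborel"]) (use b1 s2 in auto)
  qed (use i2 in auto)
  have "(\<integral>a. (\<integral>t. \<phi> (a - e t) \<partial>unit_time) * \<psi> a \<partial>lborel) = (\<integral>a. (\<integral>t. \<phi> (a - e t) * \<psi> a \<partial>unit_time) \<partial>lborel)"
    by (intro Bochner_Integration.integral_cong) auto
  also have "\<dots> = (\<integral>t. (\<integral>a. \<phi> (a - e t) * \<psi> a \<partial>lborel) \<partial>unit_time)"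
    using Q.Fubini_integral[OF F1] by simp
  also have "\<dots> = (\<integral>t. (\<integral>a. \<phi> a * \<psi> (a + e t) \<partial>lborel) \<partial>unit_time)"
    unfolding s1 ..
  also have "\<dots> = (\<integral>a. (\<integral>t. \<phi> a * \<psi> (a + e t) \<partial>unit_time) \<partial>lborel)"
    using Q.Fubini_integral[OF F2] by simp
  also have "\<dots> = (\<integral>a. \<phi> a * (\<integral>t. \<psi> (a + e t) \<partial>unit_time) \<partial>lborel)"
    by simp
  finally show ?thesis .
qed

lemma compact_support_bounds:
  fixes \<phi> :: "complex \<Rightarrow> real"
  assumes c: "continuous_on UNIV \<phi>" and k: "compact (closure {z. \<phi> z \<noteq> 0})"
  obtains B R where "R > 0" "\<And>x. \<bar>\<phi> x\<bar> \<le> B" "\<And>x. norm x > R \<Longrightarrow> \<phi> x = 0"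
    "\<And>\<epsilon>. \<epsilon> > 0 \<Longrightarrow> \<exists>r>0. \<forall>x y. dist x y \<le> r \<longrightarrow> \<bar>\<phi> x - \<phi> y\<bar> \<le> \<epsilon>"
proof -
  obtain R where R: "R > 0" "\<And>x. x \<in> closure {z. \<phi> z \<noteq> 0} \<Longrightarrow> norm x \<le> R"
    using compact_imp_bounded[OF k] by (auto simp: bounded_pos)
  have z: "\<phi> x = 0" if "norm x > R" for x
    using that R(2)[of x] closure_subset[of "{z. \<phi> z \<noteq> 0}"] by force
  have "compact (\<phi> ` cball 0 R)"
    by (intro compact_continuous_image continuous_on_subset[OF c]) auto
  then obtain B where "B > 0" "\<forall>y\<in>\<phi> ` cball 0 R. norm y \<le> B"
    using compact_imp_bounded bounded_pos by metis
  then have B: "\<And>x. norm x \<le> R \<Longrightarrow> \<bar>\<phi> x\<bar> \<le> B" "B > 0"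
    by auto
  have "\<bar>\<phi> x\<bar> \<le> B" for x using B z[of x] by (cases "norm x \<le> R") auto
  moreover have "\<exists>r>0. \<forall>x y. dist x y \<le> r \<longrightarrow> \<bar>\<phi> x - \<phi> y\<bar> \<le> \<epsilon>" if \<epsilon>: "\<epsilon> > 0" for \<epsilon>
  proof -
    \<comment> \<open>Points at distance at most 1 lie both within radius \<open>R + 2\<close> or
      both outside the support, so uniform continuity on this single disc suffices.\<close>
    have "uniformly_continuous_on (cball 0 (R + 2)) \<phi>"
      by (intro compact_uniformly_continuous continuous_on_subset[OF c]) auto
    then obtain d where d: "d > 0" "\<And>x y. norm x \<le> R + 2 \<Longrightarrow> norm y \<le> R + 2 \<Longrightarrow> dist y x < d \<Longrightarrow> dist (\<phi> y) (\<phi> x) < \<epsilon>"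
      using \<epsilon> unfolding uniformly_continuous_on_def by (metis mem_cball_0)
    show ?thesis
    proof (intro exI[of _ "min (d / 2) 1"] conjI allI impI)
      fix x y :: complex assume xy: "dist x y \<le> min (d / 2) 1"
      show "\<bar>\<phi> x - \<phi> y\<bar> \<le> \<epsilon>"
      proof (cases "norm x \<le> R + 1 \<or> norm y \<le> R + 1")
        case True
        then have "norm x \<le> R + 2" "norm y \<le> R + 2"
          using xy norm_triangle_ineq2[of x y] norm_triangle_ineq2[of y x] by (auto simp: dist_norm norm_minus_commute)
        then show ?thesis using d(2)[of y x] xy d(1) by (auto simp: dist_norm)
      next
        case False
        then show ?thesis using z[of x] z[of y] \<epsilon> by auto
      qed
    qed (use d in auto)
  qed
  ultimately show thesis using that R(1) z by blast
qed

text \<open>Circular average of the logarithm at radius \<open>r\<close> minus the logarithm. At the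
  origin the formula would give \<open>ln r\<close>, as \<open>ln 0 = 0\<close>, which may be
  negative; the value 0 keeps the kernel nonnegative everywhere.\<close>

definition ln_kernel :: "real \<Rightarrow> complex \<Rightarrow> real" where
  "ln_kernel r x = (if x = 0 then 0 else ln (max (norm x) r) - ln (norm x))"

lemma ln_kernel_nonneg: "r > 0 \<Longrightarrow> ln_kernel r x \<ge> 0"
  by (auto simp: ln_kernel_def intro!: ln_mono)

lemma ln_kernel_eq_0: "norm x \<ge> r \<Longrightarrow> ln_kernel r x = 0"
  by (simp add: ln_kernel_def max_def)

lemma borel_measurable_ln_kernel [measurable]: "ln_kernel r \<in> borel_measurable borel"
  unfolding ln_kernel_def by measurable

lemma integrable_ln_kernel:
  assumes r: "r > 0" shows "integrable lborel (ln_kernel r)" and "(\<integral>x. ln_kernel r x \<partial>lborel) > 0"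
proof -
  have [measurable]: "cball (0::complex) s \<in> sets borel" for s by simp
  have "integrable lborel (\<lambda>x::complex. indicator (cball 0 r) x * ln r - indicator (cball 0 r) x * ln (norm (x - 0)))"
    by (intro Bochner_Integration.integrable_diff integrable_mult_left integrable_real_indicator integrable_bounded_mult_ln[where B = 1 and R = r])
      (auto simp: emeasure_cball r less_imp_le indicator_def)
  moreover have "AE x in lborel. indicator (cball 0 r) x * ln r - indicator (cball 0 r) x * ln (norm (x - 0)) = ln_kernel r x"
    using AE_lborel_singleton[of 0]
    by eventually_elim (auto simp: ln_kernel_def indicator_def max_def)
  ultimately show I: "integrable lborel (ln_kernel r)"
    by (subst integrable_cong_AE[symmetric]) auto
  \<comment> \<open>On the disc of radius \<open>r / 2\<close> the kernel is at least
    \<open>ln 2\<close>, apart from the centre; positivity is all that the later normalisation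
    requires.\<close>
  have "0 < pi * (r / 2)\<^sup>2 * ln 2" using r by simp
  also have "\<dots> = (\<integral>x. indicator (cball (0::complex) (r / 2)) x * ln 2 \<partial>lborel)"
    using r by (simp add: content_cball unit_ball_vol_2)
  also have "\<dots> \<le> (\<integral>x. ln_kernel r x \<partial>lborel)"
  proof (rule integral_mono_AE)
    show "integrable lborel (\<lambda>x. indicator (cball (0::complex) (r / 2)) x * ln 2 :: real)"
      using r by (intro integrable_mult_left integrable_real_indicator) (auto simp: emeasure_cball)
    show "AE x in lborel. indicator (cball (0::complex) (r / 2)) x * ln 2 \<le> ln_kernel r x"
      using AE_lborel_singleton[of 0]
    proof eventually_elim
      case (elim x)
      show ?case
      proof (cases "norm x \<le> r / 2")
        case True
        then have "ln (norm x * 2) \<le> ln r" using elim r by (intro ln_mono) auto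
        then have "ln 2 \<le> ln r - ln (norm x)" using elim by (simp add: ln_mult)
        then show ?thesis using True elim r by (simp add: ln_kernel_def max_def)
      qed (use ln_kernel_nonneg[OF r] in auto)
    qed
  qed (rule I)
  finally show "(\<integral>x. ln_kernel r x \<partial>lborel) > 0" .
qed

text \<open>Take for \<open>g\<close> a multiple of the circular average of \<open>\<phi>\<close> minus \<open>\<phi>\<close>: its logarithmic potential is the
  convolution of \<open>\<phi>\<close> with the nonnegative kernel \<^const>\<open>ln_kernel\<close>, which lives on a small disc.\<close>

lemma approx_by_potential:
  fixes \<phi> :: "complex \<Rightarrow> real"
  assumes c: "continuous_on UNIV \<phi>" and k: "compact (closure {z. \<phi> z \<noteq> 0})" and \<epsilon>: "\<epsilon> > 0"
  obtains g :: "complex \<Rightarrow> real" and B R where "g \<in> borel_measurable borel" "\<And>x. \<bar>g x\<bar> \<le> B" "R > 0"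
    "\<And>x. norm x > R \<Longrightarrow> g x = 0" "(\<integral>x. g x \<partial>lborel) = 0"
    "\<And>z. \<bar>(\<integral>x. g x * ln (norm (x - z)) \<partial>lborel) - \<phi> z\<bar> \<le> \<epsilon>"
proof -
  obtain B R where R: "R > 0" and B: "\<And>x. \<bar>\<phi> x\<bar> \<le> B" and R0: "\<And>x. norm x > R \<Longrightarrow> \<phi> x = 0"
    and "\<exists>r>0. \<forall>x y. dist x y \<le> r \<longrightarrow> \<bar>\<phi> x - \<phi> y\<bar> \<le> \<epsilon>"
    using compact_support_bounds[OF c k] \<epsilon> by metis
  then obtain r where r: "r > 0" and unif: "\<And>x y. dist x y \<le> r \<Longrightarrow> \<bar>\<phi> x - \<phi> y\<bar> \<le> \<epsilon>" by blast
  have [measurable]: "\<phi> \<in> borel_measurable borel" using c by (rule borel_measurable_continuous_onI)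
  interpret T: prob_space unit_time by (rule prob_space_unit_time)
  define e where "e t = of_real r * cis (2 * pi * t)" for t
  have [measurable]: "e \<in> borel_measurable borel" unfolding e_def[abs_def] cis_conv_exp by measurable
  have ne: "norm (e t) = r" for t using r by (simp add: e_def norm_mult)
  define \<phi>r where "\<phi>r a = (\<integral>t. \<phi> (a - e t) \<partial>unit_time)" for a
  have [measurable]: "\<phi>r \<in> borel_measurable borel"
    unfolding \<phi>r_def[abs_def] by measurable
  have \<phi>rB: "\<bar>\<phi>r a\<bar> \<le> B" for a
  proof -
    have "norm (\<phi>r a) \<le> (\<integral>t. norm (\<phi> (a - e t)) \<partial>unit_time)"
      unfolding \<phi>r_def by (rule integral_norm_bound)
    also have "\<dots> \<le> (\<integral>t. B \<partial>unit_time)"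
      by (rule integral_mono) (use B in \<open>auto intro!: T.integrable_const_bound[where B = B]\<close>)
    finally show ?thesis using T.prob_space by simp
  qed
  have \<phi>r0: "\<phi>r a = 0" if "norm a > R + r" for a
  proof -
    have "\<phi> (a - e t) = 0" for t
      using that norm_triangle_ineq2[of a "e t"] ne[of t] by (intro R0) linarith
    then show ?thesis by (simp add: \<phi>r_def)
  qed
  have [measurable]: "cball (0::complex) (R + r) \<in> sets borel" by simp
  \<comment> \<open>Division by the mass makes the kernel a probability density on the disc of
    radius \<open>r\<close>; averaging \<open>\<phi>\<close> against it moves the value by at most
    \<open>\<epsilon>\<close>.\<close>
  define \<kappa> where "\<kappa> = (\<integral>x. ln_kernel r x \<partial>lborel)"
  have \<kappa>: "\<kappa> > 0" unfolding \<kappa>_def by (rule integrable_ln_kernel[OF r])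
  define g where "g x = (\<phi>r x - \<phi> x) / \<kappa>" for x
  have bdd_int: "integrable lborel f" if [measurable]: "f \<in> borel_measurable borel"
    and "\<And>x. \<bar>f x\<bar> \<le> B" "\<And>x. norm x > R + r \<Longrightarrow> f x = 0" for f :: "complex \<Rightarrow> real"
  proof (rule Bochner_Integration.integrable_bound)
    show "integrable lborel (\<lambda>x. indicator (cball (0::complex) (R + r)) x * B :: real)"
      using r R by (intro integrable_mult_left integrable_real_indicator) (auto simp: emeasure_cball)
    show "AE x in lborel. norm (f x) \<le> norm (indicator (cball 0 (R + r)) x * B)"
    proof (rule AE_I2)
      fix x show "norm (f x) \<le> norm (indicator (cball 0 (R + r)) x * B)"
        using that(2)[of x] that(3)[of x] by (cases "norm x \<le> R + r") auto
    qed
  qed auto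
  show thesis
  proof
    show "g \<in> borel_measurable borel" unfolding g_def[abs_def] by measurable
    show "\<bar>g x\<bar> \<le> (B + B) / \<kappa>" for x
      using \<phi>rB[of x] B[of x] \<kappa> by (auto simp: g_def intro!: divide_right_mono)
    show "R + r > 0" using R r by simp
    show "g x = 0" if "norm x > R + r" for x
      using that r \<phi>r0[of x] R0[of x] by (simp add: g_def)
    \<comment> \<open>Self-adjointness against the constant 1: averaging preserves the integral, so
      \<open>g\<close> has integral 0.\<close>
    have "(\<integral>a. \<phi>r a * 1 \<partial>lborel) = (\<integral>a. \<phi> a * (\<integral>t. 1 \<partial>unit_time) \<partial>lborel)"
      unfolding \<phi>r_def e_def
      by (rule circle_convolution[where B = B and R = R])
        (use B R0 r R in \<open>auto simp: emeasure_cball\<close>)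
    then have "(\<integral>a. \<phi>r a \<partial>lborel) = (\<integral>a. \<phi> a \<partial>lborel)"
      using T.prob_space by simp
    then show "(\<integral>x. g x \<partial>lborel) = 0"
      using bdd_int[of \<phi>r] bdd_int[of \<phi>] \<phi>rB \<phi>r0 B R0 r by (simp add: g_def)
    fix z
    \<comment> \<open>The same identity against the logarithm moves the average off
      \<open>\<phi>\<close>, where the circular mean is known for almost every
      \<open>a\<close>.\<close>
    have "(\<integral>a. \<phi>r a * ln (norm (a - z)) \<partial>lborel) = (\<integral>a. \<phi> a * (\<integral>t. ln (norm (a + e t - z)) \<partial>unit_time) \<partial>lborel)"
      unfolding \<phi>r_def e_def
      by (rule circle_convolution[where B = B and R = R])
        (use B R0 r R in \<open>auto intro!: integrable_bounded_mult_ln[where B = 1 and R = "R + r"] simp: indicator_def\<close>)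
    also have "\<dots> = (\<integral>a. \<phi> a * ln (max (norm (a - z)) r) \<partial>lborel)"
    proof (rule integral_cong_AE)
      have "AE a in lborel. norm (a - z) \<noteq> r"
      proof (rule AE_I[where N = "sphere z r"])
        show "emeasure lborel (sphere z r) = 0"
          using negligible_sphere[of z r] unfolding negligible_iff_null_sets
          by (simp add: null_sets_completion_iff null_setsD1)
      qed (auto simp: dist_norm norm_minus_commute)
      then show "AE a in lborel. \<phi> a * (\<integral>t. ln (norm (a + e t - z)) \<partial>unit_time) = \<phi> a * ln (max (norm (a - z)) r)"
      proof eventually_elim
        case (elim a)
        show ?case using integral_unit_time_ln[OF elim r] by (simp add: e_def algebra_simps)
      qed
    qed measurable
    finally have 1: "(\<integral>a. \<phi>r a * ln (norm (a - z)) \<partial>lborel) = (\<integral>a. \<phi> a * ln (max (norm (a - z)) r) \<partial>lborel)" .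
    have iK: "integrable lborel (\<lambda>a. ln_kernel r (a - z))"
      using integral_lborel_shift(2)[of "ln_kernel r" "- z"] integrable_ln_kernel(1)[OF r] by simp
    have K: "(\<integral>a. ln_kernel r (a - z) \<partial>lborel) = \<kappa>"
      using integral_lborel_shift(1)[of "ln_kernel r" "- z"] by (simp add: \<kappa>_def)
    have i\<phi>K: "integrable lborel (\<lambda>a. \<phi> a * ln_kernel r (a - z))"
      by (rule Bochner_Integration.integrable_bound[OF integrable_mult_right[OF iK, of B]])
        (use B ln_kernel_nonneg[OF r] in \<open>auto simp: abs_mult intro!: mult_mono order_trans[OF B abs_ge_self]\<close>)
    have i\<phi>: "integrable lborel (\<lambda>a. \<phi> a * ln (norm (a - z)))"
      by (rule integrable_bounded_mult_ln[of _ B R]) (use B R0 in auto)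
    have i\<phi>r: "integrable lborel (\<lambda>a. \<phi>r a * ln (norm (a - z)))"
      by (rule integrable_bounded_mult_ln[of _ B "R + r"]) (use \<phi>rB \<phi>r0 in auto)
    have ae: "AE a in lborel. \<phi> a * ln (max (norm (a - z)) r) = \<phi> a * ln_kernel r (a - z) + \<phi> a * ln (norm (a - z))"
      using AE_lborel_singleton[of z] by eventually_elim (simp add: ln_kernel_def algebra_simps)
    have 2: "(\<integral>a. \<phi> a * ln (max (norm (a - z)) r) \<partial>lborel)
       = (\<integral>a. \<phi> a * ln_kernel r (a - z) \<partial>lborel) + (\<integral>a. \<phi> a * ln (norm (a - z)) \<partial>lborel)"
      unfolding Bochner_Integration.integral_add[OF i\<phi>K i\<phi>, symmetric]
      by (rule integral_cong_AE) (use ae in auto)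
    have "(\<integral>x. g x * ln (norm (x - z)) \<partial>lborel)
      = (\<integral>x. \<phi>r x * ln (norm (x - z)) - \<phi> x * ln (norm (x - z)) \<partial>lborel) / \<kappa>"
      by (subst integral_divide_zero[symmetric]) (simp add: g_def left_diff_distrib)
    also have "\<dots> = (\<integral>a. \<phi> a * ln_kernel r (a - z) \<partial>lborel) / \<kappa>"
      using i\<phi> i\<phi>r 1 2 by simp
    finally have V: "(\<integral>x. g x * ln (norm (x - z)) \<partial>lborel) = (\<integral>a. \<phi> a * ln_kernel r (a - z) \<partial>lborel) / \<kappa>" .
    have "\<bar>(\<integral>a. \<phi> a * ln_kernel r (a - z) \<partial>lborel) - \<phi> z * \<kappa>\<bar>
       = \<bar>\<integral>a. \<phi> a * ln_kernel r (a - z) - \<phi> z * ln_kernel r (a - z) \<partial>lborel\<bar>"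
      using i\<phi>K iK K by simp
    also have "\<dots> \<le> (\<integral>a. \<bar>\<phi> a * ln_kernel r (a - z) - \<phi> z * ln_kernel r (a - z)\<bar> \<partial>lborel)"
      by (rule integral_abs_bound)
    also have "\<dots> \<le> (\<integral>a. \<epsilon> * ln_kernel r (a - z) \<partial>lborel)"
    proof (rule integral_mono)
      fix a
      show "\<bar>\<phi> a * ln_kernel r (a - z) - \<phi> z * ln_kernel r (a - z)\<bar> \<le> \<epsilon> * ln_kernel r (a - z)"
      proof (cases "norm (a - z) \<ge> r")
        case False
        then have "\<bar>\<phi> a - \<phi> z\<bar> \<le> \<epsilon>" by (intro unif) (auto simp: dist_norm)
        then show ?thesis using ln_kernel_nonneg[OF r, of "a - z"]
          by (simp add: left_diff_distrib[symmetric] abs_mult mult_right_mono)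
      qed (simp add: ln_kernel_eq_0)
    qed (use i\<phi>K iK in auto)
    also have "\<dots> = \<epsilon> * \<kappa>" using K by simp
    finally have *: "\<bar>(\<integral>a. \<phi> a * ln_kernel r (a - z) \<partial>lborel) - \<phi> z * \<kappa>\<bar> \<le> \<epsilon> * \<kappa>" .
    have "(\<integral>x. g x * ln (norm (x - z)) \<partial>lborel) - \<phi> z = ((\<integral>a. \<phi> a * ln_kernel r (a - z) \<partial>lborel) - \<phi> z * \<kappa>) / \<kappa>"
      unfolding V using \<kappa> by (simp add: diff_divide_distrib)
    then show "\<bar>(\<integral>x. g x * ln (norm (x - z)) \<partial>lborel) - \<phi> z\<bar> \<le> \<epsilon>"
      using * \<kappa> by (simp add: pos_divide_le_eq)
  qed
qed

section \<open>From potentials to zeros\<close>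

lemma continuous_on_limit_potential:
  assumes "\<alpha> > 0" shows "continuous_on S (\<lambda>z::complex. limit_potential \<alpha> (norm z))"
proof -
  have "limit_potential \<alpha> r = \<alpha> * (min r 1) powr (1 / \<alpha>) + ln (max r 1)" for r
    by (auto simp: limit_potential_def min_def max_def)
  then show ?thesis using assms
    by (auto intro!: continuous_intros continuous_on_powr')
qed

text \<open>Logarithmic potential of point masses, with \<open>A\<close> for the terms independent
  of \<open>z\<close>. A pole contributes \<open>ln 0 = 0\<close> in place of minus infinity, so
  pointwise estimates make sense only off \<open>Z\<close>.\<close>

definition discrete_potential :: "real \<Rightarrow> complex set \<Rightarrow> (complex \<Rightarrow> real) \<Rightarrow> complex \<Rightarrow> real" where
  "discrete_potential A Z m z = A + (\<Sum>w\<in>Z. m w * ln (norm (z - w)))"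

lemma borel_measurable_discrete_potential [measurable]:
  "discrete_potential A Z m \<in> borel_measurable borel"
  unfolding discrete_potential_def by measurable

text \<open>The bridge from potentials to point measures: for \<open>g\<close> of integral 0 the
  constant \<open>A\<close> drops out, and the potential of \<open>g\<close> is summed over the
  points of \<open>Z\<close>.\<close>

lemma discrete_potential_integral:
  assumes [measurable]: "g \<in> borel_measurable borel" and g: "\<And>x. \<bar>g x\<bar> \<le> B" "\<And>x. norm x > R \<Longrightarrow> g x = 0"
  shows "integrable lborel g"
    and "integrable lborel (\<lambda>x. g x * discrete_potential A Z m x)"
    and "(\<integral>x. g x * discrete_potential A Z m x \<partial>lborel)
      = A * (\<integral>x. g x \<partial>lborel) + (\<Sum>w\<in>Z. m w * (\<integral>x. g x * ln (norm (x - w)) \<partial>lborel))"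
proof -
  have [measurable]: "cball (0::complex) (max R 0) \<in> sets borel" by simp
  show ig: "integrable lborel g"
  proof (rule Bochner_Integration.integrable_bound)
    show "integrable lborel (\<lambda>x. indicator (cball (0::complex) (max R 0)) x * B :: real)"
      by (intro integrable_mult_left integrable_real_indicator) (auto simp: emeasure_cball)
    show "AE x in lborel. norm (g x) \<le> norm (indicator (cball 0 (max R 0)) x * B)"
    proof (rule AE_I2)
      fix x show "norm (g x) \<le> norm (indicator (cball 0 (max R 0)) x * B)"
        using g(1)[of x] g(2)[of x] by (cases "norm x \<le> max R 0") auto
    qed
  qed auto
  have il: "integrable lborel (\<lambda>x. m w * (g x * ln (norm (x - w))))" for w
    by (intro integrable_mult_right integrable_bounded_mult_ln[of _ B R]) (use g in auto)
  have e: "(\<lambda>x. g x * discrete_potential A Z m x) = (\<lambda>x. A * g x + (\<Sum>w\<in>Z. m w * (g x * ln (norm (x - w)))))"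
    by (simp add: discrete_potential_def algebra_simps sum_distrib_left)
  show "integrable lborel (\<lambda>x. g x * discrete_potential A Z m x)"
    unfolding e by (intro Bochner_Integration.integrable_add integrable_mult_right ig Bochner_Integration.integrable_sum il)
  show "(\<integral>x. g x * discrete_potential A Z m x \<partial>lborel)
      = A * (\<integral>x. g x \<partial>lborel) + (\<Sum>w\<in>Z. m w * (\<integral>x. g x * ln (norm (x - w)) \<partial>lborel))"
    unfolding e
    by (subst Bochner_Integration.integral_add, intro integrable_mult_right ig,
      intro Bochner_Integration.integrable_sum il, subst Bochner_Integration.integral_sum[OF il]) simp
qed

lemma discrete_potential_submean:
  assumes "z \<notin> Z" "\<rho> > 0" "\<And>w. w \<in> Z \<Longrightarrow> m w \<ge> 0"
  shows "pi * \<rho>\<^sup>2 * discrete_potential A Z m z \<le> (\<integral>x. indicator (cball z \<rho>) x * discrete_potential A Z m x \<partial>lborel)"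
proof -
  have [measurable]: "cball z \<rho> \<in> sets borel" by simp
  have out: "indicator (cball z \<rho>) x = (0::real)" if "norm x > norm z + \<rho>" for x
  proof -
    have "dist z x > \<rho>" using that norm_triangle_ineq2[of x z] by (simp add: dist_norm norm_minus_commute)
    then show ?thesis by simp
  qed
  have "pi * \<rho>\<^sup>2 * discrete_potential A Z m z
     = A * (pi * \<rho>\<^sup>2) + (\<Sum>w\<in>Z. m w * (pi * \<rho>\<^sup>2 * ln (norm (z - w))))"
    by (simp add: discrete_potential_def algebra_simps sum_distrib_left)
  also have "\<dots> \<le> A * (pi * \<rho>\<^sup>2) + (\<Sum>w\<in>Z. m w * (\<integral>x. indicator (cball z \<rho>) x * ln (norm (x - w)) \<partial>lborel))"
    using assms by (intro add_left_mono sum_mono mult_left_mono ln_submean_cball) auto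
  also have "\<dots> = (\<integral>x. indicator (cball z \<rho>) x * discrete_potential A Z m x \<partial>lborel)"
    by (subst discrete_potential_integral(3)[where B = 1 and R = "norm z + \<rho>"])
      (use out assms in \<open>auto simp: indicator_def content_cball unit_ball_vol_2\<close>)
  finally show ?thesis .
qed

text \<open>The shift by \<open>1 / 2\<close> keeps the grid away from the origin, where only the constant term of the
  random polynomial survives.\<close>

definition grid_point :: "nat \<Rightarrow> int \<Rightarrow> int \<Rightarrow> complex" where
  "grid_point j i k = Complex ((of_int i + 1 / 2) / real (Suc j)) (of_int k / real (Suc j))"

lemma grid_point_nonzero: "grid_point j i k \<noteq> 0"
proof
  assume "grid_point j i k = 0"
  then have "real_of_int i + 1 / 2 = 0" by (auto simp: grid_point_def complex_eq_iff)
  then have "real_of_int (2 * i + 1) = 0" by simp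
  then show False by (simp only: of_int_eq_0_iff) presburger
qed

lemma grid_point_cover:
  fixes R :: nat
  assumes "norm x \<le> real R" and N: "N = int (R * Suc j)"
  obtains i k where "i \<in> {-N..N}" "k \<in> {-N..N}" "norm (x - grid_point j i k) \<le> 3 / 2 / real (Suc j)"
proof
  define i k where "i = \<lfloor>Re x * real (Suc j)\<rfloor>" and "k = \<lfloor>Im x * real (Suc j)\<rfloor>"
  have b: "\<lfloor>y * real (Suc j)\<rfloor> \<in> {-N..N}" if "\<bar>y\<bar> \<le> real R" for y
  proof -
    have "\<bar>y * real (Suc j)\<bar> \<le> real R * real (Suc j)"
      unfolding abs_mult using that by (intro mult_mono) auto
    also have "\<dots> = of_int N" by (simp add: N algebra_simps)
    finally have "\<bar>y * real (Suc j)\<bar> \<le> of_int N" .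
    then have "- of_int N \<le> y * real (Suc j)" "y * real (Suc j) \<le> of_int N" by linarith+
    then show ?thesis by (auto simp: le_floor_iff floor_le_iff)
  qed
  show "i \<in> {-N..N}" unfolding i_def
    by (rule b) (use abs_Re_le_cmod[of x] assms(1) in linarith)
  show "k \<in> {-N..N}" unfolding k_def
    by (rule b) (use abs_Im_le_cmod[of x] assms(1) in linarith)
  define s where "s = real (Suc j)"
  have s: "s > 0" by (simp add: s_def)
  \<comment> \<open>Through the half shift the horizontal error is half a mesh width and the
    vertical one a full mesh width; together they give the factor \<open>3 / 2\<close>.\<close>
  have 1: "\<bar>Re x * s - (of_int i + 1 / 2)\<bar> \<le> 1 / 2" unfolding i_def s_def by linarith
  have 2: "\<bar>Im x * s - of_int k\<bar> \<le> 1" unfolding k_def s_def by linarith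
  have "norm (x - grid_point j i k) \<le> \<bar>Re (x - grid_point j i k)\<bar> + \<bar>Im (x - grid_point j i k)\<bar>"
    by (rule cmod_le)
  also have "Re (x - grid_point j i k) = (Re x * s - (of_int i + 1 / 2)) / s"
    using s by (simp add: grid_point_def s_def[symmetric] field_simps del: of_nat_Suc)
  also have "Im (x - grid_point j i k) = (Im x * s - of_int k) / s"
    using s by (simp add: grid_point_def s_def[symmetric] field_simps del: of_nat_Suc)
  also have "\<bar>(Re x * s - (of_int i + 1 / 2)) / s\<bar> + \<bar>(Im x * s - of_int k) / s\<bar> \<le> (1 / 2) / s + 1 / s"
    unfolding abs_divide abs_of_pos[OF s] by (intro add_mono divide_right_mono 1 2) (use s in auto)
  also have "\<dots> = 3 / 2 / s" using s by (simp add: field_simps)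
  finally show "norm (x - grid_point j i k) \<le> 3 / 2 / real (Suc j)"
    unfolding s_def .
qed

lemma norm_grid_point_le:
  fixes R :: nat
  assumes "i \<in> {-int (R * Suc j)..int (R * Suc j)}" "k \<in> {-int (R * Suc j)..int (R * Suc j)}"
  shows "norm (grid_point j i k) \<le> 2 * real R + 1"
proof -
  define s where "s = real (Suc j)"
  have s: "s \<ge> 1" by (simp add: s_def)
  have b: "\<bar>of_int l\<bar> \<le> real R * s" if "l \<in> {-int (R * Suc j)..int (R * Suc j)}" for l :: int
  proof -
    have "\<bar>l\<bar> \<le> int (R * Suc j)" using that by auto
    then have "real_of_int \<bar>l\<bar> \<le> real_of_int (int (R * Suc j))" by (simp only: of_int_le_iff)
    then show ?thesis by (simp add: s_def algebra_simps)
  qed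
  have "norm (grid_point j i k) \<le> \<bar>(of_int i + 1 / 2) / s\<bar> + \<bar>of_int k / s\<bar>"
    using cmod_le[of "grid_point j i k"] by (simp add: grid_point_def s_def)
  also have "\<dots> \<le> (real R * s + s) / s + (real R * s) / s"
    unfolding abs_divide using s b[OF assms(1)] b[OF assms(2)] by (intro add_mono frac_le) auto
  also have "\<dots> = 2 * real R + 1" using s by (simp add: add_divide_distrib)
  finally show ?thesis .
qed

text \<open>On a disc around a point where \<open>u n\<close> is almost as large as its limit \<open>U\<close>, the nonnegative function
  \<open>U + \<delta> - u n\<close> has a small mean by the submean value property. As the number of grid points is
  of order \<open>1 / \<eta>\<^sup>2\<close>, summing over the discs of radius \<open>3 * \<eta>\<close> loses only a constant factor.\<close>

lemma potential_L1_convergence: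
  fixes u :: "nat \<Rightarrow> complex \<Rightarrow> real" and R :: nat
  assumes \<alpha>: "\<alpha> > 0"
    and u: "\<And>n. u n = discrete_potential (A n) (Z n) (m n)"
    and fin: "\<And>n. finite (Z n)" and m: "\<And>n w. w \<in> Z n \<Longrightarrow> m n w \<ge> 0"
    and up: "\<And>R \<epsilon>. \<epsilon> > 0 \<Longrightarrow> \<forall>\<^sub>F n in sequentially. \<forall>z. norm z \<le> R \<longrightarrow> z \<notin> Z n \<longrightarrow> u n z \<le> limit_potential \<alpha> (norm z) + \<epsilon>"
    and low: "\<And>j i k \<epsilon> \<eta>. \<epsilon> > 0 \<Longrightarrow> \<eta> > 0 \<Longrightarrow> \<forall>\<^sub>F n in sequentially.
      \<exists>z\<in>cball (grid_point j i k) \<eta>. z \<notin> Z n \<and> u n z \<ge> limit_potential \<alpha> (norm (grid_point j i k)) - \<epsilon>"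
    and R: "R \<ge> 1"
  shows "(\<lambda>n. \<integral>x. indicator (cball 0 (real R)) x * \<bar>u n x - limit_potential \<alpha> (norm x)\<bar> \<partial>lborel) \<longlonglongrightarrow> 0"
proof -
  define U where "U x = limit_potential \<alpha> (norm x)" for x :: complex
  have Uc: "continuous_on S U" for S unfolding U_def by (rule continuous_on_limit_potential[OF \<alpha>])
  have [measurable]: "U \<in> borel_measurable borel" by (rule borel_measurable_continuous_onI[OF Uc])
  have [measurable]: "u n \<in> borel_measurable borel" for n by (simp add: u)
  have [measurable]: "cball z s \<in> sets borel" for z :: complex and s by simp
  have iU: "integrable lborel (\<lambda>x. indicator (cball z s) x * U x)" for z s
    using borel_integrable_compact[of "cball z s" U] Uc by simp
  have ind0: "indicator (cball z s) x = (0::real)" if "norm x > norm z + s" for z x :: complex and s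
  proof -
    have "dist z x > s" using that norm_triangle_ineq2[of x z] by (simp add: dist_norm norm_minus_commute)
    then show ?thesis by simp
  qed
  have iu: "integrable lborel (\<lambda>x. indicator (cball z s) x * u n x)" for z s n
    unfolding u by (rule discrete_potential_integral(2)[where B = 1 and R = "norm z + s"]) (use ind0 in \<open>auto simp: indicator_def\<close>)
  have ic: "integrable lborel (\<lambda>x. indicator (cball z s) x * c :: real)" if "s \<ge> 0" for z :: complex and s c
    using that by (intro integrable_mult_left integrable_real_indicator) (auto simp: emeasure_cball)
  have vol: "measure lborel (cball z s) = pi * s\<^sup>2" if "s \<ge> 0" for z :: complex and s
    using that by (simp add: content_cball unit_ball_vol_2)
  have aeZ: "AE x in lborel. x \<notin> Z n" for n
    using fin[of n] by (intro AE_not_in finite_imp_null_set_lborel)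
  \<comment> \<open>\<open>244 = 1 + 9 * 27\<close>: the 1 comes from \<open>\<delta>\<close> in the
    bound of \<open>\<bar>u n x - U x\<bar>\<close> by \<open>\<delta> + ?h x\<close>, the 9 from
    the number of grid points, the 27 from each disc.\<close>
  have main: "\<forall>\<^sub>F n in sequentially. (\<integral>x. indicator (cball 0 (real R)) x * \<bar>u n x - U x\<bar> \<partial>lborel)
      \<le> 244 * pi * (real R)\<^sup>2 * \<delta>" if \<delta>: "\<delta> > 0" for \<delta>
  proof -
    \<comment> \<open>Grid points have modulus at most \<open>2 * R + 1\<close>, and the discs reach
      at most \<open>4 * \<eta> \<le> 4\<close> beyond them.\<close>
    define Q where "Q = 2 * real R + 6"
    have "uniformly_continuous_on (cball 0 Q) U"
      by (intro compact_uniformly_continuous Uc) auto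
    then obtain \<eta>0 where \<eta>0: "\<eta>0 > 0" "\<And>x y. norm x \<le> Q \<Longrightarrow> norm y \<le> Q \<Longrightarrow> dist y x < \<eta>0 \<Longrightarrow> dist (U y) (U x) < \<delta>"
      using \<delta> unfolding uniformly_continuous_on_def by (metis mem_cball_0)
    obtain j where j: "1 / real (Suc j) < \<eta>0 / 4"
      using \<eta>0(1) by (metis divide_pos_pos nat_approx_posE zero_less_numeral)
    define \<eta> where "\<eta> = 1 / real (Suc j)"
    have \<eta>: "\<eta> > 0" "\<eta> \<le> 1" "4 * \<eta> < \<eta>0" using j by (auto simp: \<eta>_def)
    define N where "N = int (R * Suc j)"
    define G where "G = {-N..N} \<times> {-N..N}"
    have cardG: "real (card G) \<le> 9 * (real R)\<^sup>2 / \<eta>\<^sup>2"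
    proof -
      have N1: "N \<ge> 1" using R unfolding N_def
        by (metis One_nat_def Suc_le_eq mult_pos_pos of_nat_1 of_nat_mono zero_less_Suc)
      have "card G = nat (2 * N + 1) * nat (2 * N + 1)" by (simp add: G_def)
      then have "real (card G) = real (nat (2 * N + 1)) * real (nat (2 * N + 1))" by simp
      also have "\<dots> = (2 * of_int N + 1) * (2 * of_int N + 1)" using N1 by simp
      also have "\<dots> \<le> (3 * of_int N) * (3 * of_int N :: real)" using N1 by (intro mult_mono) auto
      also have "\<dots> = 9 * (real R)\<^sup>2 / \<eta>\<^sup>2"
        by (simp add: N_def \<eta>_def power2_eq_square algebra_simps)
      finally show ?thesis .
    qed
    let ?b = "\<lambda>(i, k). grid_point j i k"
    have "\<forall>\<^sub>F n in sequentially. \<forall>p\<in>G. \<exists>z\<in>cball (?b p) \<eta>. z \<notin> Z n \<and> u n z \<ge> U (?b p) - \<delta>"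
      using low[OF \<delta> \<eta>(1), of j] by (intro eventually_ball_finite) (auto simp: G_def U_def)
    moreover have "\<forall>\<^sub>F n in sequentially. \<forall>z. norm z \<le> Q \<longrightarrow> z \<notin> Z n \<longrightarrow> u n z \<le> U z + \<delta>"
      using up[OF \<delta>, of Q] by (simp add: U_def)
    ultimately show ?thesis
    proof eventually_elim
      case (elim n)
      then obtain \<zeta> where \<zeta>: "\<And>p. p \<in> G \<Longrightarrow> \<zeta> p \<in> cball (?b p) \<eta> \<and> \<zeta> p \<notin> Z n \<and> u n (\<zeta> p) \<ge> U (?b p) - \<delta>"
        by metis
      have upn: "u n z \<le> U z + \<delta>" if "norm z \<le> Q" "z \<notin> Z n" for z using elim(2) that by blast
      let ?h = "\<lambda>x. U x + \<delta> - u n x"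
      have bn: "norm (?b p) \<le> 2 * real R + 1" if "p \<in> G" for p
        using that norm_grid_point_le[of "fst p" R j "snd p"] by (auto simp: G_def N_def split: prod.splits)
      have inball: "norm x \<le> Q \<and> dist (?b p) x < \<eta>0" if "p \<in> G" "x \<in> cball (\<zeta> p) (3 * \<eta>)" for p x
      proof -
        have "dist (?b p) x \<le> dist (?b p) (\<zeta> p) + dist (\<zeta> p) x" by (rule dist_triangle)
        also have "\<dots> \<le> 4 * \<eta>" using \<zeta>[OF that(1)] that(2) by simp
        finally have 1: "dist (?b p) x \<le> 4 * \<eta>" .
        have "norm x \<le> norm (?b p) + dist (?b p) x"
          by (metis dist_commute dist_norm norm_triangle_sub)
        then show ?thesis using 1 \<eta> bn[OF that(1)] by (simp add: Q_def)
      qed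
      \<comment> \<open>Area \<open>9 * pi * \<eta>^2\<close> times three errors
        \<open>\<delta>\<close>: the oscillation of \<open>U\<close>, the shift inside
        \<open>?h\<close>, and the gap in the lower bound at \<open>\<zeta> p\<close>.\<close>
      have one: "(\<integral>x. indicator (cball (\<zeta> p) (3 * \<eta>)) x * ?h x \<partial>lborel) \<le> 27 * pi * \<eta>\<^sup>2 * \<delta>" if p: "p \<in> G" for p
      proof -
        let ?D = "cball (\<zeta> p) (3 * \<eta>)"
        have "(\<integral>x. indicator ?D x * ?h x \<partial>lborel)
           = (\<integral>x. indicator ?D x * U x + indicator ?D x * \<delta> - indicator ?D x * u n x \<partial>lborel)"
          by (simp add: algebra_simps)
        also have "\<dots> = (\<integral>x. indicator ?D x * U x \<partial>lborel) + pi * (3 * \<eta>)\<^sup>2 * \<delta> - (\<integral>x. indicator ?D x * u n x \<partial>lborel)"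
          using iU iu ic[of "3 * \<eta>" "\<zeta> p" \<delta>] \<eta> vol[of "3 * \<eta>" "\<zeta> p"] by simp
        also have "(\<integral>x. indicator ?D x * U x \<partial>lborel) \<le> (\<integral>x. indicator ?D x * (U (?b p) + \<delta>) \<partial>lborel)"
        proof (rule integral_mono[OF iU ic])
          fix x show "indicator ?D x * U x \<le> indicator ?D x * (U (?b p) + \<delta>)"
          proof (cases "x \<in> ?D")
            case True
            have "norm (?b p) \<le> Q" using bn[OF p] by (simp add: Q_def)
            then have "dist (U (?b p)) (U x) < \<delta>"
              using inball[OF p True] by (intro \<eta>0(2)) auto
            then show ?thesis using True by (simp add: dist_real_def)
          qed simp
        qed (use \<eta> in simp)
        also have "\<dots> = pi * (3 * \<eta>)\<^sup>2 * (U (?b p) + \<delta>)"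
          using vol[of "3 * \<eta>" "\<zeta> p"] \<eta> by simp
        finally have A: "(\<integral>x. indicator ?D x * ?h x \<partial>lborel) \<le> pi * (3 * \<eta>)\<^sup>2 * (U (?b p) + \<delta>) + pi * (3 * \<eta>)\<^sup>2 * \<delta> - (\<integral>x. indicator ?D x * u n x \<partial>lborel)"
          by simp
        have "pi * (3 * \<eta>)\<^sup>2 * (U (?b p) - \<delta>) \<le> pi * (3 * \<eta>)\<^sup>2 * u n (\<zeta> p)"
          using \<zeta>[OF p] by (intro mult_left_mono) auto
        also have "\<dots> \<le> (\<integral>x. indicator ?D x * u n x \<partial>lborel)"
          unfolding u by (rule discrete_potential_submean) (use \<zeta>[OF p] \<eta> m in auto)
        finally have "pi * (3 * \<eta>)\<^sup>2 * (U (?b p) - \<delta>) \<le> (\<integral>x. indicator ?D x * u n x \<partial>lborel)" .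
        with A show ?thesis by (simp add: algebra_simps power2_eq_square)
      qed
      have "(\<integral>x. indicator (cball 0 (real R)) x * \<bar>u n x - U x\<bar> \<partial>lborel)
        \<le> (\<integral>x. indicator (cball 0 (real R)) x * \<delta> + (\<Sum>p\<in>G. indicator (cball (\<zeta> p) (3 * \<eta>)) x * ?h x) \<partial>lborel)"
      proof (rule integral_mono_AE)
        have "integrable lborel (\<lambda>x. \<bar>indicator (cball 0 (real R)) x * u n x - indicator (cball 0 (real R)) x * U x\<bar>)"
          by (intro integrable_abs Bochner_Integration.integrable_diff iu iU)
        then show "integrable lborel (\<lambda>x. indicator (cball 0 (real R)) x * \<bar>u n x - U x\<bar>)"
          by (simp flip: right_diff_distrib add: abs_mult)
        have ih: "integrable lborel (\<lambda>x. indicator (cball (\<zeta> p) (3 * \<eta>)) x * ?h x)" for p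
        proof -
          have "integrable lborel (\<lambda>x. indicator (cball (\<zeta> p) (3 * \<eta>)) x * U x + indicator (cball (\<zeta> p) (3 * \<eta>)) x * \<delta> - indicator (cball (\<zeta> p) (3 * \<eta>)) x * u n x)"
            using \<eta> by (intro Bochner_Integration.integrable_add Bochner_Integration.integrable_diff iu iU ic) auto
          then show ?thesis by (simp add: algebra_simps)
        qed
        show "integrable lborel (\<lambda>x. indicator (cball 0 (real R)) x * \<delta> + (\<Sum>p\<in>G. indicator (cball (\<zeta> p) (3 * \<eta>)) x * ?h x))"
          by (intro Bochner_Integration.integrable_add Bochner_Integration.integrable_sum ic ih) simp
        show "AE x in lborel. indicator (cball 0 (real R)) x * \<bar>u n x - U x\<bar>
           \<le> indicator (cball 0 (real R)) x * \<delta> + (\<Sum>p\<in>G. indicator (cball (\<zeta> p) (3 * \<eta>)) x * ?h x)"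
          using aeZ[of n]
        proof eventually_elim
          case (elim x)
          have nn: "0 \<le> indicator (cball (\<zeta> p) (3 * \<eta>)) x * ?h x" if "p \<in> G" for p
          proof (cases "x \<in> cball (\<zeta> p) (3 * \<eta>)")
            case True
            then show ?thesis using upn[of x] inball[OF that True] elim by simp
          qed simp
          show ?case
          proof (cases "norm x \<le> real R")
            case True
            obtain i k where ik: "i \<in> {-N..N}" "k \<in> {-N..N}" "norm (x - grid_point j i k) \<le> 3 / 2 / real (Suc j)"
              using grid_point_cover[OF True N_def] .
            then have p: "(i, k) \<in> G" by (simp add: G_def)
            \<comment> \<open>The good point may lie \<open>\<eta>\<close> away from its grid point,
              and \<open>x\<close> another \<open>3 / 2 * \<eta>\<close>; the radius
              \<open>3 * \<eta>\<close> makes the discs cover nevertheless.\<close>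
            have "dist (\<zeta> (i, k)) x \<le> dist (grid_point j i k) (\<zeta> (i, k)) + dist (grid_point j i k) x"
              by (rule dist_triangle3)
            also have "\<dots> \<le> \<eta> + 3 / 2 * \<eta>"
              using \<zeta>[OF p] ik(3) by (intro add_mono) (auto simp: dist_norm norm_minus_commute \<eta>_def)
            finally have xin: "x \<in> cball (\<zeta> (i, k)) (3 * \<eta>)" using \<eta> by simp
            have "\<bar>u n x - U x\<bar> \<le> \<delta> + ?h x"
              using upn[of x] inball[OF p xin] elim \<delta> by (auto simp: abs_if)
            also have "?h x = indicator (cball (\<zeta> (i, k)) (3 * \<eta>)) x * ?h x" using xin by simp
            also have "\<dots> \<le> (\<Sum>p\<in>G. indicator (cball (\<zeta> p) (3 * \<eta>)) x * ?h x)"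
              using nn p by (intro member_le_sum) (auto simp: G_def)
            finally show ?thesis using True by simp
          next
            case False
            then show ?thesis using nn by (simp add: sum_nonneg)
          qed
        qed
      qed
      also have "\<dots> = pi * (real R)\<^sup>2 * \<delta> + (\<Sum>p\<in>G. \<integral>x. indicator (cball (\<zeta> p) (3 * \<eta>)) x * ?h x \<partial>lborel)"
      proof -
        have ih: "integrable lborel (\<lambda>x. indicator (cball (\<zeta> p) (3 * \<eta>)) x * ?h x)" for p
        proof -
          have "integrable lborel (\<lambda>x. indicator (cball (\<zeta> p) (3 * \<eta>)) x * U x + indicator (cball (\<zeta> p) (3 * \<eta>)) x * \<delta> - indicator (cball (\<zeta> p) (3 * \<eta>)) x * u n x)"
            using \<eta> by (intro Bochner_Integration.integrable_add Bochner_Integration.integrable_diff iu iU ic) auto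
          then show ?thesis by (simp add: algebra_simps)
        qed
        show ?thesis
          by (subst Bochner_Integration.integral_add[OF ic Bochner_Integration.integrable_sum[OF ih]], simp,
            subst Bochner_Integration.integral_sum[OF ih], simp add: vol)
      qed
      also have "\<dots> \<le> pi * (real R)\<^sup>2 * \<delta> + (\<Sum>p\<in>G. 27 * pi * \<eta>\<^sup>2 * \<delta>)"
        by (intro add_left_mono sum_mono one)
      also have "\<dots> = pi * (real R)\<^sup>2 * \<delta> + real (card G) * (27 * pi * \<eta>\<^sup>2 * \<delta>)" by simp
      also have "\<dots> \<le> pi * (real R)\<^sup>2 * \<delta> + (9 * (real R)\<^sup>2 / \<eta>\<^sup>2) * (27 * pi * \<eta>\<^sup>2 * \<delta>)"
        using \<delta> by (intro add_left_mono mult_right_mono cardG) auto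
      also have "\<dots> = 244 * pi * (real R)\<^sup>2 * \<delta>" using \<eta> by (simp add: field_simps)
      finally show ?case .
    qed
  qed
  show ?thesis
  proof (rule order_tendstoI)
    fix a :: real assume "a < 0"
    then show "\<forall>\<^sub>F n in sequentially. a < (\<integral>x. indicator (cball 0 (real R)) x * \<bar>u n x - limit_potential \<alpha> (norm x)\<bar> \<partial>lborel)"
      by (intro always_eventually allI order.strict_trans2[OF _ Bochner_Integration.integral_nonneg]) auto
  next
    fix a :: real assume a: "0 < a"
    define \<delta> where "\<delta> = a / (488 * pi * (real R)\<^sup>2)"
    have "\<delta> > 0" using a R by (simp add: \<delta>_def)
    moreover have "244 * pi * (real R)\<^sup>2 * \<delta> < a" using a R by (simp add: \<delta>_def)
    ultimately show "\<forall>\<^sub>F n in sequentially. (\<integral>x. indicator (cball 0 (real R)) x * \<bar>u n x - limit_potential \<alpha> (norm x)\<bar> \<partial>lborel) < a"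
      using main[of \<delta>] by (auto simp: U_def elim: eventually_mono)
  qed
qed

text \<open>Fubini combined with the potential of the limit measure, which is
  \<open>limit_potential\<close> minus \<open>\<alpha>\<close>; integral 0 cancels the
  \<open>\<alpha>\<close>. The logarithmic bound, uniform over poles in the unit disc, gives
  integrability on the product.\<close>

lemma integral_limit_potential:
  assumes \<alpha>: "\<alpha> > 0" and [measurable]: "g \<in> borel_measurable borel"
    and g: "\<And>x. \<bar>g x\<bar> \<le> B" "\<And>x. norm x > R \<Longrightarrow> g x = 0" "(\<integral>x. g x \<partial>lborel) = 0" and R: "R > 0"
  shows "integrable (limit_measure \<alpha>) (\<lambda>w. \<integral>x. g x * ln (norm (x - w)) \<partial>lborel)"
    and "(\<integral>x. g x * limit_potential \<alpha> (norm x) \<partial>lborel) = (\<integral>w. (\<integral>x. g x * ln (norm (x - w)) \<partial>lborel) \<partial>limit_measure \<alpha>)"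
proof -
  interpret N: prob_space "limit_measure \<alpha>" by (rule prob_space_limit_measure[OF \<alpha>])
  interpret P: pair_sigma_finite "limit_measure \<alpha>" "lborel :: complex measure"
    by (intro pair_sigma_finite.intro sigma_finite_lborel N.sigma_finite_measure_axioms)
  have [measurable]: "cball (0::complex) R \<in> sets borel" by simp
  have B: "B \<ge> 0" using g(1)[of 0] by linarith
  obtain D where D: "D \<ge> 0" "\<And>v. norm v \<le> 1 \<Longrightarrow>
    (\<integral>\<^sup>+a\<in>cball 0 R. ennreal \<bar>ln (norm (a - v))\<bar> \<partial>(lborel::complex measure)) \<le> ennreal D"
    using nn_integral_ln_norm_cball[of R 1] R by auto
  have i1: "integrable lborel (\<lambda>x. g x * ln (norm (x - w)))" for w
    by (rule integrable_bounded_mult_ln) (use g in auto)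
  have b1: "(\<integral>x. \<bar>g x * ln (norm (x - w))\<bar> \<partial>lborel) \<le> B * D" if w: "norm w \<le> 1" for w
  proof -
    have "(\<integral>\<^sup>+x. ennreal \<bar>g x * ln (norm (x - w))\<bar> \<partial>lborel)
       \<le> (\<integral>\<^sup>+a. ennreal B * (ennreal \<bar>ln (norm (a - w))\<bar> * indicator (cball 0 R) a) \<partial>lborel)"
    proof (rule nn_integral_mono)
      fix x :: complex
      show "ennreal \<bar>g x * ln (norm (x - w))\<bar> \<le> ennreal B * (ennreal \<bar>ln (norm (x - w))\<bar> * indicator (cball 0 R) x)"
        using g(1,2)[of x] B by (cases "norm x \<le> R")
          (auto simp: abs_mult simp flip: ennreal_mult intro!: ennreal_leI mult_right_mono)
    qed
    also have "\<dots> = ennreal B * (\<integral>\<^sup>+a\<in>cball 0 R. ennreal \<bar>ln (norm (a - w))\<bar> \<partial>lborel)"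
      by (rule nn_integral_cmult) measurable
    also have "\<dots> \<le> ennreal B * ennreal D"
      by (intro mult_left_mono D w) auto
    also have "\<dots> = ennreal (B * D)" using B D by (simp add: ennreal_mult)
    finally show ?thesis
      using B D by (subst integral_eq_nn_integral) (auto intro!: enn2real_leI)
  qed
  have F: "integrable (limit_measure \<alpha> \<Otimes>\<^sub>M lborel) (\<lambda>(w, x). g x * ln (norm (x - w)))"
  proof (rule P.Fubini_integrable)
    show "integrable (limit_measure \<alpha>) (\<lambda>w. \<integral>x. norm (case (w, x) of (w, x) \<Rightarrow> g x * ln (norm (x - w))) \<partial>lborel)"
    proof (rule N.integrable_const_bound[where B = "B * D"])
      show "AE w in limit_measure \<alpha>. norm (\<integral>x. norm (case (w, x) of (w, x) \<Rightarrow> g x * ln (norm (x - w))) \<partial>lborel) \<le> B * D"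
        using AE_limit_measure[OF \<alpha>, of 0] by eventually_elim (use b1 in auto)
    qed simp
  qed (use i1 in auto)
  have ig: "integrable lborel g"
    by (rule discrete_potential_integral(1)[of _ B R]) (use g in auto)
  show "integrable (limit_measure \<alpha>) (\<lambda>w. \<integral>x. g x * ln (norm (x - w)) \<partial>lborel)"
    using P.integrable_fst'[OF F] by simp
  have "(\<integral>w. (\<integral>x. g x * ln (norm (x - w)) \<partial>lborel) \<partial>limit_measure \<alpha>)
    = (\<integral>x. (\<integral>w. g x * ln (norm (x - w)) \<partial>limit_measure \<alpha>) \<partial>lborel)"
    using P.Fubini_integral[OF F] by simp
  also have "\<dots> = (\<integral>x. g x * limit_potential \<alpha> (norm x) - \<alpha> * g x \<partial>lborel)"
  proof (rule integral_cong_AE)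
    show "AE x in lborel. (\<integral>w. g x * ln (norm (x - w)) \<partial>limit_measure \<alpha>) = g x * limit_potential \<alpha> (norm x) - \<alpha> * g x"
      using AE_lborel_singleton[of 0]
    proof eventually_elim
      case (elim x)
      have "(\<integral>w. g x * ln (norm (x - w)) \<partial>limit_measure \<alpha>) = g x * (\<integral>w. ln (norm (w - x)) \<partial>limit_measure \<alpha>)"
        by (simp add: norm_minus_commute)
      then show ?case
        by (simp only: limit_measure_ln_integral(2)[OF \<alpha> elim]) (simp add: algebra_simps)
    qed
    show "(\<lambda>x. g x * limit_potential \<alpha> (norm x) - \<alpha> * g x) \<in> borel_measurable lborel"
      using borel_measurable_continuous_onI[OF continuous_on_limit_potential[OF \<alpha>]] by simp
  qed measurable
  also have "\<dots> = (\<integral>x. g x * limit_potential \<alpha> (norm x) \<partial>lborel)"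
  proof -
    have "integrable lborel (\<lambda>x. indicator (cball (0::complex) R) x * limit_potential \<alpha> (norm x) :: real)" for R
      using borel_integrable_compact[of "cball (0::complex) R" "\<lambda>x. limit_potential \<alpha> (norm x)"]
        continuous_on_limit_potential[OF \<alpha>] by simp
    then have "integrable lborel (\<lambda>x::complex. B * (indicator (cball 0 R) x * limit_potential \<alpha> (norm x)))"
      by (rule integrable_mult_right)
    then have "integrable lborel (\<lambda>x. g x * limit_potential \<alpha> (norm x))"
    proof (rule Bochner_Integration.integrable_bound)
      show "AE x in lborel. norm (g x * limit_potential \<alpha> (norm x)) \<le> norm (B * (indicator (cball 0 R) x * limit_potential \<alpha> (norm x)))"
      proof (rule AE_I2)
        fix x show "norm (g x * limit_potential \<alpha> (norm x)) \<le> norm (B * (indicator (cball 0 R) x * limit_potential \<alpha> (norm x)))"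
          using g(1,2)[of x] B by (cases "norm x \<le> R") (auto simp: abs_mult intro!: mult_right_mono)
      qed
      show "(\<lambda>x. g x * limit_potential \<alpha> (norm x)) \<in> borel_measurable lborel"
        using borel_measurable_continuous_onI[OF continuous_on_limit_potential[OF \<alpha>]] by simp
    qed
    then show ?thesis using ig g(3) by simp
  qed
  finally show "(\<integral>x. g x * limit_potential \<alpha> (norm x) \<partial>lborel) = (\<integral>w. (\<integral>x. g x * ln (norm (x - w)) \<partial>lborel) \<partial>limit_measure \<alpha>)" ..
qed

text \<open>Replacing \<open>\<phi>\<close> by the potential \<open>V\<close> of \<open>g\<close>
  costs at most \<open>\<epsilon>\<close> on either side because both masses are at most 1. The two
  integrals of \<open>V\<close> differ by the pairing of \<open>g\<close> with \<open>u n\<close>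
  minus its limit, which local \<open>L1\<close> convergence controls.\<close>

lemma discrete_measures_converge:
  fixes u :: "nat \<Rightarrow> complex \<Rightarrow> real" and \<phi> :: "complex \<Rightarrow> real"
  assumes \<alpha>: "\<alpha> > 0"
    and u: "\<And>n. u n = discrete_potential (A n) (Z n) (m n)"
    and fin: "\<And>n. finite (Z n)" and m: "\<And>n w. w \<in> Z n \<Longrightarrow> m n w \<ge> 0" "\<And>n. sum (m n) (Z n) \<le> 1"
    and up: "\<And>R \<epsilon>. \<epsilon> > 0 \<Longrightarrow> \<forall>\<^sub>F n in sequentially. \<forall>z. norm z \<le> R \<longrightarrow> z \<notin> Z n \<longrightarrow> u n z \<le> limit_potential \<alpha> (norm z) + \<epsilon>"
    and low: "\<And>j i k \<epsilon> \<eta>. \<epsilon> > 0 \<Longrightarrow> \<eta> > 0 \<Longrightarrow> \<forall>\<^sub>F n in sequentially.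
      \<exists>z\<in>cball (grid_point j i k) \<eta>. z \<notin> Z n \<and> u n z \<ge> limit_potential \<alpha> (norm (grid_point j i k)) - \<epsilon>"
    and c: "continuous_on UNIV \<phi>" and k: "compact (closure {z. \<phi> z \<noteq> 0})"
  shows "(\<lambda>n. \<Sum>w\<in>Z n. m n w * \<phi> w) \<longlonglongrightarrow> (\<integral>w. \<phi> w \<partial>limit_measure \<alpha>)"
proof (rule LIMSEQ_I)
  interpret N: prob_space "limit_measure \<alpha>" by (rule prob_space_limit_measure[OF \<alpha>])
  fix \<epsilon>' :: real assume \<epsilon>': "0 < \<epsilon>'"
  define \<epsilon> where "\<epsilon> = \<epsilon>' / 4"
  have \<epsilon>: "\<epsilon> > 0" using \<epsilon>' by (simp add: \<epsilon>_def)
  obtain g :: "complex \<Rightarrow> real" and B R where [measurable]: "g \<in> borel_measurable borel"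
    and g: "\<And>x. \<bar>g x\<bar> \<le> B" "R > 0" "\<And>x. norm x > R \<Longrightarrow> g x = 0" "(\<integral>x. g x \<partial>lborel) = 0"
    and app: "\<And>z. \<bar>(\<integral>x. g x * ln (norm (x - z)) \<partial>lborel) - \<phi> z\<bar> \<le> \<epsilon>"
    by (rule approx_by_potential[OF c k \<epsilon>]) (rule that; assumption)
  obtain B\<phi> where B\<phi>: "\<And>x. \<bar>\<phi> x\<bar> \<le> B\<phi>" by (rule compact_support_bounds[OF c k]) (rule that)
  have [measurable]: "\<phi> \<in> borel_measurable borel" using c by (rule borel_measurable_continuous_onI)
  define V where "V z = (\<integral>x. g x * ln (norm (x - z)) \<partial>lborel)" for z
  have iV: "integrable (limit_measure \<alpha>) V"
    unfolding V_def[abs_def] by (rule integral_limit_potential(1)[OF \<alpha>, of g B R]) (use g in auto)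
  have i\<phi>: "integrable (limit_measure \<alpha>) \<phi>"
    by (rule N.integrable_const_bound[where B = B\<phi>]) (use B\<phi> in auto)
  have B: "B \<ge> 0" using g(1)[of 0] by linarith
  define K where "K = nat \<lceil>max R 1\<rceil>"
  have K: "K \<ge> 1" "R \<le> real K" unfolding K_def by linarith+
  have [measurable]: "u n \<in> borel_measurable borel" for n by (simp add: u)
  have Um[measurable]: "(\<lambda>x::complex. limit_potential \<alpha> (norm x)) \<in> borel_measurable borel"
    by (rule borel_measurable_continuous_onI[OF continuous_on_limit_potential[OF \<alpha>]])
  have [measurable]: "cball (0::complex) (real K) \<in> sets borel" by simp
  let ?d = "\<lambda>n x. indicator (cball 0 (real K)) x * \<bar>u n x - limit_potential \<alpha> (norm x)\<bar>"
  have lim: "(\<lambda>n. \<integral>x. ?d n x \<partial>lborel) \<longlonglongrightarrow> 0"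
    by (rule potential_L1_convergence[OF \<alpha> u fin m(1) up low K(1)])
  have iUK: "integrable lborel (\<lambda>x. indicator (cball (0::complex) (real K)) x * limit_potential \<alpha> (norm x) :: real)"
    using borel_integrable_compact[of "cball (0::complex) (real K)" "\<lambda>x. limit_potential \<alpha> (norm x)"]
      continuous_on_limit_potential[OF \<alpha>] by simp
  have iuK: "integrable lborel (\<lambda>x. indicator (cball 0 (real K)) x * u n x)" for n
    unfolding u by (rule discrete_potential_integral(2)[where B = 1 and R = "real K"]) (auto simp: indicator_def)
  have id: "integrable lborel (?d n)" for n
  proof -
    have "integrable lborel (\<lambda>x. \<bar>indicator (cball 0 (real K)) x * u n x - indicator (cball 0 (real K)) x * limit_potential \<alpha> (norm x)\<bar>)"
      by (intro integrable_abs Bochner_Integration.integrable_diff iuK iUK)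
    then show ?thesis by (simp flip: right_diff_distrib add: abs_mult)
  qed
  have bd: "\<bar>(\<Sum>w\<in>Z n. m n w * V w) - (\<integral>w. V w \<partial>limit_measure \<alpha>)\<bar> \<le> B * (\<integral>x. ?d n x \<partial>lborel)" for n
  proof -
    have 1: "(\<Sum>w\<in>Z n. m n w * V w) = (\<integral>x. g x * u n x \<partial>lborel)"
      unfolding u V_def by (subst discrete_potential_integral(3)[where B = B and R = R]) (use g in auto)
    have 2: "(\<integral>w. V w \<partial>limit_measure \<alpha>) = (\<integral>x. g x * limit_potential \<alpha> (norm x) \<partial>lborel)"
      unfolding V_def by (rule integral_limit_potential(2)[OF \<alpha>, of g B R, symmetric]) (use g in auto)
    have dom: "\<bar>g x * (u n x - limit_potential \<alpha> (norm x))\<bar> \<le> B * ?d n x" for x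
      using g(1,3)[of x] K B by (cases "norm x \<le> K") (auto simp: abs_mult intro!: mult_right_mono)
    have idg: "integrable lborel (\<lambda>x. g x * (u n x - limit_potential \<alpha> (norm x)))"
      by (rule Bochner_Integration.integrable_bound[OF integrable_mult_right[OF id, of B n]])
        (use dom B in auto)
    have iu: "integrable lborel (\<lambda>x. g x * u n x)"
      unfolding u by (rule discrete_potential_integral(2)[where B = B and R = R]) (use g in auto)
    have "integrable lborel (\<lambda>x. g x * u n x - g x * (u n x - limit_potential \<alpha> (norm x)))"
      using iu idg by (rule Bochner_Integration.integrable_diff)
    then have iU: "integrable lborel (\<lambda>x. g x * limit_potential \<alpha> (norm x))" by (simp add: algebra_simps)
    have "(\<Sum>w\<in>Z n. m n w * V w) - (\<integral>w. V w \<partial>limit_measure \<alpha>) = (\<integral>x. g x * (u n x - limit_potential \<alpha> (norm x)) \<partial>lborel)"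
      unfolding 1 2 right_diff_distrib using iu iU by simp
    also have "\<bar>\<dots>\<bar> \<le> (\<integral>x. \<bar>g x * (u n x - limit_potential \<alpha> (norm x))\<bar> \<partial>lborel)"
      by (rule integral_abs_bound)
    also have "\<dots> \<le> (\<integral>x. B * ?d n x \<partial>lborel)"
      by (rule integral_mono) (use idg id dom in auto)
    finally show ?thesis by simp
  qed
  have "(\<lambda>n. B * (\<integral>x. ?d n x \<partial>lborel)) \<longlonglongrightarrow> B * 0"
    by (intro tendsto_mult tendsto_const lim)
  then have "\<forall>\<^sub>F n in sequentially. B * (\<integral>x. ?d n x \<partial>lborel) < \<epsilon>"
    by (rule order_tendstoD(2)) (use \<epsilon> in simp)
  then obtain n0 where n0: "\<And>n. n \<ge> n0 \<Longrightarrow> B * (\<integral>x. ?d n x \<partial>lborel) < \<epsilon>"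
    by (auto simp: eventually_sequentially)
  have V\<phi>: "\<bar>(\<integral>w. V w \<partial>limit_measure \<alpha>) - (\<integral>w. \<phi> w \<partial>limit_measure \<alpha>)\<bar> \<le> \<epsilon>"
  proof -
    have "\<bar>(\<integral>w. V w \<partial>limit_measure \<alpha>) - (\<integral>w. \<phi> w \<partial>limit_measure \<alpha>)\<bar> = \<bar>\<integral>w. V w - \<phi> w \<partial>limit_measure \<alpha>\<bar>"
      using iV i\<phi> by simp
    also have "\<dots> \<le> (\<integral>w. \<bar>V w - \<phi> w\<bar> \<partial>limit_measure \<alpha>)" by (rule integral_abs_bound)
    also have "\<dots> \<le> (\<integral>w. \<epsilon> \<partial>limit_measure \<alpha>)"
      by (rule integral_mono) (use iV i\<phi> app in \<open>auto simp: V_def[symmetric]\<close>)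
    finally show ?thesis using N.prob_space by simp
  qed
  have \<phi>V: "\<bar>(\<Sum>w\<in>Z n. m n w * \<phi> w) - (\<Sum>w\<in>Z n. m n w * V w)\<bar> \<le> \<epsilon>" for n
  proof -
    have "\<bar>(\<Sum>w\<in>Z n. m n w * \<phi> w) - (\<Sum>w\<in>Z n. m n w * V w)\<bar> = \<bar>\<Sum>w\<in>Z n. m n w * (\<phi> w - V w)\<bar>"
      by (simp add: sum_subtractf right_diff_distrib)
    also have "\<dots> \<le> (\<Sum>w\<in>Z n. \<bar>m n w * (\<phi> w - V w)\<bar>)" by (rule sum_abs)
    also have "\<dots> \<le> (\<Sum>w\<in>Z n. m n w * \<epsilon>)"
    proof (rule sum_mono)
      fix w assume "w \<in> Z n"
      then show "\<bar>m n w * (\<phi> w - V w)\<bar> \<le> m n w * \<epsilon>"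
        using m(1)[of w n] app[of w] by (auto simp: abs_mult V_def abs_minus_commute intro!: mult_left_mono)
    qed
    also have "\<dots> = sum (m n) (Z n) * \<epsilon>" by (simp add: sum_distrib_right)
    also have "\<dots> \<le> 1 * \<epsilon>" using m(2)[of n] \<epsilon> by (intro mult_right_mono) auto
    finally show ?thesis by simp
  qed
  have "norm ((\<Sum>w\<in>Z n. m n w * \<phi> w) - (\<integral>w. \<phi> w \<partial>limit_measure \<alpha>)) < \<epsilon>'" if "n \<ge> n0" for n
    using bd[of n] n0[OF that] V\<phi> \<phi>V[of n] \<epsilon>' unfolding \<epsilon>_def real_norm_def by linarith
  then show "\<exists>no. \<forall>n\<ge>no. norm ((\<Sum>w\<in>Z n. m n w * \<phi> w) - (\<integral>w. \<phi> w \<partial>limit_measure \<alpha>)) < \<epsilon>'" by blast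
qed

section \<open>Anti-concentration\<close>

text \<open>An independent copy of \<open>X\<close> lies at distance more than \<open>2 * d\<close> with positive probability, whereas
  two points of a disc of radius \<open>d\<close> never do.\<close>

lemma nondegenerate_concentration:
  fixes X :: "'a \<Rightarrow> complex"
  assumes "prob_space M" and [measurable]: "X \<in> borel_measurable M" and nd: "nondegenerate M X"
  obtains d Q :: real where "d > 0" "0 \<le> Q" "Q < 1"
    "\<And>c. emeasure (distr M borel X) (cball c d) \<le> ennreal Q"
proof -
  interpret M: prob_space M by fact
  define \<mu> where "\<mu> = distr M borel X"
  have [measurable_cong, simp]: "sets \<mu> = sets borel" by (simp add: \<mu>_def)
  interpret \<mu>: prob_space \<mu> unfolding \<mu>_def by (rule M.prob_space_distr) simp
  interpret P: pair_prob_space \<mu> \<mu> ..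
  let ?P = "\<mu> \<Otimes>\<^sub>M \<mu>"
  define E where "E j = {p \<in> space ?P. dist (fst p) (snd p) > 2 / real (Suc j)}" for j
  have [measurable]: "E j \<in> sets ?P" for j unfolding E_def by measurable
  have "\<exists>j. P.prob (E j) > 0"
  proof (rule ccontr)
    assume "\<not> ?thesis"
    then have "P.prob (E j) = 0" for j
      using measure_nonneg[of ?P "E j"] by (metis less_eq_real_def)
    then have "AE p in ?P. p \<notin> E j" for j
      by (rule P.prob_eq_0[THEN iffD1, rotated]) measurable
    then have "AE p in ?P. \<forall>j. p \<notin> E j"
      unfolding AE_all_countable by blast
    then have "AE p in ?P. fst p = snd p"
      using AE_space
    proof eventually_elim
      case (elim p)
      show ?case
      proof (rule ccontr)
        assume "fst p \<noteq> snd p"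
        then obtain j where "1 / real (Suc j) < dist (fst p) (snd p) / 2"
          using nat_approx_posE[of "dist (fst p) (snd p) / 2"] by auto
        then have "p \<in> E j" using elim by (simp add: E_def)
        then show False using elim by blast
      qed
    qed
    then have "AE x in \<mu>. AE y in \<mu>. x = y"
      using P.AE_pair[of "\<lambda>p. fst p = snd p"] by simp
    then obtain x where "AE y in \<mu>. x = y"
      using eventually_happens'[of "ae_filter \<mu>"] \<mu>.ae_filter_bot by blast
    then have "AE \<omega> in M. X \<omega> = x"
      unfolding \<mu>_def by (subst (asm) AE_distr_iff) (auto elim: eventually_mono)
    then show False using nd by (auto simp: nondegenerate_def)
  qed
  then obtain j where j: "P.prob (E j) > 0" by blast
  define d where "d = 1 / real (Suc j)"
  \<comment> \<open>The square of a disc of radius \<open>d\<close> misses \<open>E j\<close>, so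
    the squared measure of the disc is at most \<open>1 - P.prob (E j)\<close>.\<close>
  define Q where "Q = sqrt (1 - P.prob (E j))"
  have p1: "P.prob (E j) \<le> 1" by simp
  show thesis
  proof
    show "d > 0" by (simp add: d_def)
    show "0 \<le> Q" using p1 by (simp add: Q_def)
    show "Q < 1" using j by (simp add: Q_def)
    fix c :: complex
    have [measurable]: "cball c d \<in> sets borel" by simp
    have "(\<mu>.prob (cball c d))\<^sup>2 = P.prob (cball c d \<times> cball c d)"
      by (simp add: power2_eq_square measure_def \<mu>.emeasure_pair_measure_Times enn2real_mult)
    also have "\<dots> \<le> P.prob (space ?P - E j)"
    proof (rule P.finite_measure_mono)
      show "cball c d \<times> cball c d \<subseteq> space ?P - E j"
      proof
        fix p assume "p \<in> cball c d \<times> cball c d"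
        then have "dist (fst p) (snd p) \<le> d + d"
          using dist_triangle3[of "fst p" "snd p" c] by (auto simp: mem_Times_iff)
        then show "p \<in> space ?P - E j"
          using sets_eq_imp_space_eq[of \<mu> borel] by (auto simp: E_def d_def space_pair_measure)
      qed
    qed measurable
    also have "\<dots> = 1 - P.prob (E j)" by (rule P.prob_compl) measurable
    finally have "\<mu>.prob (cball c d) \<le> Q" unfolding Q_def by (rule real_le_rsqrt)
    then show "emeasure (distr M borel X) (cball c d) \<le> ennreal Q"
      unfolding \<mu>_def[symmetric] \<mu>.emeasure_eq_measure by (rule ennreal_leI)
  qed
qed

text \<open>Fubini over the coordinates outside \<open>J\<close>: each slice lies in a product of
  discs of radius \<open>d\<close> centred at the coordinates of any one of its points, and every
  factor has measure at most \<open>Q\<close>.\<close>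

lemma emeasure_PiM_pinned:
  fixes \<mu> :: "complex measure"
  assumes "prob_space \<mu>" and s: "sets \<mu> = sets borel" and I: "finite I" "J \<subseteq> I"
    and A: "A \<in> sets (PiM I (\<lambda>_. \<mu>))"
    and pin: "\<And>x y k. x \<in> A \<Longrightarrow> y \<in> A \<Longrightarrow> (\<And>i. i \<in> I - J \<Longrightarrow> x i = y i) \<Longrightarrow> k \<in> J \<Longrightarrow> dist (x k) (y k) \<le> d"
    and Q: "\<And>c. emeasure \<mu> (cball c d) \<le> ennreal Q" "Q \<ge> 0"
  shows "emeasure (PiM I (\<lambda>_. \<mu>)) A \<le> ennreal (Q ^ card J)"
proof -
  interpret \<mu>: prob_space \<mu> by fact
  interpret PP: product_prob_space "\<lambda>_. \<mu>" I ..
  interpret product_sigma_finite "\<lambda>_::'i. \<mu>" ..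
  have fJ: "finite J" using I finite_subset by blast
  have un: "(I - J) \<union> J = I" using I by auto
  have sp: "space \<mu> = UNIV" using sets_eq_imp_space_eq[OF s] by simp
  have inner: "emeasure (PiM J (\<lambda>_. \<mu>)) ((\<lambda>y. merge (I - J) J (x, y)) -` A \<inter> space (PiM J (\<lambda>_. \<mu>)))
      \<le> ennreal (Q ^ card J)" (is "emeasure ?M ?S \<le> _") for x
  proof (cases "?S = {}")
    case False
    then obtain y0 where y0: "y0 \<in> ?S" by blast
    have "?S \<subseteq> PiE J (\<lambda>k. cball (y0 k) d)"
    proof
      fix y assume y: "y \<in> ?S"
      have "dist (merge (I - J) J (x, y0) k) (merge (I - J) J (x, y) k) \<le> d" if "k \<in> J" for k
        by (rule pin[OF _ _ _ that]) (use y y0 in \<open>auto simp: merge_def\<close>)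
      then have "dist (y0 k) (y k) \<le> d" if "k \<in> J" for k
        using that by (force simp: merge_def)
      then show "y \<in> PiE J (\<lambda>k. cball (y0 k) d)"
        using y by (auto simp: space_PiM PiE_def)
    qed
    moreover have "PiE J (\<lambda>k. cball (y0 k) d) \<in> sets ?M"
      using fJ s by (intro sets_PiM_I_finite) auto
    ultimately have "emeasure ?M ?S \<le> emeasure ?M (PiE J (\<lambda>k. cball (y0 k) d))"
      by (rule emeasure_mono)
    also have "\<dots> = (\<Prod>k\<in>J. emeasure \<mu> (cball (y0 k) d))"
      using fJ s by (intro emeasure_PiM) auto
    also have "\<dots> \<le> (\<Prod>k\<in>J. ennreal Q)"
      by (intro prod_mono_ennreal Q)
    also have "\<dots> = ennreal (Q ^ card J)"
      using Q(2) by (simp add: ennreal_power)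
    finally show ?thesis .
  qed simp
  have "emeasure (PiM I (\<lambda>_. \<mu>)) A = emeasure (PiM ((I - J) \<union> J) (\<lambda>_. \<mu>)) A" by (simp only: un)
  also have "\<dots> = (\<integral>\<^sup>+x. emeasure (PiM J (\<lambda>_. \<mu>)) ((\<lambda>y. merge (I - J) J (x, y)) -` A \<inter> space (PiM J (\<lambda>_. \<mu>))) \<partial>PiM (I - J) (\<lambda>_. \<mu>))"
    by (rule emeasure_fold_integral) (use I fJ A un in auto)
  also have "\<dots> \<le> (\<integral>\<^sup>+x. ennreal (Q ^ card J) \<partial>PiM (I - J) (\<lambda>_. \<mu>))"
    by (intro nn_integral_mono inner)
  also have "\<dots> = ennreal (Q ^ card J)"
  proof -
    interpret prob_space "PiM (I - J) (\<lambda>_. \<mu>)" by (rule prob_space_PiM) (rule assms(1))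
    show ?thesis by (simp add: emeasure_space_1)
  qed
  finally show ?thesis .
qed

text \<open>Discrete Fourier inversion at the \<open>N\<close>-th roots of unity. Sampling finitely
  many points, in place of a whole circle, will make the relevant event a finite intersection of
  measurable conditions.\<close>

lemma roots_of_unity_coeff_bound:
  fixes a :: "nat \<Rightarrow> complex" and \<eta> B :: real
  defines "\<omega> \<equiv> \<lambda>N l. exp (2 * of_real pi * \<i> * of_nat l / of_nat N)"
  assumes N: "N \<ge> 1" and B: "\<And>l. l < N \<Longrightarrow> norm (\<Sum>i<N. a i * (of_real \<eta> * \<omega> N l) ^ i) \<le> B"
    and j: "j < N" and \<eta>: "\<eta> > 0"
  shows "norm (a j) * \<eta> ^ j \<le> B"
proof -
  have pw: "\<omega> N l ^ i = \<omega> N i ^ l" for i l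
    by (simp add: \<omega>_def exp_of_nat_mult[symmetric] algebra_simps)
  have nz: "\<omega> N l \<noteq> 0" for l by (simp add: \<omega>_def)
  have nm: "norm (\<omega> N l) = 1" for l by (simp add: \<omega>_def norm_exp_eq_Re)
  have orth: "(\<Sum>l<N. \<omega> N l ^ i / \<omega> N l ^ j) = (if i = j then of_nat N else 0)" if i: "i < N" for i
  proof (cases "i = j")
    case True
    then show ?thesis using nz by simp
  next
    case False
    define \<rho> where "\<rho> = \<omega> N i / \<omega> N j"
    have "\<omega> N i \<noteq> \<omega> N j"
      unfolding \<omega>_def using complex_root_unity_eq[of N i j] N i j False by simp
    then have "\<rho> \<noteq> 1" using nz by (simp add: \<rho>_def)
    have one: "\<omega> N l ^ N = 1" for l
      using N by (simp add: \<omega>_def exp_of_nat_mult[symmetric])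
        (metis exp_2pi_1_nat mult.assoc mult.commute)
    have "\<rho> ^ N = 1" by (simp add: \<rho>_def power_divide one)
    have "(\<Sum>l<N. \<omega> N l ^ i / \<omega> N l ^ j) = (\<Sum>l<N. \<rho> ^ l)"
      by (simp add: pw \<rho>_def power_divide)
    also have "\<dots> = 0" using \<open>\<rho> \<noteq> 1\<close> \<open>\<rho> ^ N = 1\<close> by (simp add: sum_gp_strict)
    finally show ?thesis using False by simp
  qed
  have "(\<Sum>l<N. (\<Sum>i<N. a i * (of_real \<eta> * \<omega> N l) ^ i) / \<omega> N l ^ j)
      = (\<Sum>i<N. a i * of_real \<eta> ^ i * (\<Sum>l<N. \<omega> N l ^ i / \<omega> N l ^ j))"
    unfolding sum_divide_distrib sum_distrib_left
    by (subst sum.swap) (simp add: power_mult_distrib algebra_simps)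
  also have "\<dots> = (\<Sum>i<N. if i = j then a i * of_real \<eta> ^ i * of_nat N else 0)"
    by (intro sum.cong refl) (simp add: orth)
  also have "\<dots> = a j * of_real \<eta> ^ j * of_nat N" using j by simp
  finally have "norm (a j * of_real \<eta> ^ j * of_nat N) = norm (\<Sum>l<N. (\<Sum>i<N. a i * (of_real \<eta> * \<omega> N l) ^ i) / \<omega> N l ^ j)"
    by simp
  also have "\<dots> \<le> (\<Sum>l<N. B)"
    by (intro sum_norm_le) (use B in \<open>simp add: norm_divide norm_power nm\<close>)
  finally have "norm (a j) * \<eta> ^ j * real N \<le> B * real N"
    using \<eta> by (simp add: norm_mult norm_power mult.commute)
  then show ?thesis using N by simp
qed

lemma pcompose_shift_shift: "pcompose (pcompose q [:b, 1:]) [:-b, 1:] = (q :: complex poly)"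
  by (simp add: pcompose_assoc[symmetric] pcompose_pCons)

lemma pcompose_monom: "pcompose (monom c j) r = smult c (r ^ j)"
  for r :: "'a::comm_semiring_1 poly"
  by (induction j) (simp_all add: monom_0 monom_Suc pcompose_pCons mult.commute)

text \<open>Fourier inversion bounds the Taylor coefficients at \<open>b\<close>; the binomial
  theorem then carries the bound back to the origin. The 2 in \<open>2 * norm b / \<eta>\<close>
  stems from \<open>j choose i \<le> 2 ^ j\<close>.\<close>

lemma coeff_bound_from_disc:
  fixes q :: "complex poly" and b :: complex and \<eta> B :: real
  assumes deg: "degree q \<le> m" and mN: "m < N" and \<eta>: "0 < \<eta>" "\<eta> \<le> norm b" and B0: "B \<ge> 0"
    and B: "\<And>l. l < N \<Longrightarrow> norm (poly q (b + of_real \<eta> * exp (2 * of_real pi * \<i> * of_nat l / of_nat N))) \<le> B"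
  shows "norm (coeff q i) * norm b ^ i \<le> real (Suc m) * B * (2 * norm b / \<eta>) ^ m"
proof -
  define Q where "Q = pcompose q [:b, 1:]"
  have degQ: "degree Q \<le> m" using deg by (simp add: Q_def degree_pcompose)
  have pQ: "poly Q y = (\<Sum>i<N. coeff Q i * y ^ i)" for y
    unfolding poly_altdef
    by (rule sum.mono_neutral_left) (use degQ mN in \<open>auto simp: not_le intro: coeff_eq_0\<close>)
  have cQ: "norm (coeff Q j) * \<eta> ^ j \<le> B" if "j < N" for j
  proof (rule roots_of_unity_coeff_bound[OF _ _ that \<eta>(1)])
    fix l assume "l < N"
    then show "norm (\<Sum>i<N. coeff Q i * (of_real \<eta> * exp (2 * of_real pi * \<i> * of_nat l / of_nat N)) ^ i) \<le> B"
      unfolding pQ[symmetric] using B by (simp add: Q_def poly_pcompose add.commute)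
  qed (use mN in simp)
  define s where "s = 2 * norm b / \<eta>"
  have s: "s \<ge> 1" using \<eta> by (simp add: s_def field_simps)
  have "q = pcompose Q [:-b, 1:]" unfolding Q_def by (rule pcompose_shift_shift[symmetric])
  also have "\<dots> = (\<Sum>j\<le>m. smult (coeff Q j) ([:-b, 1:] ^ j))"
    by (subst poly_as_sum_of_monoms'[OF degQ, symmetric]) (simp add: pcompose_sum pcompose_monom)
  finally have "coeff q i = (\<Sum>j\<le>m. coeff Q j * coeff ([:-b, 1:] ^ j) i)"
    by (metis (no_types, lifting) coeff_smult coeff_sum sum.cong)
  then have "norm (coeff q i) * norm b ^ i \<le> (\<Sum>j\<le>m. norm (coeff Q j * coeff ([:-b, 1:] ^ j) i)) * norm b ^ i"
    by (intro mult_right_mono) (auto intro: norm_sum)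
  also have "\<dots> = (\<Sum>j\<le>m. norm (coeff Q j) * (norm (coeff ([:-b, 1:] ^ j) i) * norm b ^ i))"
    by (simp add: sum_distrib_right norm_mult mult.assoc)
  also have "\<dots> \<le> (\<Sum>j\<le>m. B * s ^ m)"
  proof (rule sum_mono)
    fix j assume j: "j \<in> {..m}"
    have "norm (coeff ([:-b, 1:] ^ j) i) * norm b ^ i \<le> 2 ^ j * norm b ^ j"
    proof (cases "i \<le> j")
      case True
      have "norm (coeff ([:-b, 1:] ^ j) i) * norm b ^ i = real (j choose i) * (norm b ^ (j - i) * norm b ^ i)"
        using True by (simp add: coeff_linear_poly_power norm_mult norm_power mult.assoc)
      also have "norm b ^ (j - i) * norm b ^ i = norm b ^ j"
        using True by (simp flip: power_add)
      also have "real (j choose i) * norm b ^ j \<le> 2 ^ j * norm b ^ j"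
        using binomial_le_pow2[of j i] by (intro mult_right_mono) (auto simp: of_nat_le_iff[symmetric] simp del: of_nat_le_iff)
      finally show ?thesis .
    qed (simp add: coeff_eq_0 degree_linear_power)
    then have "norm (coeff Q j) * (norm (coeff ([:-b, 1:] ^ j) i) * norm b ^ i) \<le> norm (coeff Q j) * (2 ^ j * norm b ^ j)"
      by (rule mult_left_mono) simp
    also have "\<dots> = (norm (coeff Q j) * \<eta> ^ j) * s ^ j"
      using \<eta> by (simp add: s_def power_divide power_mult_distrib)
    also have "\<dots> \<le> B * s ^ m"
      using cQ[of j] j mN s B0 by (intro mult_mono power_increasing) auto
    finally show "norm (coeff Q j) * (norm (coeff ([:-b, 1:] ^ j) i) * norm b ^ i) \<le> B * s ^ m" .
  qed
  also have "\<dots> = real (Suc m) * B * s ^ m" by simp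
  finally show ?thesis by (simp add: s_def)
qed

text \<open>Dividing by \<open>z ^ k0\<close> first leaves the expensive factor
  \<open>2 * norm b / \<eta>\<close> with only the window length \<open>m\<close> as exponent. The
  removed power costs \<open>norm b / (norm b - \<eta>)\<close> per degree, which is close to 1 for
  small \<open>\<eta>\<close>.\<close>

lemma sparse_coeff_bound:
  fixes D :: "nat \<Rightarrow> complex" and b :: complex and \<eta> B :: real
  assumes mN: "m < N" and \<eta>: "0 < \<eta>" "\<eta> < norm b" and B0: "B \<ge> 0"
    and B: "\<And>l. l < N \<Longrightarrow> norm (\<Sum>k\<in>{k0..k0 + m}. D k * (b + of_real \<eta> * exp (2 * of_real pi * \<i> * of_nat l / of_nat N)) ^ k) \<le> B"
    and k: "k \<in> {k0..k0 + m}"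
  shows "norm (D k) * norm b ^ k \<le> real (Suc m) * B * (norm b / (norm b - \<eta>)) ^ k0 * (2 * norm b / \<eta>) ^ m"
proof -
  define q where "q = (\<Sum>i\<le>m. monom (D (k0 + i)) i)"
  let ?z = "\<lambda>l. b + of_real \<eta> * exp (2 * of_real pi * \<i> * of_nat l / of_nat N)"
  have cq: "coeff q i = (if i \<le> m then D (k0 + i) else 0)" for i
    by (simp add: q_def coeff_sum)
  have deg: "degree q \<le> m" by (rule degree_le) (simp add: cq)
  have pq: "z ^ k0 * poly q z = (\<Sum>k\<in>{k0..k0 + m}. D k * z ^ k)" for z
  proof -
    have "z ^ k0 * poly q z = (\<Sum>i\<le>m. D (k0 + i) * z ^ (k0 + i))"
      by (simp add: q_def poly_sum poly_monom sum_distrib_left power_add algebra_simps)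
    also have "\<dots> = (\<Sum>k\<in>{k0..k0 + m}. D k * z ^ k)"
      by (rule sum.reindex_bij_witness[of _ "\<lambda>k. k - k0" "\<lambda>i. k0 + i"]) auto
    finally show ?thesis .
  qed
  have pos: "norm b - \<eta> > 0" using \<eta> by simp
  have qB: "norm (poly q (?z l)) \<le> B / (norm b - \<eta>) ^ k0" if "l < N" for l
  proof -
    have n1: "norm (of_real \<eta> * exp (2 * of_real pi * \<i> * of_nat l / of_nat N)) = \<eta>"
      using \<eta> by (simp add: norm_mult norm_exp_eq_Re)
    have "norm b - \<eta> \<le> norm (?z l)"
      using norm_diff_ineq[of b "of_real \<eta> * exp (2 * of_real pi * \<i> * of_nat l / of_nat N)"] n1 by simp
    then have "(norm b - \<eta>) ^ k0 * norm (poly q (?z l)) \<le> norm (?z l) ^ k0 * norm (poly q (?z l))"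
      using pos by (intro mult_right_mono power_mono) auto
    also have "\<dots> = norm (?z l ^ k0 * poly q (?z l))" by (simp add: norm_mult norm_power)
    also have "\<dots> \<le> B" unfolding pq by (rule B[OF that])
    finally show ?thesis using pos by (simp add: pos_le_divide_eq mult.commute)
  qed
  obtain i where i: "k = k0 + i" "i \<le> m" using k by (metis atLeastAtMost_iff le_add_diff_inverse nat_add_left_cancel_le)
  have "norm (coeff q i) * norm b ^ i \<le> real (Suc m) * (B / (norm b - \<eta>) ^ k0) * (2 * norm b / \<eta>) ^ m"
    by (rule coeff_bound_from_disc[OF deg mN]) (use \<eta> qB B0 pos in auto)
  then have "norm (coeff q i) * norm b ^ i * norm b ^ k0 \<le> real (Suc m) * (B / (norm b - \<eta>) ^ k0) * (2 * norm b / \<eta>) ^ m * norm b ^ k0"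
    by (rule mult_right_mono) simp
  then show ?thesis using i by (simp add: cq power_add power_divide algebra_simps add_divide_distrib)
qed

section \<open>Growth of the random polynomials\<close>

lemma limit_potential_nonneg: "\<alpha> > 0 \<Longrightarrow> limit_potential \<alpha> r \<ge> 0"
  by (auto simp: limit_potential_def intro: add_nonneg_nonneg ln_ge_zero)

text \<open>\<open>?L\<close> is the logarithm of the \<open>k\<close>-th term without the random
  coefficient and the \<open>o(k)\<close> error; \<open>\<beta>\<close> cancels between weight and
  dilation. The maximiser is \<open>k = n * \<rho> powr (1 / \<alpha>)\<close>, or the endpoint
  \<open>k = n\<close> once \<open>\<rho> > 1\<close>, and \<open>ln x \<le> x - 1\<close> proves
  the maximum.\<close>

lemma exponent_le_limit_potential:
  assumes \<alpha>: "\<alpha> > 0" and \<rho>: "\<rho> > 0" and n: "1 \<le> n" "k \<le> n"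
  shows "real k * ln \<rho> - \<alpha> * (real k * ln (real k) - real k) + \<alpha> * real k * ln (real n)
    \<le> real n * limit_potential \<alpha> \<rho>" (is "?L \<le> _")
proof (cases "k = 0")
  case True
  then show ?thesis using limit_potential_nonneg[OF \<alpha>, of \<rho>] by simp
next
  case False
  then have k: "real k > 0" "real n > 0" using n by auto
  show ?thesis
  proof (cases "\<rho> \<le> 1")
    case True
    define s where "s = \<rho> powr (1 / \<alpha>)"
    have s: "s > 0" "ln \<rho> = \<alpha> * ln s" using \<rho> \<alpha> by (auto simp: s_def ln_powr)
    have "ln (s * real n / real k) \<le> s * real n / real k - 1"
      using s k by (intro ln_le_minus_one) auto
    then have "ln s + ln (real n) - ln (real k) + 1 \<le> s * real n / real k"
      using s k by (simp add: ln_mult ln_div)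
    then have "\<alpha> * real k * (ln s + ln (real n) - ln (real k) + 1) \<le> \<alpha> * real k * (s * real n / real k)"
      using \<alpha> k by (intro mult_left_mono) auto
    then show ?thesis using k True by (simp add: s(2) limit_potential_def s_def[symmetric] algebra_simps)
  next
    case False
    have "ln (real n / real k) \<le> real n / real k - 1"
      using k by (intro ln_le_minus_one) auto
    then have "ln (real n) - ln (real k) + 1 \<le> real n / real k"
      using k by (simp add: ln_div)
    then have "\<alpha> * real k * (ln (real n) - ln (real k) + 1) \<le> \<alpha> * real k * (real n / real k)"
      using \<alpha> k by (intro mult_left_mono) auto
    moreover have "real k * ln \<rho> \<le> real n * ln \<rho>"
      using n False by (intro mult_right_mono) auto
    ultimately have "\<alpha> * real k * (ln (real n) - ln (real k) + 1) + real k * ln \<rho> \<le> \<alpha> * real k * (real n / real k) + real n * ln \<rho>"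
      by (rule add_mono)
    also have "\<alpha> * real k * (ln (real n) - ln (real k) + 1) + real k * ln \<rho> = ?L"
      by (simp add: algebra_simps)
    also have "\<alpha> * real k * (real n / real k) + real n * ln \<rho> = real n * limit_potential \<alpha> \<rho>"
      using k False by (simp add: limit_potential_def algebra_simps)
    finally show ?thesis .
  qed
qed

text \<open>With \<open>x = k / n\<close> the exponent equals \<open>n * F x\<close>. Continuity of
  \<open>F\<close> at its maximiser \<open>t\<close> makes the nearly maximal terms fill a window of
  length proportional to \<open>n\<close>.\<close>

lemma exponent_near_limit_potential:
  assumes \<alpha>: "\<alpha> > 0" and \<rho>: "\<rho> > 0" and \<epsilon>: "\<epsilon> > 0"
  obtains t \<delta> where "0 < t" "t \<le> 1" "\<delta> > 0" "\<And>n k. n > 0 \<Longrightarrow> \<bar>real k / real n - t\<bar> \<le> \<delta> \<Longrightarrow>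
    real n * (limit_potential \<alpha> \<rho> - \<epsilon>)
    \<le> real k * ln \<rho> - \<alpha> * (real k * ln (real k) - real k) + \<alpha> * real k * ln (real n)"
proof -
  define t where "t = min 1 (\<rho> powr (1 / \<alpha>))"
  have t: "0 < t" "t \<le> 1" using \<rho> by (auto simp: t_def)
  define F where "F x = x * ln \<rho> + \<alpha> * (x - x * ln x)" for x
  have Ft: "F t = limit_potential \<alpha> \<rho>"
  proof (cases "\<rho> \<le> 1")
    case True
    then have "\<rho> powr (1 / \<alpha>) \<le> 1" using \<rho> \<alpha> by (intro powr_le1) auto
    then have "t = \<rho> powr (1 / \<alpha>)" "ln \<rho> = \<alpha> * ln t" using \<rho> \<alpha> by (auto simp: t_def ln_powr)
    then show ?thesis using True \<alpha> by (simp add: F_def limit_potential_def algebra_simps)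
  next
    case False
    then have "t = 1" using \<alpha> by (simp add: t_def ge_one_powr_ge_zero)
    then show ?thesis using False by (simp add: F_def limit_potential_def)
  qed
  have "isCont F t" unfolding F_def using t by (intro continuous_intros) auto
  then obtain \<delta> where \<delta>: "\<delta> > 0" "\<And>x. dist x t < \<delta> \<Longrightarrow> dist (F x) (F t) < \<epsilon>"
    using \<epsilon> unfolding continuous_at_eps_delta by blast
  show thesis
  proof
    show "0 < t" "t \<le> 1" by fact+
    \<comment> \<open>The bound \<open>t / 2\<close> keeps \<open>x\<close> positive, so that
      \<open>ln (n * x)\<close> splits.\<close>
    show "min (\<delta> / 2) (t / 2) > 0" using \<delta> t by simp
    fix n k :: nat assume n: "n > 0" and d: "\<bar>real k / real n - t\<bar> \<le> min (\<delta> / 2) (t / 2)"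
    define x where "x = real k / real n"
    have x: "x > 0" using d t by (auto simp: x_def[symmetric] abs_if split: if_splits)
    have k: "real k = real n * x" using n by (simp add: x_def)
    have "dist (F x) (F t) < \<epsilon>" using d \<delta> by (intro \<delta>(2)) (auto simp: x_def[symmetric] dist_real_def)
    then have "limit_potential \<alpha> \<rho> - \<epsilon> \<le> F x" unfolding Ft dist_real_def by linarith
    then have "real n * (limit_potential \<alpha> \<rho> - \<epsilon>) \<le> real n * F x" by (intro mult_left_mono) auto
    also have "real n * F x = real k * ln \<rho> - \<alpha> * (real k * ln (real k) - real k) + \<alpha> * real k * ln (real n)"
      unfolding k F_def using n x by (simp add: ln_mult algebra_simps)
    finally show "real n * (limit_potential \<alpha> \<rho> - \<epsilon>)
      \<le> real k * ln \<rho> - \<alpha> * (real k * ln (real k) - real k) + \<alpha> * real k * ln (real n)" .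
  qed
qed

text \<open>Nonvanishing is part of the claim because \<open>ln 0 = 0\<close>: a zero weight would
  force the exponent to be at most \<open>\<epsilon> * k\<close> in modulus, against its growth of
  order \<open>k * ln k\<close>.\<close>

lemma weights_asymptotics:
  fixes w :: "nat \<Rightarrow> complex"
  assumes w: "(\<lambda>k. ln (norm (w k)) - (- \<alpha> * (real k * ln (real k) - real k) - \<beta> * real k)) \<in> o(\<lambda>k. real k)"
    and \<alpha>: "\<alpha> > 0" and \<epsilon>: "\<epsilon> > 0"
  shows "\<forall>\<^sub>F k in sequentially. w k \<noteq> 0 \<and>
    norm (w k) \<le> exp (- \<alpha> * (real k * ln (real k) - real k) - \<beta> * real k + \<epsilon> * real k) \<and>
    norm (w k) \<ge> exp (- \<alpha> * (real k * ln (real k) - real k) - \<beta> * real k - \<epsilon> * real k)"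
proof -
  have "\<forall>\<^sub>F k in sequentially. norm (ln (norm (w k)) - (- \<alpha> * (real k * ln (real k) - real k) - \<beta> * real k)) \<le> \<epsilon> * norm (real k)"
    using landau_o.smallD[OF w \<epsilon>] .
  moreover have "\<forall>\<^sub>F k in sequentially. \<alpha> * (real k * ln (real k) - real k) + \<beta> * real k > \<epsilon> * real k"
    using \<alpha> by real_asymp
  ultimately show ?thesis
  proof eventually_elim
    case (elim k)
    let ?a = "- \<alpha> * (real k * ln (real k) - real k) - \<beta> * real k"
    have w0: "w k \<noteq> 0"
    proof
      assume "w k = 0"
      then have "\<bar>?a\<bar> \<le> \<epsilon> * real k" using elim(1) by simp
      then show False using elim(2) by (simp add: abs_if split: if_splits)
    qed
    then have e: "norm (w k) = exp (ln (norm (w k)))" by simp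
    have "ln (norm (w k)) \<le> ?a + \<epsilon> * real k" "?a - \<epsilon> * real k \<le> ln (norm (w k))"
      using elim(1) by (auto simp: abs_if split: if_splits)
    then have "exp (ln (norm (w k))) \<le> exp (?a + \<epsilon> * real k)" "exp (?a - \<epsilon> * real k) \<le> exp (ln (norm (w k)))"
      by (simp_all only: exp_le_cancel_iff)
    then show ?case using w0 unfolding e[symmetric] by blast
  qed
qed

section \<open>Upper bound for the dilated polynomials\<close>

lemma eventually_le_imp_all_le_mult:
  fixes f g :: "nat \<Rightarrow> real"
  assumes ev: "\<forall>\<^sub>F k in sequentially. f k \<le> g k" and g: "\<And>k. g k > 0"
  obtains A where "A \<ge> 1" "\<And>k. f k \<le> A * g k"
proof -
  obtain K where K: "\<And>k. k \<ge> K \<Longrightarrow> f k \<le> g k" using ev by (auto simp: eventually_sequentially)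
  define A where "A = 1 + (\<Sum>k<K. \<bar>f k\<bar> / g k)"
  have A1: "A \<ge> 1" using g by (auto simp: A_def intro!: sum_nonneg divide_nonneg_pos)
  have "f k \<le> A * g k" for k
  proof (cases "k \<ge> K")
    case True
    have "1 * g k \<le> A * g k" using A1 g[of k] by (intro mult_right_mono) auto
    then show ?thesis using K[OF True] by simp
  next
    case False
    have "\<bar>f k\<bar> / g k \<le> (\<Sum>k<K. \<bar>f k\<bar> / g k)"
      using False g by (intro member_le_sum) (auto intro!: divide_nonneg_pos)
    then have "\<bar>f k\<bar> / g k \<le> A" by (simp add: A_def)
    then show ?thesis using g[of k] by (simp add: pos_divide_le_eq)
  qed
  then show thesis using that A1 by blast
qed

lemma scale_power:
  assumes "n > 0"
  shows "(exp \<beta> * real n powr \<alpha>) ^ k = exp (\<beta> * real k + \<alpha> * real k * ln (real n))"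
  using assms by (simp add: powr_def exp_add[symmetric] exp_of_nat_mult[symmetric] algebra_simps)

text \<open>Triangle inequality: each of the \<open>n + 1\<close> terms is at most the maximal one
  up to a subexponential factor. The exponent estimate holds at every modulus, so no restriction to
  compact sets is required.\<close>

lemma poly_upper_bound:
  fixes w x :: "nat \<Rightarrow> complex"
  assumes w: "(\<lambda>k. ln (norm (w k)) - (- \<alpha> * (real k * ln (real k) - real k) - \<beta> * real k)) \<in> o(\<lambda>k. real k)"
    and \<alpha>: "\<alpha> > 0" and \<epsilon>: "\<epsilon> > 0"
    and x: "\<And>\<epsilon>. \<epsilon> > 0 \<Longrightarrow> \<forall>\<^sub>F k in sequentially. norm (x k) \<le> exp (\<epsilon> * real k)"
  shows "\<forall>\<^sub>F n in sequentially. \<forall>z. norm (\<Sum>k\<le>n. x k * w k * (of_real (exp \<beta> * real n powr \<alpha>) * z) ^ k)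
     \<le> exp (real n * (limit_potential \<alpha> (norm z) + \<epsilon>))"
proof -
  \<comment> \<open>One third each for the random coefficients, the weights, and the factor
    \<open>(n + 1) * A\<close>.\<close>
  define \<delta> where "\<delta> = \<epsilon> / 3"
  have \<delta>: "\<delta> > 0" using \<epsilon> by (simp add: \<delta>_def)
  let ?g = "\<lambda>k. exp (- \<alpha> * (real k * ln (real k) - real k) - \<beta> * real k + 2 * \<delta> * real k)"
  have "\<forall>\<^sub>F k in sequentially. norm (x k * w k) \<le> ?g k"
    using x[OF \<delta>] weights_asymptotics[OF w \<alpha> \<delta>]
  proof eventually_elim
    case (elim k)
    have "norm (x k * w k) \<le> exp (\<delta> * real k) * exp (- \<alpha> * (real k * ln (real k) - real k) - \<beta> * real k + \<delta> * real k)"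
      unfolding norm_mult using elim by (intro mult_mono) auto
    then show ?case by (simp add: exp_add[symmetric] algebra_simps)
  qed
  \<comment> \<open>\<open>A\<close> absorbs the finitely many indices at which the asymptotic
    bounds do not yet hold; it does not depend on \<open>n\<close>.\<close>
  then obtain A where A: "A \<ge> 1" "\<And>k. norm (x k * w k) \<le> A * ?g k"
    by (rule eventually_le_imp_all_le_mult) auto
  have "\<forall>\<^sub>F n in sequentially. (real n + 1) * A \<le> exp (\<delta> * real n)"
    using A \<delta> by real_asymp
  moreover have "\<forall>\<^sub>F n in sequentially. n \<ge> (1::nat)" by (rule eventually_ge_at_top)
  ultimately show ?thesis
  proof eventually_elim
    case (elim n)
    let ?c = "exp \<beta> * real n powr \<alpha>"
    show ?case
    proof
      fix z :: complex
      let ?U = "limit_potential \<alpha> (norm z)"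
      have U: "?U \<ge> 0" by (rule limit_potential_nonneg[OF \<alpha>])
      have one: "norm (x k * w k * (of_real ?c * z) ^ k) \<le> A * exp (2 * \<delta> * real n + real n * ?U)" if k: "k \<le> n" for k
      proof (cases "z = 0")
        \<comment> \<open>The exponent estimate needs a positive modulus; at the origin only the
          term \<open>k = 0\<close> survives.\<close>
        case True
        have "norm (x k * w k * (of_real ?c * z) ^ k) \<le> A * 1"
          using True A(1) A(2)[of 0] by (cases "k = 0") (auto simp: power_0_left)
        also have "\<dots> \<le> A * exp (2 * \<delta> * real n + real n * ?U)"
          using A(1) \<delta> U by (intro mult_left_mono) auto
        finally show ?thesis .
      next
        case False
        have "norm (x k * w k * (of_real ?c * z) ^ k) = norm (x k * w k) * (?c ^ k * norm z ^ k)"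
          by (simp add: norm_mult norm_power power_mult_distrib)
        also have "?c ^ k * norm z ^ k = exp (\<beta> * real k + \<alpha> * real k * ln (real n)) * exp (real k * ln (norm z))"
          using False elim by (simp add: scale_power exp_of_nat_mult)
        also have "norm (x k * w k) * \<dots> \<le> (A * ?g k) * \<dots>"
          by (intro mult_right_mono A(2)) auto
        also have "\<dots> = A * exp (2 * \<delta> * real k + (real k * ln (norm z) - \<alpha> * (real k * ln (real k) - real k) + \<alpha> * real k * ln (real n)))"
          by (simp add: exp_add[symmetric] mult.assoc algebra_simps)
        also have "\<dots> \<le> A * exp (2 * \<delta> * real n + real n * ?U)"
        proof -
          have "2 * \<delta> * real k \<le> 2 * \<delta> * real n" using \<delta> k by simp
          moreover have "real k * ln (norm z) - \<alpha> * (real k * ln (real k) - real k) + \<alpha> * real k * ln (real n) \<le> real n * ?U"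
            by (rule exponent_le_limit_potential[OF \<alpha>]) (use False elim(2) k in auto)
          ultimately show ?thesis using A(1) by (intro mult_left_mono) auto
        qed
        finally show ?thesis .
      qed
      have "norm (\<Sum>k\<le>n. x k * w k * (of_real ?c * z) ^ k) \<le> (\<Sum>k\<le>n. A * exp (2 * \<delta> * real n + real n * ?U))"
        by (intro sum_norm_le one) auto
      also have "\<dots> = ((real n + 1) * A) * exp (2 * \<delta> * real n + real n * ?U)" by simp
      also have "\<dots> \<le> exp (\<delta> * real n) * exp (2 * \<delta> * real n + real n * ?U)"
        by (intro mult_right_mono elim) auto
      also have "\<dots> = exp (real n * (?U + \<epsilon>))"
        by (simp add: exp_add[symmetric] \<delta>_def algebra_simps)
      finally show "norm (\<Sum>k\<le>n. x k * w k * (of_real ?c * z) ^ k) \<le> exp (real n * (?U + \<epsilon>))" .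
    qed
  qed
qed

text \<open>Borel-Cantelli. By equality of laws all tails can be taken for \<open>\<xi> 0\<close>;
  for each outcome at most \<open>Y + 1\<close> indices \<open>k\<close> satisfy
  \<open>\<epsilon> * k < ln (1 + norm (\<xi> 0 \<omega>))\<close>, so the tail probabilities sum to
  at most a finite expectation.\<close>

lemma AE_log_moment_subexponential:
  fixes \<xi> :: "nat \<Rightarrow> 'a \<Rightarrow> complex"
  assumes "prob_space M" and rv[measurable]: "\<And>k. \<xi> k \<in> borel_measurable M"
    and id: "\<And>k. distr M borel (\<xi> k) = distr M borel (\<xi> 0)"
    and mom: "integrable M (\<lambda>\<omega>. ln (1 + norm (\<xi> 0 \<omega>)))" and \<epsilon>: "\<epsilon> > 0"
  shows "AE \<omega> in M. \<forall>\<^sub>F k in sequentially. norm (\<xi> k \<omega>) \<le> exp (\<epsilon> * real k)"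
proof -
  interpret prob_space M by fact
  define A where "A k = {\<omega> \<in> space M. ln (1 + norm (\<xi> k \<omega>)) > \<epsilon> * real k}" for k
  define A0 where "A0 k = {\<omega> \<in> space M. ln (1 + norm (\<xi> 0 \<omega>)) > \<epsilon> * real k}" for k
  have [measurable]: "A k \<in> sets M" "A0 k \<in> sets M" for k unfolding A_def A0_def by measurable
  have eq: "emeasure M (A k) = emeasure M (A0 k)" for k
  proof -
    let ?S = "{z::complex. ln (1 + norm z) > \<epsilon> * real k}"
    have [measurable]: "?S \<in> sets borel" by measurable
    have "emeasure M (A k) = emeasure (distr M borel (\<xi> k)) ?S"
      by (subst emeasure_distr) (auto simp: A_def vimage_def Int_def intro!: arg_cong[of _ _ "emeasure M"])
    also have "\<dots> = emeasure (distr M borel (\<xi> 0)) ?S" by (simp only: id[of k])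
    also have "\<dots> = emeasure M (A0 k)"
      by (subst emeasure_distr) (auto simp: A0_def vimage_def Int_def intro!: arg_cong[of _ _ "emeasure M"])
    finally show ?thesis .
  qed
  have "(\<Sum>k. emeasure M (A k)) = (\<Sum>k. \<integral>\<^sup>+\<omega>. indicator (A0 k) \<omega> \<partial>M)"
    by (simp add: eq)
  also have "\<dots> = (\<integral>\<^sup>+\<omega>. (\<Sum>k. indicator (A0 k) \<omega>) \<partial>M)"
    by (rule nn_integral_suminf[symmetric]) measurable
  also have "\<dots> \<le> (\<integral>\<^sup>+\<omega>. ennreal (ln (1 + norm (\<xi> 0 \<omega>)) / \<epsilon> + 1) \<partial>M)"
  proof (rule nn_integral_mono)
    fix \<omega>
    define Y where "Y = ln (1 + norm (\<xi> 0 \<omega>)) / \<epsilon>"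
    have Y: "Y \<ge> 0" using \<epsilon> by (simp add: Y_def)
    have out: "indicator (A0 k) \<omega> = (0::ennreal)" if "k \<notin> {..<nat \<lceil>Y\<rceil>}" for k
    proof -
      have "Y \<le> real k" using that by (simp add: not_less)
      then have "ln (1 + norm (\<xi> 0 \<omega>)) \<le> \<epsilon> * real k" using \<epsilon> by (simp add: Y_def field_simps)
      then show ?thesis by (simp add: A0_def)
    qed
    have "(\<Sum>k. indicator (A0 k) \<omega> :: ennreal) = (\<Sum>k\<in>{..<nat \<lceil>Y\<rceil>}. indicator (A0 k) \<omega>)"
      by (rule suminf_finite) (use out in auto)
    also have "\<dots> \<le> (\<Sum>k\<in>{..<nat \<lceil>Y\<rceil>}. 1)" by (intro sum_mono) (simp add: indicator_def)
    also have "\<dots> = ennreal (real (nat \<lceil>Y\<rceil>))" by (simp add: ennreal_of_nat_eq_real_of_nat)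
    also have "\<dots> \<le> ennreal (Y + 1)" using Y by (intro ennreal_leI) linarith
    finally show "(\<Sum>k. indicator (A0 k) \<omega>) \<le> ennreal (ln (1 + norm (\<xi> 0 \<omega>)) / \<epsilon> + 1)"
      by (simp add: Y_def)
  qed
  also have "\<dots> < \<infinity>"
  proof -
    have "integrable M (\<lambda>\<omega>. ln (1 + norm (\<xi> 0 \<omega>)) / \<epsilon> + 1)" using mom by simp
    then show ?thesis using \<epsilon> by (subst nn_integral_eq_integral) auto
  qed
  finally have fin: "(\<Sum>k. emeasure M (A k)) \<noteq> \<infinity>" by simp
  have "summable (\<lambda>k. measure M (A k))"
    by (rule summable_suminf_not_top) (use fin in \<open>auto simp: emeasure_eq_measure\<close>)
  then have "AE \<omega> in M. \<forall>\<^sub>F k in sequentially. \<omega> \<in> space M - A k"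
    by (intro borel_cantelli_AE1) (auto simp: emeasure_eq_measure)
  then show ?thesis
  proof eventually_elim
    case (elim \<omega>)
    then show ?case
    proof eventually_elim
      case (elim k)
      then have "ln (1 + norm (\<xi> k \<omega>)) \<le> \<epsilon> * real k" by (auto simp: A_def)
      then have "exp (ln (1 + norm (\<xi> k \<omega>))) \<le> exp (\<epsilon> * real k)" by (simp only: exp_le_cancel_iff)
      moreover have "exp (ln (1 + norm (\<xi> k \<omega>))) = 1 + norm (\<xi> k \<omega>)" by (intro exp_ln add_pos_nonneg) auto
      ultimately show ?case by linarith
    qed
  qed
qed

section \<open>Almost sure lower bound near a given point\<close>

lemma prob_pinned:
  fixes \<xi> :: "nat \<Rightarrow> 'a \<Rightarrow> complex"
  assumes "prob_space M" and ind: "prob_space.indep_vars M (\<lambda>_. borel) \<xi> UNIV"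
    and id: "\<And>k. distr M borel (\<xi> k) = distr M borel (\<xi> 0)"
    and I: "finite I" "I \<noteq> {}" "J \<subseteq> I" and A: "A \<in> sets (PiM I (\<lambda>_. borel))"
    and pin: "\<And>x y k. x \<in> A \<Longrightarrow> y \<in> A \<Longrightarrow> (\<And>i. i \<in> I - J \<Longrightarrow> x i = y i) \<Longrightarrow> k \<in> J \<Longrightarrow> dist (x k) (y k) \<le> d"
    and Q: "\<And>c. emeasure (distr M borel (\<xi> 0)) (cball c d) \<le> ennreal Q" "Q \<ge> 0"
  shows "measure M {\<omega> \<in> space M. (\<lambda>k\<in>I. \<xi> k \<omega>) \<in> A} \<le> Q ^ card J"
proof -
  interpret prob_space M by fact
  have rv[measurable]: "\<xi> k \<in> borel_measurable M" for k using ind by (auto simp: indep_vars_def)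
  let ?\<mu> = "distr M borel (\<xi> 0)"
  have ps: "prob_space ?\<mu>" by (rule prob_space_distr) simp
  have X: "(\<lambda>\<omega>. \<lambda>k\<in>I. \<xi> k \<omega>) \<in> M \<rightarrow>\<^sub>M PiM I (\<lambda>_. borel)" by measurable
  have "indep_vars (\<lambda>_. borel) \<xi> I" by (rule indep_vars_subset[OF ind]) simp
  then have D: "distr M (PiM I (\<lambda>_. borel)) (\<lambda>\<omega>. \<lambda>k\<in>I. \<xi> k \<omega>) = PiM I (\<lambda>k. distr M borel (\<xi> k))"
    using I by (subst (asm) indep_vars_iff_distr_eq_PiM) auto
  have "emeasure M {\<omega> \<in> space M. (\<lambda>k\<in>I. \<xi> k \<omega>) \<in> A} = emeasure (distr M (PiM I (\<lambda>_. borel)) (\<lambda>\<omega>. \<lambda>k\<in>I. \<xi> k \<omega>)) A"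
    by (subst emeasure_distr[OF X A]) (auto intro!: arg_cong[of _ _ "emeasure M"])
  also have "\<dots> = emeasure (PiM I (\<lambda>_. ?\<mu>)) A"
  proof -
    have "(\<lambda>k. distr M borel (\<xi> k)) = (\<lambda>_. ?\<mu>)" by (rule ext) (rule id)
    then show ?thesis unfolding D by simp
  qed
  also have "\<dots> \<le> ennreal (Q ^ card J)"
  proof (rule emeasure_PiM_pinned[where d = d])
    show "A \<in> sets (PiM I (\<lambda>_. ?\<mu>))"
      using A sets_PiM_cong[of I I "\<lambda>_. ?\<mu>" "\<lambda>_. borel"] by simp
  qed (use ps I(1,3) Q in \<open>auto intro: pin\<close>)
  finally show ?thesis using Q(2) by (simp add: emeasure_eq_measure)
qed

text \<open>If \<open>W\<^sub>n\<close> is exponentially too small at all points \<open>z n l\<close> near \<open>b\<close>, then, given the other coefficients,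
  the \<open>\<xi> k\<close> with \<open>k\<close> in a window \<open>J n\<close> of length about \<open>\<gamma> * n\<close> around the maximal term are pinned down
  up to an exponentially small error. This has probability at most \<open>Q ^ card (J n)\<close>, which is
  summable, so that no passage to subsequences is needed.\<close>

lemma AE_poly_lower_bound:
  fixes \<xi> :: "nat \<Rightarrow> 'a \<Rightarrow> complex" and w :: "nat \<Rightarrow> complex"
  assumes P: "prob_space M" and ind: "prob_space.indep_vars M (\<lambda>_. borel) \<xi> UNIV"
    and id: "\<And>k. distr M borel (\<xi> k) = distr M borel (\<xi> 0)"
    and nd: "nondegenerate M (\<xi> 0)"
    and \<alpha>: "\<alpha> > 0"
    and w: "(\<lambda>k. ln (norm (w k)) - (- \<alpha> * (real k * ln (real k) - real k) - \<beta> * real k)) \<in> o(\<lambda>k. real k)"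
    and b: "b \<noteq> 0" and \<epsilon>: "\<epsilon> > 0" and \<eta>: "\<eta> > 0"
  shows "AE \<omega> in M. \<forall>\<^sub>F n in sequentially. \<exists>z\<in>cball b \<eta>.
    norm (\<Sum>k\<le>n. \<xi> k \<omega> * w k * (of_real (exp \<beta> * real n powr \<alpha>) * z) ^ k)
      \<ge> exp (real n * (limit_potential \<alpha> (norm b) - \<epsilon>))"
proof -
  interpret prob_space M by fact
  have rv[measurable]: "\<xi> k \<in> borel_measurable M" for k using ind by (auto simp: indep_vars_def)
  define \<rho> where "\<rho> = norm b"
  have \<rho>: "\<rho> > 0" using b by (simp add: \<rho>_def)
  define U where "U = limit_potential \<alpha> \<rho>"
  obtain d Q0 :: real where d: "d > 0" and Q0: "0 \<le> Q0" "Q0 < 1"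
    "\<And>c. emeasure (distr M borel (\<xi> 0)) (cball c d) \<le> ennreal Q0"
    using nondegenerate_concentration[OF P rv nd] by blast
  \<comment> \<open>Positivity allows powers of \<open>Q\<close> to be rewritten with
    \<open>powr\<close>.\<close>
  define Q where "Q = max Q0 (1 / 2)"
  have Q: "0 < Q" "Q < 1" "\<And>c. emeasure (distr M borel (\<xi> 0)) (cball c d) \<le> ennreal Q"
    using Q0 by (auto simp: Q_def intro: order_trans[OF Q0(3)] ennreal_leI)
  have e8: "\<epsilon> / 8 > 0" using \<epsilon> by simp
  obtain t \<delta> where t: "0 < t" "t \<le> 1" and \<delta>: "\<delta> > 0"
    and win: "\<And>n k. n > 0 \<Longrightarrow> \<bar>real k / real n - t\<bar> \<le> \<delta> \<Longrightarrow>
      real n * (U - \<epsilon> / 8) \<le> real k * ln \<rho> - \<alpha> * (real k * ln (real k) - real k) + \<alpha> * real k * ln (real n)"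
    by (rule exponent_near_limit_potential[OF \<alpha> \<rho> e8, folded U_def]) (rule that; assumption)
  \<comment> \<open>Chosen so that \<open>\<rho> / (\<rho> - r) \<le> exp (\<epsilon> / 8)\<close>:
    dividing out \<open>z ^ k0\<close> then costs at most
    \<open>exp (\<epsilon> / 8 * n)\<close>.\<close>
  define r where "r = min \<eta> (\<rho> * (1 - exp (- \<epsilon> / 8)))"
  have r4: "\<rho> * exp (- \<epsilon> / 8) \<le> \<rho> - r"
    by (auto simp: r_def min_def algebra_simps)
  moreover have "\<rho> * exp (- \<epsilon> / 8) > 0" using \<rho> by simp
  ultimately have "r < \<rho>" by linarith
  with r4 have r: "0 < r" "r \<le> \<eta>" "r < \<rho>" "\<rho> * exp (- \<epsilon> / 8) \<le> \<rho> - r"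
    using \<eta> \<rho> \<epsilon> by (auto simp: r_def)
  have ratio: "\<rho> / (\<rho> - r) \<le> exp (\<epsilon> / 8)"
  proof -
    have "\<rho> = exp (\<epsilon> / 8) * (\<rho> * exp (- \<epsilon> / 8))" by (simp add: exp_minus)
    also have "\<dots> \<le> exp (\<epsilon> / 8) * (\<rho> - r)" using r by (intro mult_left_mono) auto
    finally show ?thesis using r by (simp add: pos_divide_le_eq)
  qed
  define \<Lambda> where "\<Lambda> = ln (2 * \<rho> / r)"
  have \<Lambda>: "\<Lambda> > 0" "exp \<Lambda> = 2 * \<rho> / r" using r \<rho> by (auto simp: \<Lambda>_def)
  \<comment> \<open>Three demands on the window: its terms stay nearly maximal
    (\<open>\<delta> / 2\<close>), recentring costs at most \<open>exp (\<epsilon> / 8 * n)\<close>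
    (\<open>\<epsilon> / (8 * \<Lambda>)\<close>), and its indices grow linearly in
    \<open>n\<close>, so that the weight asymptotics apply (\<open>t / 2\<close>).\<close>
  define \<gamma> where "\<gamma> = Min {\<delta> / 2, \<epsilon> / (8 * \<Lambda>), t / 2}"
  have \<gamma>: "\<gamma> > 0" "\<gamma> \<le> \<delta> / 2" "\<gamma> \<le> \<epsilon> / (8 * \<Lambda>)" "\<gamma> \<le> t / 2"
    using \<delta> \<epsilon> \<Lambda> t by (auto simp: \<gamma>_def)
  have \<gamma>\<Lambda>: "\<gamma> * \<Lambda> \<le> \<epsilon> / 8" using \<gamma>(3) \<Lambda> by (simp add: field_simps)
  define m where "m n = nat \<lfloor>\<gamma> * real n\<rfloor>" for n
  \<comment> \<open>The window ends at \<open>t * n\<close> rounded down and so stays within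
    \<open>{..n}\<close> even for \<open>t = 1\<close>; \<open>\<gamma> \<le> t / 2\<close> makes
    the natural subtraction exact.\<close>
  define k0 where "k0 n = nat \<lfloor>t * real n\<rfloor> - m n" for n
  define J where "J n = {k0 n..k0 n + m n}" for n
  define c where "c n = exp \<beta> * real n powr \<alpha>" for n :: nat
  define z where "z n l = b + of_real r * exp (2 * of_real pi * \<i> * of_nat l / of_nat (Suc n))" for n l :: nat
  define B where "B n = exp (real n * (U - \<epsilon>))" for n :: nat
  define S where "S n x l = (\<Sum>k\<le>n. x k * w k * (of_real (c n) * z n l) ^ k)" for n l :: nat and x :: "nat \<Rightarrow> complex"
  define A where "A n = {x \<in> space (PiM {..n} (\<lambda>_. borel)). \<forall>l<Suc n. norm (S n x l) < B n}" for n
  have A_sets: "A n \<in> sets (PiM {..n} (\<lambda>_. borel))" for n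
    unfolding A_def S_def by measurable
  define E where "E n = {\<omega> \<in> space M. (\<lambda>k\<in>{..n}. \<xi> k \<omega>) \<in> A n}" for n
  have E_sets[measurable]: "E n \<in> sets M" for n
  proof -
    have "(\<lambda>\<omega>. \<lambda>k\<in>{..n}. \<xi> k \<omega>) \<in> M \<rightarrow>\<^sub>M PiM {..n} (\<lambda>_. borel)" by measurable
    from measurable_sets[OF this A_sets[of n]] show ?thesis
      by (simp add: E_def vimage_def Int_def conj_commute)
  qed
  have m_le: "real (m n) \<le> \<gamma> * real n" "\<gamma> * real n \<le> real (m n) + 1" for n
    using \<gamma>(1) by (auto simp: m_def)
  have mt: "m n \<le> nat \<lfloor>t * real n\<rfloor>" for n
  proof -
    have "\<gamma> * real n \<le> t * real n" using \<gamma> t by (intro mult_right_mono) auto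
    then show ?thesis unfolding m_def by (intro nat_mono floor_mono)
  qed
  have J_props: "k \<le> n" "real k \<le> t * real n" "real k \<ge> t * real n - 1 - \<gamma> * real n" "real k \<ge> t / 2 * real n - 1"
    if "k \<in> J n" for k n
  proof -
    have a: "k \<le> nat \<lfloor>t * real n\<rfloor>" "nat \<lfloor>t * real n\<rfloor> \<le> k + m n"
      using that mt[of n] by (auto simp: J_def k0_def)
    have tn: "real (nat \<lfloor>t * real n\<rfloor>) \<le> t * real n" "t * real n \<le> real (nat \<lfloor>t * real n\<rfloor>) + 1"
      using t by auto
    show 1: "real k \<le> t * real n" using a tn by linarith
    also have "t * real n \<le> 1 * real n" using t by (intro mult_right_mono) auto
    finally show "k \<le> n" by simp
    show 2: "real k \<ge> t * real n - 1 - \<gamma> * real n" using a tn m_le[of n] by linarith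
    have "\<gamma> * real n \<le> t / 2 * real n" using \<gamma> by (intro mult_right_mono) auto
    then show "real k \<ge> t / 2 * real n - 1" using 2 by linarith
  qed
  obtain K where K: "\<And>k. k \<ge> K \<Longrightarrow> w k \<noteq> 0 \<and>
    norm (w k) \<ge> exp (- \<alpha> * (real k * ln (real k) - real k) - \<beta> * real k - \<epsilon> / 8 * real k)"
    using weights_asymptotics[OF w \<alpha> e8] by (auto simp: eventually_sequentially)
  have "\<forall>\<^sub>F n in sequentially. real n \<ge> 2 / \<delta>" using \<delta> by real_asymp
  moreover have "\<forall>\<^sub>F n in sequentially. t / 2 * real n - 1 \<ge> real K" using t by real_asymp
  \<comment> \<open>Budget: \<open>B n\<close> gains \<open>\<epsilon>\<close>, the two losses in
    the coefficient bound take \<open>\<epsilon> / 8\<close> each, and the lower bound for the terms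
    takes \<open>\<epsilon> / 4\<close>; what remains is \<open>\<epsilon> / 2\<close>.\<close>
  moreover have "\<forall>\<^sub>F n in sequentially. 2 * (real n + 1) * exp (- real n * \<epsilon> / 2) \<le> d"
    using d \<epsilon> by real_asymp
  moreover have "\<forall>\<^sub>F n in sequentially. n \<ge> (1::nat)" by (rule eventually_ge_at_top)
  ultimately have ev: "\<forall>\<^sub>F n in sequentially. measure M (E n) \<le> (Q powr \<gamma>) ^ n"
  proof eventually_elim
    case (elim n)
    have n: "real n > 0" using elim by simp
    have v: "norm (w k) * (c n) ^ k * \<rho> ^ k \<ge> exp (real n * (U - \<epsilon> / 4))" if k: "k \<in> J n" for k
    proof -
      have "real k \<ge> real K" using J_props(4)[OF k] elim(2) by linarith
      then have kK: "k \<ge> K" by simp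
      have "\<bar>real k / real n - t\<bar> \<le> \<delta>"
      proof -
        have "\<bar>real k - t * real n\<bar> \<le> 1 + \<gamma> * real n" using J_props(2,3)[OF k] \<gamma>(1) by (simp add: abs_if)
        also have "1 \<le> \<delta> / 2 * real n" using elim(1) \<delta> by (simp add: field_simps)
        also have "\<gamma> * real n \<le> \<delta> / 2 * real n" using \<gamma> by (intro mult_right_mono) auto
        finally have "\<bar>real k - t * real n\<bar> \<le> \<delta> * real n" by simp
        moreover have "real k / real n - t = (real k - t * real n) / real n" using n by (simp add: field_simps)
        ultimately show ?thesis using n by (simp add: abs_divide pos_divide_le_eq)
      qed
      then have W: "real n * (U - \<epsilon> / 8) \<le> real k * ln \<rho> - \<alpha> * (real k * ln (real k) - real k) + \<alpha> * real k * ln (real n)"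
        using elim by (intro win) auto
      have kn: "\<epsilon> / 8 * real k \<le> \<epsilon> / 8 * real n" using J_props(1)[OF k] \<epsilon> by simp
      have "exp (real n * (U - \<epsilon> / 4)) \<le> exp ((- \<alpha> * (real k * ln (real k) - real k) - \<beta> * real k - \<epsilon> / 8 * real k)
          + ((\<beta> * real k + \<alpha> * real k * ln (real n)) + real k * ln \<rho>))"
        unfolding exp_le_cancel_iff using W kn by (simp add: algebra_simps)
      also have "\<dots> = exp (- \<alpha> * (real k * ln (real k) - real k) - \<beta> * real k - \<epsilon> / 8 * real k) * ((c n) ^ k * \<rho> ^ k)"
      proof -
        have "(c n) ^ k = exp (\<beta> * real k + \<alpha> * real k * ln (real n))"
          unfolding c_def by (rule scale_power) (use elim in simp)
        moreover have "\<rho> ^ k = exp (real k * ln \<rho>)" using \<rho> by (simp add: exp_of_nat_mult)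
        ultimately show ?thesis by (simp only: exp_add[symmetric])
      qed
      also have "\<dots> \<le> norm (w k) * ((c n) ^ k * \<rho> ^ k)"
        using K[OF kK] \<rho> by (intro mult_right_mono) (auto simp: c_def)
      finally show ?thesis by (simp add: mult.assoc)
    qed
    have "measure M (E n) \<le> Q ^ card (J n)"
      unfolding E_def
    proof (rule prob_pinned[OF P ind id _ _ _ A_sets, where d = d])
      fix x y k assume xy: "x \<in> A n" "y \<in> A n" and eq: "\<And>i. i \<in> {..n} - J n \<Longrightarrow> x i = y i" and k: "k \<in> J n"
      \<comment> \<open>Two configurations in \<open>A n\<close> agreeing off the window differ by a
        polynomial with coefficients \<open>D k\<close> supported on the window, and that difference
        is at most \<open>2 * B n\<close> at all sample points.\<close>
      define D where "D k = (x k - y k) * w k * of_real (c n) ^ k" for k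
      have sumD: "(\<Sum>k\<in>{k0 n..k0 n + m n}. D k * z n l ^ k) = S n x l - S n y l" for l
      proof -
        have "S n x l - S n y l = (\<Sum>k\<le>n. D k * z n l ^ k)"
          unfolding S_def sum_subtractf[symmetric] D_def by (simp add: power_mult_distrib algebra_simps)
        also have "\<dots> = (\<Sum>k\<in>J n. D k * z n l ^ k)"
          by (rule sum.mono_neutral_right) (use J_props(1)[of _ n] eq in \<open>auto simp: D_def\<close>)
        finally show ?thesis by (simp add: J_def)
      qed
      have "norm (D k) * norm b ^ k \<le> real (Suc (m n)) * (2 * B n) * (norm b / (norm b - r)) ^ k0 n * (2 * norm b / r) ^ m n"
      proof (rule sparse_coeff_bound[where N = "Suc n"])
        show "m n < Suc n" using J_props(1)[of "k0 n + m n" n] by (simp add: J_def)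
        fix l assume l: "l < Suc n"
        have "norm (S n x l - S n y l) \<le> norm (S n x l) + norm (S n y l)" by (rule norm_triangle_ineq4)
        also have "\<dots> \<le> 2 * B n" using xy l by (auto simp: A_def less_imp_le intro!: add_mono[of _ "B n" _ "B n", simplified])
        finally show "norm (\<Sum>k\<in>{k0 n..k0 n + m n}. D k * (b + of_real r * exp (2 * of_real pi * \<i> * of_nat l / of_nat (Suc n))) ^ k) \<le> 2 * B n"
          unfolding z_def[symmetric] sumD .
      qed (use r \<rho>_def k in \<open>auto simp: B_def J_def\<close>)
      also have "\<dots> \<le> (real n + 1) * (2 * B n) * exp (\<epsilon> / 8 * real n) * exp (\<epsilon> / 8 * real n)"
      proof (intro mult_mono)
        show "real (Suc (m n)) \<le> real n + 1" using J_props(1)[of "k0 n + m n" n] by (simp add: J_def)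
        have "(norm b / (norm b - r)) ^ k0 n \<le> exp (\<epsilon> / 8) ^ k0 n"
          using ratio r by (intro power_mono) (auto simp: \<rho>_def)
        also have "\<dots> \<le> exp (\<epsilon> / 8) ^ n"
          using J_props(1)[of "k0 n" n] \<epsilon> by (intro power_increasing) (auto simp: J_def)
        also have "\<dots> = exp (\<epsilon> / 8 * real n)" by (simp add: exp_of_nat_mult[symmetric] mult.commute)
        finally show "(norm b / (norm b - r)) ^ k0 n \<le> exp (\<epsilon> / 8 * real n)" .
        have "(2 * norm b / r) ^ m n = exp (real (m n) * \<Lambda>)"
          using \<Lambda>(2) by (simp add: exp_of_nat_mult \<rho>_def)
        also have "real (m n) * \<Lambda> \<le> \<gamma> * real n * \<Lambda>" using m_le(1)[of n] \<Lambda> by (intro mult_right_mono) auto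
        also have "\<gamma> * real n * \<Lambda> = (\<gamma> * \<Lambda>) * real n" by simp
        also have "\<dots> \<le> \<epsilon> / 8 * real n" using \<gamma>\<Lambda> by (intro mult_right_mono) auto
        finally show "(2 * norm b / r) ^ m n \<le> exp (\<epsilon> / 8 * real n)" by simp
      qed (use r \<rho>_def in \<open>auto simp: B_def intro!: mult_nonneg_nonneg\<close>)
      finally have 1: "norm (D k) * \<rho> ^ k \<le> (real n + 1) * (2 * B n) * exp (\<epsilon> / 8 * real n) * exp (\<epsilon> / 8 * real n)"
        by (simp add: \<rho>_def)
      have "norm (x k - y k) * exp (real n * (U - \<epsilon> / 4)) \<le> norm (x k - y k) * (norm (w k) * (c n) ^ k * \<rho> ^ k)"
        by (intro mult_left_mono v k) auto
      also have "\<dots> = norm (D k) * \<rho> ^ k"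
        by (simp add: D_def norm_mult norm_power c_def mult.assoc)
      also note 1
      also have "(real n + 1) * (2 * B n) * exp (\<epsilon> / 8 * real n) * exp (\<epsilon> / 8 * real n)
         = (2 * (real n + 1) * exp (- real n * \<epsilon> / 2)) * exp (real n * (U - \<epsilon> / 4))"
        by (simp add: B_def exp_add[symmetric] mult.assoc) (simp add: algebra_simps)
      finally have "norm (x k - y k) \<le> 2 * (real n + 1) * exp (- real n * \<epsilon> / 2)"
        by simp
      then show "dist (x k) (y k) \<le> d" using elim(3) by (simp add: dist_norm)
    qed (use Q J_props(1)[of _ n] in auto)
    \<comment> \<open>The closed window has one index more than \<open>m n\<close>, which
      compensates the rounding: its size is at least \<open>\<gamma> * n\<close>, and the bound
      becomes a geometric sequence.\<close>
    also have "card (J n) = m n + 1" by (simp add: J_def)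
    also have "Q ^ (m n + 1) = Q powr real (m n + 1)" by (rule powr_realpow[OF Q(1), symmetric])
    also have "\<dots> \<le> Q powr (\<gamma> * real n)"
      using Q m_le(2)[of n] by (intro powr_mono') auto
    also have "\<dots> = (Q powr \<gamma>) ^ n" using Q by (simp add: powr_powr[symmetric] powr_realpow)
    finally show ?case .
  qed
  have "summable (\<lambda>n. (Q powr \<gamma>) ^ n)"
    using Q \<gamma>(1) powr_less_mono2[of \<gamma> Q 1] by (intro summable_geometric) simp
  then have "summable (\<lambda>n. measure M (E n))"
    by (rule summable_comparison_test_ev[rotated]) (use ev in simp)
  then have "AE \<omega> in M. \<forall>\<^sub>F n in sequentially. \<omega> \<in> space M - E n"
    by (intro borel_cantelli_AE1) (auto simp: emeasure_eq_measure)
  then show ?thesis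
  proof eventually_elim
    case (elim \<omega>)
    then show ?case
    proof eventually_elim
      case (elim n)
      have "(\<lambda>k\<in>{..n}. \<xi> k \<omega>) \<in> space (PiM {..n} (\<lambda>_. borel))" by (simp add: space_PiM)
      then obtain l where l: "norm (S n (\<lambda>k\<in>{..n}. \<xi> k \<omega>) l) \<ge> B n"
        using elim by (auto simp: E_def A_def not_less)
      have "S n (\<lambda>k\<in>{..n}. \<xi> k \<omega>) l = (\<Sum>k\<le>n. \<xi> k \<omega> * w k * (of_real (exp \<beta> * real n powr \<alpha>) * z n l) ^ k)"
        by (simp add: S_def c_def)
      moreover have "z n l \<in> cball b \<eta>"
        using r by (simp add: z_def dist_norm norm_mult norm_exp_eq_Re)
      ultimately show ?case using l by (auto simp: B_def U_def \<rho>_def)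
    qed
  qed
qed

section \<open>Zero measures\<close>

lemma integral_scaled_zero_measure:
  fixes \<phi> :: "complex \<Rightarrow> real"
  assumes G: "G \<noteq> 0" and c: "c > 0" and n: "n > 0" and [measurable]: "\<phi> \<in> borel_measurable borel"
  shows "(\<integral>z. \<phi> z \<partial>scale_measure (ennreal (1 / real n)) (dilate c (zero_measure G)))
    = (\<Sum>z | poly G z = 0. real (order z G) / real n * \<phi> (z / of_real c))"
proof -
  let ?Z = "{z. poly G z = 0}"
  have fin: "finite ?Z" using G by (rule poly_roots_finite)
  let ?P = "point_measure ?Z (\<lambda>z. ennreal (real (order z G) / real n))"
  have m: "(\<lambda>z. z / of_real c) \<in> ?P \<rightarrow>\<^sub>M borel"
    by (simp add: measurable_point_measure_eq1)
  have "scale_measure (ennreal (1 / real n)) (dilate c (zero_measure G)) = distr ?P borel (\<lambda>z. z / of_real c)"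
  proof (rule measure_eqI)
    fix B assume "B \<in> sets (scale_measure (ennreal (1 / real n)) (dilate c (zero_measure G)))"
    then have B[measurable]: "B \<in> sets borel" by (simp add: dilate_def)
    have pre: "(\<lambda>z. z / of_real c) -` B \<in> sets borel"
      using measurable_sets[of "\<lambda>z. z / of_real c" borel borel B] by simp
    have "emeasure (dilate c (zero_measure G)) B = emeasure (zero_measure G) ((\<lambda>z. z / of_real c) -` B)"
      unfolding dilate_def by (subst emeasure_distr) (auto cong: measurable_cong_sets)
    also have "\<dots> = (\<Sum>z\<in>?Z. of_nat (order z G) * indicator B (z / of_real c))"
      unfolding emeasure_zero_measure[OF G pre] by (simp add: indicator_def)
    finally have "ennreal (1 / real n) * emeasure (dilate c (zero_measure G)) B
      = (\<Sum>z\<in>?Z. ennreal (1 / real n) * (of_nat (order z G) * indicator B (z / of_real c)))"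
      by (simp add: sum_distrib_left)
    also have "\<dots> = (\<Sum>z\<in>?Z. if z / of_real c \<in> B then ennreal (real (order z G) / real n) else 0)"
      by (intro sum.cong) (auto simp: ennreal_of_nat_eq_real_of_nat simp flip: ennreal_mult)
    also have "\<dots> = (\<Sum>z\<in>(\<lambda>z. z / of_real c) -` B \<inter> ?Z. ennreal (real (order z G) / real n))"
      using fin by (simp add: sum.If_cases Int_commute vimage_def Collect_conj_eq)
    also have "\<dots> = emeasure (distr ?P borel (\<lambda>z. z / of_real c)) B"
      using fin by (subst emeasure_distr[OF m B]) (simp add: emeasure_point_measure_finite space_point_measure)
    finally show "emeasure (scale_measure (ennreal (1 / real n)) (dilate c (zero_measure G))) B
      = emeasure (distr ?P borel (\<lambda>z. z / of_real c)) B" by simp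
  qed (simp add: dilate_def)
  then show ?thesis
    using fin by (simp add: integral_distr[OF m] lebesgue_integral_point_measure_finite)
qed

lemma sum_order_le_degree:
  fixes p :: "complex poly"
  assumes "p \<noteq> 0" shows "(\<Sum>z | poly p z = 0. order z p) \<le> degree p"
proof -
  have "degree p = degree (\<Prod>z|poly p z = 0. [:-z, 1:] ^ order z p)"
    using assms by (subst complex_poly_decompose[of p, symmetric]) simp
  also have "\<dots> = (\<Sum>z | poly p z = 0. degree ([:-z, 1:] ^ order z p))"
    by (rule degree_prod_eq_sum_degree) simp
  also have "\<dots> = (\<Sum>z | poly p z = 0. order z p)" by (simp add: degree_linear_power)
  finally show ?thesis by simp
qed

lemma ln_norm_poly_dilated:
  fixes p :: "complex poly"
  assumes p: "poly p (of_real c * z) \<noteq> 0" and c: "c > 0"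
  shows "ln (norm (poly p (of_real c * z))) = ln (norm (lead_coeff p))
    + (\<Sum>y | poly p y = 0. real (order y p) * (ln c + ln (norm (z - y / of_real c))))"
proof -
  have p0: "p \<noteq> 0" using p by auto
  have fin: "finite {y. poly p y = 0}" using p0 by (rule poly_roots_finite)
  have ne: "z \<noteq> y / of_real c" if "poly p y = 0" for y using that p c by auto
  have e: "norm (of_real c * z - y) = c * norm (z - y / of_real c)" for y
  proof -
    have "of_real c * z - y = of_real c * (z - y / of_real c)" using c by (simp add: algebra_simps)
    then show ?thesis using c by (simp add: norm_mult del: right_diff_distrib)
  qed
  have "poly p (of_real c * z) = lead_coeff p * (\<Prod>y | poly p y = 0. (of_real c * z - y) ^ order y p)"
    by (subst (1) complex_poly_decompose[of p, symmetric]) (simp add: poly_prod)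
  then have "norm (poly p (of_real c * z)) = norm (lead_coeff p) * (\<Prod>y | poly p y = 0. (c * norm (z - y / of_real c)) ^ order y p)"
    by (simp add: norm_mult prod_norm[symmetric] norm_power e)
  also have "ln \<dots> = ln (norm (lead_coeff p)) + ln (\<Prod>y | poly p y = 0. (c * norm (z - y / of_real c)) ^ order y p)"
    using p0 c ne by (intro ln_mult_pos) (auto intro!: prod_pos)
  also have "ln (\<Prod>y | poly p y = 0. (c * norm (z - y / of_real c)) ^ order y p)
      = (\<Sum>y | poly p y = 0. ln ((c * norm (z - y / of_real c)) ^ order y p))"
    using c ne by (intro ln_prod) (auto simp: fin)
  also have "\<dots> = (\<Sum>y | poly p y = 0. real (order y p) * (ln c + ln (norm (z - y / of_real c))))"
    using c ne by (intro sum.cong) (auto simp: ln_realpow ln_mult)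
  finally show ?thesis .
qed

text \<open>Factorisation into linear factors presents \<open>1 / n * ln\<close> of the dilated
  polynomial as a discrete potential off its zeros. The total mass is at most 1, since
  multiplicities sum to at most the degree.\<close>

lemma zeros_converge:
  fixes P :: "nat \<Rightarrow> complex poly" and c :: "nat \<Rightarrow> real" and \<phi> :: "complex \<Rightarrow> real"
  assumes \<alpha>: "\<alpha> > 0" and deg: "\<And>n. degree (P n) \<le> n" and c: "\<And>n. n > 0 \<Longrightarrow> c n > 0"
    and up: "\<And>\<epsilon>. \<epsilon> > 0 \<Longrightarrow> \<forall>\<^sub>F n in sequentially. \<forall>z. norm (poly (P n) (of_real (c n) * z))
       \<le> exp (real n * (limit_potential \<alpha> (norm z) + \<epsilon>))"
    and low: "\<And>j i k \<epsilon> \<eta>. \<epsilon> > 0 \<Longrightarrow> \<eta> > 0 \<Longrightarrow> \<forall>\<^sub>F n in sequentially. \<exists>z\<in>cball (grid_point j i k) \<eta>.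
       norm (poly (P n) (of_real (c n) * z)) \<ge> exp (real n * (limit_potential \<alpha> (norm (grid_point j i k)) - \<epsilon>))"
    and \<phi>: "continuous_on UNIV \<phi>" "compact (closure {z. \<phi> z \<noteq> 0})"
  shows "(\<lambda>n. \<integral>z. \<phi> z \<partial>scale_measure (ennreal (1 / real n)) (dilate (c n) (zero_measure (P n))))
    \<longlonglongrightarrow> (\<integral>z. \<phi> z \<partial>limit_measure \<alpha>)"
proof -
  \<comment> \<open>For \<open>n = 0\<close> or a zero polynomial the empty configuration with
    constant 0 is substituted, so that finiteness and the mass bound hold for every
    \<open>n\<close>.\<close>
  define good where "good n \<longleftrightarrow> n > 0 \<and> P n \<noteq> 0" for n
  define Y where "Y n = {y. poly (P n) y = 0}" for n
  define Z where "Z n = (if good n then (\<lambda>y. y / of_real (c n)) ` Y n else {})" for n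
  define m where "m n z = real (order (of_real (c n) * z) (P n)) / real n" for n z
  \<comment> \<open>Everything independent of \<open>z\<close>: the leading coefficient, and a
    factor \<open>c n\<close> for each zero with multiplicity.\<close>
  define A where "A n = (if good n then (ln (norm (lead_coeff (P n))) + (\<Sum>y\<in>Y n. real (order y (P n)) * ln (c n))) / real n else 0)" for n
  define u where "u n = discrete_potential (A n) (Z n) (m n)" for n
  have cg: "c n > 0" if "good n" for n using that c by (simp add: good_def)
  have finY: "finite (Y n)" if "good n" for n
    using that unfolding Y_def good_def by (intro poly_roots_finite) auto
  have sumZ: "(\<Sum>z\<in>Z n. m n z * f z) = (\<Sum>y\<in>Y n. real (order y (P n)) / real n * f (y / of_real (c n)))"
    if g: "good n" for n and f :: "complex \<Rightarrow> real"
  proof -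
    have inj: "inj_on (\<lambda>y. y / complex_of_real (c n)) (Y n)"
      using cg[OF g] by (auto simp: inj_on_def)
    have "(\<Sum>z\<in>Z n. m n z * f z) = (\<Sum>y\<in>Y n. m n (y / of_real (c n)) * f (y / of_real (c n)))"
      using g by (simp add: Z_def sum.reindex[OF inj] o_def)
    then show ?thesis using cg[OF g] by (simp add: m_def)
  qed
  have u_eq: "u n z = ln (norm (poly (P n) (of_real (c n) * z))) / real n"
    if g: "good n" and z: "poly (P n) (of_real (c n) * z) \<noteq> 0" for n z
  proof -
    have "ln (norm (poly (P n) (of_real (c n) * z))) / real n
       = (ln (norm (lead_coeff (P n))) + (\<Sum>y\<in>Y n. real (order y (P n)) * ln (c n))) / real n
         + (\<Sum>y\<in>Y n. real (order y (P n)) / real n * ln (norm (z - y / of_real (c n))))"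
      unfolding ln_norm_poly_dilated[OF z cg[OF g]] Y_def
      by (simp add: distrib_left sum.distrib add_divide_distrib sum_divide_distrib)
    also have "\<dots> = u n z"
      using sumZ[OF g, of "\<lambda>y. ln (norm (z - y))"] g by (simp add: u_def discrete_potential_def A_def)
    finally show ?thesis ..
  qed
  have notZ: "z \<notin> Z n \<longleftrightarrow> poly (P n) (of_real (c n) * z) \<noteq> 0" if g: "good n" for n z
    using g cg[OF g] by (auto simp: Z_def Y_def image_iff)
  have pos: "\<forall>\<^sub>F n in sequentially. n > (0::nat)" by (rule eventually_gt_at_top)
  \<comment> \<open>The lower bound near a single grid point already rules out the zero polynomial
    for large \<open>n\<close>.\<close>
  have ev_good: "\<forall>\<^sub>F n in sequentially. good n"
    using low[of 1 1 0 0 0, OF zero_less_one zero_less_one] pos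
  proof eventually_elim
    case (elim n)
    then obtain z where "norm (poly (P n) (of_real (c n) * z)) \<ge> exp (real n * (limit_potential \<alpha> (norm (grid_point 0 0 0)) - 1))"
      by auto
    then have "norm (poly (P n) (of_real (c n) * z)) > 0" by (meson exp_gt_zero order_less_le_trans)
    then show ?case using elim by (auto simp: good_def)
  qed
  have "(\<lambda>n. \<Sum>z\<in>Z n. m n z * \<phi> z) \<longlonglongrightarrow> (\<integral>z. \<phi> z \<partial>limit_measure \<alpha>)"
  proof (rule discrete_measures_converge[OF \<alpha> u_def _ _ _ _ _ \<phi>])
    show "finite (Z n)" for n using finY by (simp add: Z_def)
    show "0 \<le> m n z" for n z by (simp add: m_def)
    show "sum (m n) (Z n) \<le> 1" for n
    proof (cases "good n")
      case True
      have "sum (m n) (Z n) = real (\<Sum>y\<in>Y n. order y (P n)) / real n"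
        using sumZ[OF True, of "\<lambda>_. 1"] by (simp add: sum_divide_distrib)
      also have "real (\<Sum>y\<in>Y n. order y (P n)) \<le> real n"
        using sum_order_le_degree[of "P n"] deg[of n] True unfolding of_nat_le_iff Y_def good_def by linarith
      finally show ?thesis using True by (simp add: good_def divide_right_mono)
    qed (simp add: Z_def)
  next
    fix R \<epsilon> :: real assume \<epsilon>: "\<epsilon> > 0"
    show "\<forall>\<^sub>F n in sequentially. \<forall>z. norm z \<le> R \<longrightarrow> z \<notin> Z n \<longrightarrow> u n z \<le> limit_potential \<alpha> (norm z) + \<epsilon>"
      using up[OF \<epsilon>] ev_good
    proof eventually_elim
      case (elim n)
      show ?case
      proof (intro allI impI)
        fix z assume "z \<notin> Z n"
        then have nz: "poly (P n) (of_real (c n) * z) \<noteq> 0" using notZ elim by blast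
        have "ln (norm (poly (P n) (of_real (c n) * z))) \<le> ln (exp (real n * (limit_potential \<alpha> (norm z) + \<epsilon>)))"
          using elim(1) nz by (intro ln_mono) auto
        then show "u n z \<le> limit_potential \<alpha> (norm z) + \<epsilon>"
          using elim(2) by (simp add: u_eq[OF elim(2) nz] good_def pos_divide_le_eq mult.commute)
      qed
    qed
  next
    fix j i k and \<epsilon> \<eta> :: real assume "\<epsilon> > 0" "\<eta> > 0"
    from low[OF this, of j i k] ev_good
    show "\<forall>\<^sub>F n in sequentially. \<exists>z\<in>cball (grid_point j i k) \<eta>. z \<notin> Z n \<and> limit_potential \<alpha> (norm (grid_point j i k)) - \<epsilon> \<le> u n z"
    proof eventually_elim
      case (elim n)
      then obtain z where z: "z \<in> cball (grid_point j i k) \<eta>"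
        "norm (poly (P n) (of_real (c n) * z)) \<ge> exp (real n * (limit_potential \<alpha> (norm (grid_point j i k)) - \<epsilon>))"
        by auto
      then have "norm (poly (P n) (of_real (c n) * z)) > 0" by (meson exp_gt_zero order_less_le_trans)
      then have nz: "poly (P n) (of_real (c n) * z) \<noteq> 0" by auto
      have "ln (exp (real n * (limit_potential \<alpha> (norm (grid_point j i k)) - \<epsilon>))) \<le> ln (norm (poly (P n) (of_real (c n) * z)))"
        using z(2) by (intro ln_mono) auto
      then have "limit_potential \<alpha> (norm (grid_point j i k)) - \<epsilon> \<le> u n z"
        using elim(2) by (simp add: u_eq[OF elim(2) nz] good_def pos_le_divide_eq mult.commute)
      then show ?case using z(1) notZ[OF elim(2)] nz by blast
    qed
  qed
  moreover have "\<forall>\<^sub>F n in sequentially. (\<Sum>z\<in>Z n. m n z * \<phi> z)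
      = (\<integral>z. \<phi> z \<partial>scale_measure (ennreal (1 / real n)) (dilate (c n) (zero_measure (P n))))"
    using ev_good
  proof eventually_elim
    case (elim n)
    have "\<phi> \<in> borel_measurable borel" using \<phi>(1) by (rule borel_measurable_continuous_onI)
    then show ?case
      using integral_scaled_zero_measure[of "P n" "c n" n \<phi>] sumZ[OF elim, of \<phi>] cg[OF elim] elim
      by (simp add: good_def Y_def)
  qed
  ultimately show ?thesis by (rule Lim_transform_eventually)
qed

theorem theorem2p3:
  fixes M :: "'a measure" and \<xi> :: "nat \<Rightarrow> 'a \<Rightarrow> complex"
    and w :: "nat \<Rightarrow> complex" and \<alpha> \<beta> :: real
  assumes "prob_space M"
    and "prob_space.indep_vars M (\<lambda>_. borel) \<xi> UNIV"
    and "\<And>k. distr M borel (\<xi> k) = distr M borel (\<xi> 0)"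
    and "nondegenerate M (\<xi> 0)"
    and "integrable M (\<lambda>\<omega>. ln (1 + norm (\<xi> 0 \<omega>)))"
    and "\<alpha> > 0"
    and "(\<lambda>k. ln (norm (w k)) - (- \<alpha> * (real k * ln (real k) - real k) - \<beta> * real k))
           \<in> o(\<lambda>k. real k)"
  shows "prob_space (limit_measure \<alpha>) \<and>
    converges_as M
      (\<lambda>n \<omega>. scale_measure (ennreal (1 / real n))
         (dilate (exp \<beta> * real n powr \<alpha>) (zero_measure (random_poly \<xi> w n \<omega>))))
      (limit_measure \<alpha>)"
proof (rule conjI)
  interpret prob_space M by fact
  show "prob_space (limit_measure \<alpha>)" by (rule prob_space_limit_measure) fact
  have rv: "\<xi> k \<in> borel_measurable M" for k using assms(2) by (auto simp: indep_vars_def)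
  \<comment> \<open>Reciprocals of integers in place of all tolerances, and the countable grid,
    leave countably many almost sure events; the exceptional set obtained is common to all test
    functions.\<close>
  let ?e = "\<lambda>p::nat. 1 / real (Suc p)"
  let ?W = "\<lambda>n \<omega> z. norm (\<Sum>k\<le>n. \<xi> k \<omega> * w k * (of_real (exp \<beta> * real n powr \<alpha>) * z) ^ k)"
  have "AE \<omega> in M. \<forall>\<^sub>F k in sequentially. norm (\<xi> k \<omega>) \<le> exp (?e p * real k)" for p
    by (rule AE_log_moment_subexponential[where \<xi> = \<xi>, OF assms(1) rv assms(3,5)]) simp
  then have 1: "AE \<omega> in M. \<forall>p. \<forall>\<^sub>F k in sequentially. norm (\<xi> k \<omega>) \<le> exp (?e p * real k)"
    unfolding AE_all_countable by blast
  have "AE \<omega> in M. \<forall>\<^sub>F n in sequentially. \<exists>z\<in>cball (grid_point j i k) (?e q).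
      ?W n \<omega> z \<ge> exp (real n * (limit_potential \<alpha> (norm (grid_point j i k)) - ?e p))" for j i k p q
    by (rule AE_poly_lower_bound[OF assms(1,2,3,4,6,7) grid_point_nonzero]) auto
  then have 2: "AE \<omega> in M. \<forall>j i k p q. \<forall>\<^sub>F n in sequentially. \<exists>z\<in>cball (grid_point j i k) (?e q).
      ?W n \<omega> z \<ge> exp (real n * (limit_potential \<alpha> (norm (grid_point j i k)) - ?e p))"
    unfolding AE_all_countable by blast
  show "converges_as M
      (\<lambda>n \<omega>. scale_measure (ennreal (1 / real n))
         (dilate (exp \<beta> * real n powr \<alpha>) (zero_measure (random_poly \<xi> w n \<omega>))))
      (limit_measure \<alpha>)"
    unfolding converges_as_def
  proof (intro allI impI)
    fix \<phi> :: "complex \<Rightarrow> real"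
    assume \<phi>: "continuous_on UNIV \<phi>" "compact (closure {z. \<phi> z \<noteq> 0})"
    show "AE \<omega> in M. (\<lambda>n. \<integral>z. \<phi> z \<partial>scale_measure (ennreal (1 / real n))
         (dilate (exp \<beta> * real n powr \<alpha>) (zero_measure (random_poly \<xi> w n \<omega>)))) \<longlonglongrightarrow> (\<integral>z. \<phi> z \<partial>limit_measure \<alpha>)"
      using 1 2
    proof eventually_elim
      case (elim \<omega>)
      have x: "\<forall>\<^sub>F k in sequentially. norm (\<xi> k \<omega>) \<le> exp (\<epsilon> * real k)" if \<epsilon>: "\<epsilon> > 0" for \<epsilon>
      proof -
        obtain p where p: "?e p < \<epsilon>" using nat_approx_posE[OF \<epsilon>] .
        show ?thesis using elim(1)[rule_format, of p]
        proof eventually_elim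
          case (elim k)
          have "?e p * real k \<le> \<epsilon> * real k" using p by (intro mult_right_mono) auto
          then have "exp (?e p * real k) \<le> exp (\<epsilon> * real k)" by (simp only: exp_le_cancel_iff)
          then show ?case using elim by linarith
        qed
      qed
      show ?case
      proof (rule zeros_converge[OF assms(6) _ _ _ _ \<phi>])
        show "degree (random_poly \<xi> w n \<omega>) \<le> n" for n
          unfolding random_poly_def
          by (rule degree_sum_le) (auto intro: order_trans[OF degree_monom_le])
        show "exp \<beta> * real n powr \<alpha> > 0" if "n > 0" for n using that by simp
      next
        fix \<epsilon> :: real assume "\<epsilon> > 0"
        then show "\<forall>\<^sub>F n in sequentially. \<forall>z. norm (poly (random_poly \<xi> w n \<omega>) (of_real (exp \<beta> * real n powr \<alpha>) * z))
            \<le> exp (real n * (limit_potential \<alpha> (norm z) + \<epsilon>))"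
          unfolding poly_random_poly by (rule poly_upper_bound[OF assms(7,6) _ x])
      next
        fix j i k and \<epsilon> \<eta> :: real assume \<epsilon>: "\<epsilon> > 0" and \<eta>: "\<eta> > 0"
        obtain p where p: "?e p < \<epsilon>" using nat_approx_posE[OF \<epsilon>] .
        obtain q where q: "?e q < \<eta>" using nat_approx_posE[OF \<eta>] .
        let ?b = "grid_point j i k"
        show "\<forall>\<^sub>F n in sequentially. \<exists>z\<in>cball ?b \<eta>. exp (real n * (limit_potential \<alpha> (norm ?b) - \<epsilon>))
            \<le> norm (poly (random_poly \<xi> w n \<omega>) (of_real (exp \<beta> * real n powr \<alpha>) * z))"
          using elim(2)[rule_format, of j i k q p]
        proof eventually_elim
          case (elim n)
          then obtain z where z: "z \<in> cball ?b (?e q)"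
            "?W n \<omega> z \<ge> exp (real n * (limit_potential \<alpha> (norm ?b) - ?e p))" by blast
          have "exp (real n * (limit_potential \<alpha> (norm ?b) - \<epsilon>)) \<le> exp (real n * (limit_potential \<alpha> (norm ?b) - ?e p))"
            unfolding exp_le_cancel_iff using p by (intro mult_left_mono) auto
          also note z(2)
          finally show ?case using z(1) q unfolding poly_random_poly by (intro bexI[of _ z]) auto
        qed
      qed
    qed
  qed
qed

end
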